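(* Let $k$ be an algebraically closed field with $\operatorname{char}(k)\ne2$ and let $A=A(\alpha,\beta,\gamma)$ be a 4-dimensional Sklyanin algebra over $k$ with associated automorphism $\sigma$. Assume $|\sigma|=\infty$. Then the point scheme $\Gamma\subset\mathbb{P}^3_k$ of the cocycle twist $A^{G,\mu}$ (described in the context) has the form $$\Gamma=\Gamma'\cup\{e_0,e_1,e_2,e_3\},$$ where $e_0=(1,0,0,0)$, $e_1=(0,1,0,0)$, $e_2=(0,0,1,0)$, $e_3=(0,0,0,1)$ and $\Gamma'$ is the set of 16 points listed in the context. Thus $\Gamma$ contains 20 points, each of which has multiplicity 1.
   Context: Write $[x,y]=xy-yx$, $[x,y]_+=xy+yx$. The parameters satisfy $\alpha+\beta+\gamma+\alpha\beta\gamma=0$, $\{\alpha,\beta,\gamma\}\cap\{0,\pm1\}=\emptyset$, and $A$ is generated by $x_0,\dots,x_3$ (degree 1) with relations $[x_0,x_1]-\alpha[x_2,x_3]_+$, $[x_0,x_1]_+-[x_2,x_3]$, $[x_0,x_2]-\beta[x_3,x_1]_+$, $[x_0,x_2]_+-[x_3,x_1]$, $[x_0,x_3]-\gamma[x_1,x_2]_+$, $[x_0,x_3]_+-[x_1,x_2]$. Point modules (cyclic $\mathbb{N}$-graded right modules with Hilbert series $1/(1-t)$) over $A$ are parameterised by the elliptic curve $E\subset\mathbb{P}^3_k$: $y_0^2+y_1^2+y_2^2+y_3^2=0$, $y_3^2+\frac{1-\gamma}{1+\alpha}y_1^2+\frac{1+\gamma}{1-\beta}y_2^2=0$, and the four points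 $e_j$; $\sigma$ is the translation automorphism of $E$ defined by $M_p[1]_{\ge0}\cong M_{\sigma(p)}$, where $M_p$ is the point module of $p$. $G=\langle g_1,g_2\rangle\cong(C_2)^2$ acts on $A$ by $x_0^{g_1}=x_0$, $x_1^{g_1}=x_1$, $x_2^{g_1}=-x_2$, $x_3^{g_1}=-x_3$, $x_i^{g_2}=(-1)^ix_i$, inducing a $G$-grading with $x_0\in A_e$, $x_1\in A_{g_1}$, $x_2\in A_{g_2}$, $x_3\in A_{g_1g_2}$; with $\mu(g_1^pg_2^q,g_1^rg_2^s)=(-1)^{ps}$, $A^{G,\mu}$ is $A$ with multiplication $a\ast_\mu b=\mu(g,h)ab$ for $a\in A_g,b\in A_h$. Equivalently, it has generators $v_0,\dots,v_3$ and relations $[v_0,v_1]-\alpha[v_2,v_3]$, $[v_0,v_1]_+-[v_2,v_3]_+$, $[v_0,v_2]-\beta[v_3,v_1]$, $[v_0,v_2]_+-[v_3,v_1]_+$, $[v_0,v_3]+\gamma[v_1,v_2]$, $[v_0,v_3]_++[v_1,v_2]_+$. The point scheme of $A^{G,\mu}$ is the projective scheme parameterising its point modules (the inverse limit of the schemes parameterising truncated point modules). It equals $\pi_1(\Gamma_2)\subset\mathbb{P}^3_k$, where $\Gamma_2\subset\mathbb{P}^3_k\times\mathbb{P}^3_k$ is the zero scheme of the multilinearisations of the six relations (replace each monomial $v_iv_j$ by $v_{i1}v_{j2}$) and $\pi_1$, the first projection, maps $\Gamma_2$ isomorphically onto it. Fix square roots $\alpha^{1/2},\beta^{1/2},\gamma^{1/2}$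 (with $(\alpha\beta)^{1/2}=\alpha^{1/2}\beta^{1/2}$, etc.) and $i\in k$ with $i^2=-1$. $\Gamma'$ consists of the 16 points (upper signs together, lower signs together): $(1,\pm i,\pm i,1)$, $(1,\pm i,\mp i,-1)$, $(1,-(\beta\gamma)^{-1/2},\mp\gamma^{-1/2},\mp\beta^{-1/2})$, $(1,(\beta\gamma)^{-1/2},\mp\gamma^{-1/2},\pm\beta^{-1/2})$, $(1,\pm i\gamma^{-1/2},(\alpha\gamma)^{-1/2},\pm i\alpha^{-1/2})$, $(1,\mp i\gamma^{-1/2},-(\alpha\gamma)^{-1/2},\pm i\alpha^{-1/2})$, $(1,\pm\beta^{-1/2},\pm i\alpha^{-1/2},i(\alpha\beta)^{-1/2})$, $(1,\pm\beta^{-1/2},\mp i\alpha^{-1/2},-i(\alpha\beta)^{-1/2})$. *)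

theory Defs
  imports
    "HOL-Library.Poly_Mapping"
    "HOL-Library.Numeral_Type"
    "HOL-Library.Product_Plus"
    "HOL-Library.Z2"
    "HOL-Computational_Algebra.Polynomial"
    "HOL-Computational_Algebra.Fraction_Field"
    "HOL-Algebra.QuotRing"
    "HOL-Algebra.Embedded_Algebras"
begin

section \<open>The free algebra on four generators\<close>

text \<open>
  Indices \<open>0, 1, 2, 3\<close> are elements of the four-element type \<open>4\<close>. With words as an
  additive monoid under concatenation, finitely supported functions on words form the
  free algebra \<open>k\<langle>x\<^sub>0, \<dots>, x\<^sub>3\<rangle>\<close> under the convolution product of
  \<^theory>\<open>HOL-Library.Poly_Mapping\<close>.
\<close>

instantiation list :: (type) monoid_add
begin
definition zero_list :: "'a list" where "zero_list = []"
definition plus_list :: "'a list \<Rightarrow> 'a list \<Rightarrow> 'a list" where "plus_list u v = u @ v"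
instance by standard (simp_all add: zero_list_def plus_list_def)
end

type_synonym 'k free_alg = "4 list \<Rightarrow>\<^sub>0 'k"

definition free_gen :: "4 \<Rightarrow> 'k::comm_ring_1 free_alg" where
  "free_gen i = Poly_Mapping.single [i] 1"

definition free_const :: "'k \<Rightarrow> 'k::comm_ring_1 free_alg" where
  "free_const c = Poly_Mapping.single [] c"

definition free_homogeneous :: "nat \<Rightarrow> 'k::comm_ring_1 free_alg set" where
  "free_homogeneous n = {f. \<forall>w\<in>Poly_Mapping.keys f. length w = n}"

definition commutator :: "'a \<Rightarrow> 'a \<Rightarrow> 'a::ring" where
  "commutator a b = a * b - b * a"

definition anticommutator :: "'a \<Rightarrow> 'a \<Rightarrow> 'a::ring" where
  "anticommutator a b = a * b + b * a"

definition type_ring :: "'a::ring_1 ring" where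
  "type_ring = \<lparr>carrier = UNIV, monoid.mult = (*), one = 1, ring.zero = 0, add = (+)\<rparr>"

section \<open>The Sklyanin algebra\<close>

definition sklyanin_relations ::
  "'k \<Rightarrow> 'k \<Rightarrow> 'k \<Rightarrow> 'k::comm_ring_1 free_alg set" where
  "sklyanin_relations \<alpha> \<beta> \<gamma> =
    (let x = free_gen in
     { commutator (x 0) (x 1) - free_const \<alpha> * anticommutator (x 2) (x 3),
       anticommutator (x 0) (x 1) - commutator (x 2) (x 3),
       commutator (x 0) (x 2) - free_const \<beta> * anticommutator (x 3) (x 1),
       anticommutator (x 0) (x 2) - commutator (x 3) (x 1),
       commutator (x 0) (x 3) - free_const \<gamma> * anticommutator (x 1) (x 2),
       anticommutator (x 0) (x 3) - commutator (x 1) (x 2) })"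

definition sklyanin_ideal :: "'k \<Rightarrow> 'k \<Rightarrow> 'k \<Rightarrow> 'k::comm_ring_1 free_alg set" where
  "sklyanin_ideal \<alpha> \<beta> \<gamma> = genideal type_ring (sklyanin_relations \<alpha> \<beta> \<gamma>)"

definition sklyanin :: "'k \<Rightarrow> 'k \<Rightarrow> 'k \<Rightarrow> 'k::comm_ring_1 free_alg set ring" where
  "sklyanin \<alpha> \<beta> \<gamma> = type_ring Quot (sklyanin_ideal \<alpha> \<beta> \<gamma>)"

definition sklyanin_class ::
  "'k \<Rightarrow> 'k \<Rightarrow> 'k \<Rightarrow> 'k::comm_ring_1 free_alg \<Rightarrow> 'k free_alg set" where
  "sklyanin_class \<alpha> \<beta> \<gamma> f = sklyanin_ideal \<alpha> \<beta> \<gamma> +>\<^bsub>type_ring\<^esub> f"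

abbreviation sklyanin_gen ::
  "'k \<Rightarrow> 'k \<Rightarrow> 'k \<Rightarrow> 4 \<Rightarrow> 'k::comm_ring_1 free_alg set" where
  "sklyanin_gen \<alpha> \<beta> \<gamma> i \<equiv> sklyanin_class \<alpha> \<beta> \<gamma> (free_gen i)"

abbreviation sklyanin_scalar ::
  "'k \<Rightarrow> 'k \<Rightarrow> 'k \<Rightarrow> 'k \<Rightarrow> 'k::comm_ring_1 free_alg set" where
  "sklyanin_scalar \<alpha> \<beta> \<gamma> c \<equiv> sklyanin_class \<alpha> \<beta> \<gamma> (free_const c)"

definition sklyanin_degree ::
  "'k \<Rightarrow> 'k \<Rightarrow> 'k \<Rightarrow> nat \<Rightarrow> 'k::comm_ring_1 free_alg set set" where
  "sklyanin_degree \<alpha> \<beta> \<gamma> n = sklyanin_class \<alpha> \<beta> \<gamma> ` free_homogeneous n"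

section \<open>Points of projective three-space\<close>

text \<open>A point is the set of all its (nonzero) homogeneous coordinate vectors.\<close>

type_synonym 'k point = "(4 \<Rightarrow> 'k) set"

definition proj :: "(4 \<Rightarrow> 'k::field) \<Rightarrow> 'k point" where
  "proj y = {(\<lambda>i. c * y i) | c. c \<noteq> 0}"

definition proj_space :: "'k::field point set" where
  "proj_space = {proj y | y. y \<noteq> (\<lambda>i. 0)}"

definition pt :: "'k \<Rightarrow> 'k \<Rightarrow> 'k \<Rightarrow> 'k \<Rightarrow> 'k::field point" where
  "pt a b c d =
    proj (\<lambda>i. if i = 0 then a else if i = 1 then b else if i = 2 then c else d)"

section \<open>Point modules of the Sklyanin algebra and the automorphism\<close>

text \<open>
  A graded right module \<open>M = \<Oplus>\<^sub>n M\<^sub>n\<close> is represented by its homogeneous components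
  \<open>M\<^sub>n\<close> together with addition and the right action of ring elements.
\<close>

record ('a, 'm) graded_rmodule =
  component :: "nat \<Rightarrow> 'm set"
  madd :: "'m \<Rightarrow> 'm \<Rightarrow> 'm"
  ract :: "'m \<Rightarrow> 'a \<Rightarrow> 'm"

text \<open>The module \<open>M[1]\<^bsub>\<ge>0\<^esub>\<close>, where \<open>M[1]\<^sub>n = M\<^bsub>n+1\<^esub>\<close>.\<close>

definition shift_trunc :: "('a, 'm) graded_rmodule \<Rightarrow> ('a, 'm) graded_rmodule" where
  "shift_trunc M = M\<lparr>component := (\<lambda>n. component M (Suc n))\<rparr>"

text \<open>
  Degree-preserving isomorphism over a graded ring with graded pieces \<open>A n\<close>. Compatibility
  with \<open>A 0\<close>, which contains the scalars, includes linearity over the ground field.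
\<close>

definition graded_isomorphic ::
  "(nat \<Rightarrow> 'a set) \<Rightarrow> ('a, 'm) graded_rmodule \<Rightarrow> ('a, 'n) graded_rmodule \<Rightarrow> bool" where
  "graded_isomorphic A M N \<longleftrightarrow>
    (\<exists>\<phi> :: nat \<Rightarrow> 'm \<Rightarrow> 'n.
      (\<forall>n. bij_betw (\<phi> n) (component M n) (component N n)) \<and>
      (\<forall>n. \<forall>x\<in>component M n. \<forall>y\<in>component M n.
         \<phi> n (madd M x y) = madd N (\<phi> n x) (\<phi> n y)) \<and>
      (\<forall>n m. \<forall>x\<in>component M n. \<forall>a\<in>A m. \<phi> (n + m) (ract M x a) = ract N (\<phi> n x) a))"

definition right_ideal_gen :: "('a, 'b) ring_scheme \<Rightarrow> 'a set \<Rightarrow> 'a set" where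
  "right_ideal_gen R S =
    \<Inter>{J. additive_subgroup J R \<and> S \<subseteq> J \<and> (\<forall>a\<in>J. \<forall>r\<in>carrier R. a \<otimes>\<^bsub>R\<^esub> r \<in> J)}"

text \<open>\<open>p\<^sup>\<bottom>\<close>, the linear forms vanishing at \<open>p\<close>, as a subset of the degree one part of \<open>A\<close>.\<close>

definition perp ::
  "'k \<Rightarrow> 'k \<Rightarrow> 'k \<Rightarrow> 'k::field point \<Rightarrow> 'k free_alg set set" where
  "perp \<alpha> \<beta> \<gamma> p =
    {sklyanin_class \<alpha> \<beta> \<gamma> (\<Sum>i\<in>UNIV. free_const (l i) * free_gen i) | l.
       \<forall>y\<in>p. (\<Sum>i\<in>UNIV. l i * y i) = 0}"

text \<open>\<open>M\<^sub>p = A / p\<^sup>\<bottom>A\<close>\<close>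

definition point_module ::
  "'k \<Rightarrow> 'k \<Rightarrow> 'k \<Rightarrow> 'k::field point
    \<Rightarrow> ('k free_alg set, 'k free_alg set set) graded_rmodule" where
  "point_module \<alpha> \<beta> \<gamma> p =
    (let A = sklyanin \<alpha> \<beta> \<gamma>; J = right_ideal_gen A (perp \<alpha> \<beta> \<gamma> p) in
     \<lparr>component = (\<lambda>n. (\<lambda>a. J +>\<^bsub>A\<^esub> a) ` sklyanin_degree \<alpha> \<beta> \<gamma> n),
      madd = (\<lambda>X Y. X <+>\<^bsub>A\<^esub> Y),
      ract = (\<lambda>X r. \<Union>x\<in>X. J +>\<^bsub>A\<^esub> (x \<otimes>\<^bsub>A\<^esub> r))\<rparr>)"

definition sklyanin_curve :: "'k \<Rightarrow> 'k \<Rightarrow> 'k \<Rightarrow> 'k::field point set" where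
  "sklyanin_curve \<alpha> \<beta> \<gamma> =
    {p \<in> proj_space. \<forall>y\<in>p.
       (y 0)\<^sup>2 + (y 1)\<^sup>2 + (y 2)\<^sup>2 + (y 3)\<^sup>2 = 0 \<and>
       (y 3)\<^sup>2 + (1 - \<gamma>) / (1 + \<alpha>) * (y 1)\<^sup>2 + (1 + \<gamma>) / (1 - \<beta>) * (y 2)\<^sup>2 = 0}"

definition sklyanin_automorphism ::
  "'k \<Rightarrow> 'k \<Rightarrow> 'k \<Rightarrow> ('k::field point \<Rightarrow> 'k point) \<Rightarrow> bool" where
  "sklyanin_automorphism \<alpha> \<beta> \<gamma> \<sigma> \<longleftrightarrow>
    bij_betw \<sigma> (sklyanin_curve \<alpha> \<beta> \<gamma>) (sklyanin_curve \<alpha> \<beta> \<gamma>) \<and>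
    (\<forall>p\<in>sklyanin_curve \<alpha> \<beta> \<gamma>.
       graded_isomorphic (sklyanin_degree \<alpha> \<beta> \<gamma>)
         (shift_trunc (point_module \<alpha> \<beta> \<gamma> p)) (point_module \<alpha> \<beta> \<gamma> (\<sigma> p)))"

definition infinite_order_on :: "'a set \<Rightarrow> ('a \<Rightarrow> 'a) \<Rightarrow> bool" where
  "infinite_order_on E \<sigma> \<longleftrightarrow> (\<forall>n>0. \<exists>p\<in>E. (\<sigma> ^^ n) p \<noteq> p)"

section \<open>The cocycle twist\<close>

text \<open>The group \<open>G\<close> is \<^typ>\<open>bit \<times> bit\<close>; \<open>(p, q)\<close> stands for \<open>g\<^sub>1\<^sup>p g\<^sub>2\<^sup>q\<close>.\<close>

definition letter_degree :: "4 \<Rightarrow> bit \<times> bit" where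
  "letter_degree i =
    (if i = 0 then (0, 0) else if i = 1 then (1, 0) else if i = 2 then (0, 1) else (1, 1))"

definition word_degree :: "4 list \<Rightarrow> bit \<times> bit" where
  "word_degree w = sum_list (map letter_degree w)"

definition cocycle :: "bit \<times> bit \<Rightarrow> bit \<times> bit \<Rightarrow> 'k::comm_ring_1" where
  "cocycle g h = (if fst g * snd h = 1 then - 1 else 1)"

definition sklyanin_G_part ::
  "'k \<Rightarrow> 'k \<Rightarrow> 'k \<Rightarrow> bit \<times> bit \<Rightarrow> 'k::comm_ring_1 free_alg set set" where
  "sklyanin_G_part \<alpha> \<beta> \<gamma> g =
    sklyanin_class \<alpha> \<beta> \<gamma> ` {f. \<forall>w\<in>Poly_Mapping.keys f. word_degree w = g}"

text \<open>The component \<open>a\<^sub>g\<close> in the decomposition \<open>A = \<Oplus>\<^sub>g A\<^sub>g\<close>.\<close>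

definition sklyanin_G_component ::
  "'k \<Rightarrow> 'k \<Rightarrow> 'k \<Rightarrow> 'k::comm_ring_1 free_alg set \<Rightarrow> bit \<times> bit \<Rightarrow> 'k free_alg set" where
  "sklyanin_G_component \<alpha> \<beta> \<gamma> a =
    (THE c. (\<forall>g. c g \<in> sklyanin_G_part \<alpha> \<beta> \<gamma> g) \<and>
            finsum (sklyanin \<alpha> \<beta> \<gamma>) c UNIV = a)"

text \<open>
  The twisted product \<open>a \<^emph>\<open>*\<close> b = \<mu>(g, h) a b\<close> for \<open>a \<in> A\<^sub>g\<close>, \<open>b \<in> A\<^sub>h\<close>, extended
  additively to all of \<open>A\<close>.
\<close>

definition twist_mult ::
  "'k \<Rightarrow> 'k \<Rightarrow> 'k \<Rightarrow> 'k::comm_ring_1 free_alg set \<Rightarrow> 'k free_alg set \<Rightarrow> 'k free_alg set" where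
  "twist_mult \<alpha> \<beta> \<gamma> a b =
    (let A = sklyanin \<alpha> \<beta> \<gamma> in
     finsum A (\<lambda>(g, h). sklyanin_scalar \<alpha> \<beta> \<gamma> (cocycle g h) \<otimes>\<^bsub>A\<^esub>
                 (sklyanin_G_component \<alpha> \<beta> \<gamma> a g \<otimes>\<^bsub>A\<^esub> sklyanin_G_component \<alpha> \<beta> \<gamma> b h)) UNIV)"

definition cocycle_twist :: "'k \<Rightarrow> 'k \<Rightarrow> 'k \<Rightarrow> 'k::comm_ring_1 free_alg set ring" where
  "cocycle_twist \<alpha> \<beta> \<gamma> = (sklyanin \<alpha> \<beta> \<gamma>)\<lparr>monoid.mult := twist_mult \<alpha> \<beta> \<gamma>\<rparr>"

section \<open>The point scheme of an algebra generated by four elements\<close>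

text \<open>
  Let \<open>B\<close> be a ring with scalars \<open>\<iota>\<close> and generators \<open>x\<^sub>0, \<dots>, x\<^sub>3\<close>. All relations among
  the generators form the kernel of the map from the free algebra to \<open>B\<close>.
\<close>

definition eval_free ::
  "('b, 'c) ring_scheme \<Rightarrow> ('k \<Rightarrow> 'b) \<Rightarrow> (4 \<Rightarrow> 'b) \<Rightarrow> 'k::comm_ring_1 free_alg \<Rightarrow> 'b" where
  "eval_free B \<iota> x f =
    finsum B (\<lambda>w. \<iota> (Poly_Mapping.lookup f w) \<otimes>\<^bsub>B\<^esub>
                foldr (\<lambda>i b. x i \<otimes>\<^bsub>B\<^esub> b) w \<one>\<^bsub>B\<^esub>)
      (Poly_Mapping.keys f)"

definition relation_ideal ::
  "('b, 'c) ring_scheme \<Rightarrow> ('k \<Rightarrow> 'b) \<Rightarrow> (4 \<Rightarrow> 'b) \<Rightarrow> 'k::comm_ring_1 free_alg set" where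
  "relation_ideal B \<iota> x = {f. eval_free B \<iota> x f = \<zero>\<^bsub>B\<^esub>}"

text \<open>
  Polynomials in the coordinates \<open>y\<^bsub>j,i\<^esub>\<close>, for \<open>j\<close> a natural number and \<open>i = 0, \<dots>, 3\<close>, of
  the factors of \<open>\<P>\<^sup>3 \<times> \<P>\<^sup>3 \<times> \<dots>\<close>. An exponent assigns to each factor \<open>j\<close> an exponent in
  the four variables of that factor.
\<close>

type_synonym 'k mpoly = "(nat \<Rightarrow>\<^sub>0 (4 \<Rightarrow>\<^sub>0 nat)) \<Rightarrow>\<^sub>0 'k"

definition mvar :: "nat \<Rightarrow> 4 \<Rightarrow> 'k::comm_ring_1 mpoly" where
  "mvar j i = Poly_Mapping.single (Poly_Mapping.single j (Poly_Mapping.single i 1)) 1"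

definition mconst :: "'k \<Rightarrow> 'k::comm_ring_1 mpoly" where
  "mconst c = Poly_Mapping.single 0 c"

definition meval :: "(nat \<Rightarrow> 4 \<Rightarrow> 'k) \<Rightarrow> 'k::comm_ring_1 mpoly \<Rightarrow> 'k" where
  "meval y P =
    (\<Sum>e\<in>Poly_Mapping.keys P. Poly_Mapping.lookup P e *
       (\<Prod>j\<in>Poly_Mapping.keys e. \<Prod>i\<in>UNIV. y j i ^ Poly_Mapping.lookup (Poly_Mapping.lookup e j) i))"

definition multihomogeneous :: "(nat \<Rightarrow> nat) \<Rightarrow> 'k::comm_ring_1 mpoly set" where
  "multihomogeneous m =
    {P. \<forall>e\<in>Poly_Mapping.keys P. \<forall>j.
       (\<Sum>i\<in>UNIV. Poly_Mapping.lookup (Poly_Mapping.lookup e j) i) = m j}"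

text \<open>The multilinearisation replaces \<open>x\<^bsub>i\<^sub>0\<^esub> \<dots> x\<^bsub>i\<^sub>n\<^esub>\<close> by \<open>y\<^bsub>0,i\<^sub>0\<^esub> \<dots> y\<^bsub>n,i\<^sub>n\<^esub>\<close>.\<close>

definition multilinearisation :: "'k::comm_ring_1 free_alg \<Rightarrow> 'k mpoly" where
  "multilinearisation f =
    (\<Sum>w\<in>Poly_Mapping.keys f.
       mconst (Poly_Mapping.lookup f w) * (\<Prod>j<length w. mvar j (w ! j)))"

text \<open>
  For an ideal \<open>I\<close> of relations let \<open>I\<^sub>d\<close> be its part of degree \<open>d\<close>. The scheme \<open>\<Gamma>\<^sub>d\<close> of
  truncated point modules of length \<open>d + 1\<close> is the zero scheme in \<open>(\<P>\<^sup>3)\<^sup>d\<close> of the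
  multilinearisations of \<open>I\<^sub>d\<close> (the \<open>j\<close>-th component of a point records how the generators
  map degree \<open>j\<close> to degree \<open>j + 1\<close>). The point scheme is the inverse limit of the \<open>\<Gamma>\<^sub>d\<close>
  along the projections dropping the last factor. Its closed points are the sequences all of
  whose initial segments lie on the \<open>\<Gamma>\<^sub>d\<close>, and its local rings are the direct limits of those
  of the \<open>\<Gamma>\<^sub>d\<close>. The first projection maps the point scheme to \<open>\<P>\<^sup>3\<close>.
\<close>

definition on_truncated ::
  "'k::field free_alg set \<Rightarrow> nat \<Rightarrow> (nat \<Rightarrow> 'k point) \<Rightarrow> bool" where
  "on_truncated I d P \<longleftrightarrow>
    (\<forall>f\<in>I \<inter> free_homogeneous d. \<forall>y. (\<forall>j. y j \<in> P j) \<longrightarrow> meval y (multilinearisation f) = 0)"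

definition point_scheme :: "'k::field free_alg set \<Rightarrow> (nat \<Rightarrow> 'k point) set" where
  "point_scheme I = {P. (\<forall>j. P j \<in> proj_space) \<and> (\<forall>d. on_truncated I d P)}"

definition nonvanishing_at :: "(nat \<Rightarrow> 'k point) \<Rightarrow> 'k::field mpoly set" where
  "nonvanishing_at P = {b. \<forall>y. (\<forall>j. y j \<in> P j) \<longrightarrow> meval y b \<noteq> 0}"

text \<open>
  The local ring at \<open>P\<close> of the ambient product of projective spaces: fractions of
  multihomogeneous polynomials of equal multidegree whose denominator does not vanish at \<open>P\<close>.
\<close>

definition ambient_local_ring :: "(nat \<Rightarrow> 'k point) \<Rightarrow> 'k::field mpoly fract ring" where
  "ambient_local_ring P =
    type_ring\<lparr>carrier := {Fract a b | a b m. a \<in> multihomogeneous m \<and>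
                  b \<in> multihomogeneous m \<and> b \<in> nonvanishing_at P}\<rparr>"

definition point_scheme_stalk_ideal ::
  "'k::field free_alg set \<Rightarrow> (nat \<Rightarrow> 'k point) \<Rightarrow> 'k mpoly fract set" where
  "point_scheme_stalk_ideal I P =
    genideal (ambient_local_ring P)
      {Fract (multilinearisation f) b | f b d. f \<in> I \<inter> free_homogeneous d \<and>
         b \<in> multihomogeneous (\<lambda>j. if j < d then 1 else 0) \<and> b \<in> nonvanishing_at P}"

definition point_scheme_local_ring ::
  "'k::field free_alg set \<Rightarrow> (nat \<Rightarrow> 'k point) \<Rightarrow> 'k mpoly fract set ring" where
  "point_scheme_local_ring I P =
    ambient_local_ring P Quot point_scheme_stalk_ideal I P"

text \<open>
  The multiplicity of a point is the dimension over \<open>k\<close> of the local ring, \<open>k\<close> being embedded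
  as the classes of constants.
\<close>

definition has_multiplicity ::
  "'k::field free_alg set \<Rightarrow> (nat \<Rightarrow> 'k point) \<Rightarrow> nat \<Rightarrow> bool" where
  "has_multiplicity I P m \<longleftrightarrow>
    ring.dimension (point_scheme_local_ring I P) m
      (range (\<lambda>c. point_scheme_stalk_ideal I P +>\<^bsub>ambient_local_ring P\<^esub> Fract (mconst c) 1))
      (carrier (point_scheme_local_ring I P))"

definition twist_relations :: "'k \<Rightarrow> 'k \<Rightarrow> 'k \<Rightarrow> 'k::field free_alg set" where
  "twist_relations \<alpha> \<beta> \<gamma> =
    relation_ideal (cocycle_twist \<alpha> \<beta> \<gamma>) (sklyanin_scalar \<alpha> \<beta> \<gamma>) (sklyanin_gen \<alpha> \<beta> \<gamma>)"

section \<open>The listed points\<close>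

text \<open>\<open>a, b, c\<close> are the chosen square roots of \<open>\<alpha>, \<beta>, \<gamma>\<close>, and \<open>\<iota>\<close> of \<open>-1\<close>; \<open>s\<close> is the sign.\<close>

definition Gamma' :: "'k \<Rightarrow> 'k \<Rightarrow> 'k \<Rightarrow> 'k \<Rightarrow> 'k::field point set" where
  "Gamma' a b c \<iota> =
    (\<Union>s\<in>{1, - 1}.
      { pt 1 (s * \<iota>) (s * \<iota>) 1,
        pt 1 (s * \<iota>) (- s * \<iota>) (- 1),
        pt 1 (- inverse (b * c)) (- s * inverse c) (- s * inverse b),
        pt 1 (inverse (b * c)) (- s * inverse c) (s * inverse b),
        pt 1 (s * \<iota> * inverse c) (inverse (a * c)) (s * \<iota> * inverse a),
        pt 1 (- s * \<iota> * inverse c) (- inverse (a * c)) (s * \<iota> * inverse a),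
        pt 1 (s * inverse b) (s * \<iota> * inverse a) (\<iota> * inverse (a * b)),
        pt 1 (s * inverse b) (- s * \<iota> * inverse a) (- \<iota> * inverse (a * b)) })"

definition coordinate_points :: "'k::field point set" where
  "coordinate_points = {pt 1 0 0 0, pt 0 1 0 0, pt 0 0 1 0, pt 0 0 0 1}"

end

theory Submission
  imports Defs
begin

text \<open>
  A word \<open>x\<^bsub>i\<^sub>1\<^esub> \<dots> x\<^bsub>i\<^sub>n\<^esub>\<close> is the same in the twist as in the Sklyanin algebra up to a sign, so the
  relations of the twist are generated by the six twisted quadratic relations, and a point of
  the point scheme is a sequence of points of \<open>\<P>\<^sup>3\<close> in which consecutive members \<open>y, z\<close> satisfy their
  multilinearisations.

  For such a pair put \<open>S\<^sub>i = y\<^sub>jz\<^sub>k + y\<^sub>kz\<^sub>j\<close> and \<open>T\<^sub>i = y\<^sub>jz\<^sub>k - y\<^sub>kz\<^sub>j\<close>, where \<open>(i, j, k)\<close> is cyclic in \<open>1, 2, 3\<close>. The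
  relations imply \<open>S\<^sub>iT\<^sub>i = 0\<close> for all \<open>i\<close>. Deciding which factors vanish leaves the four \<open>e\<^sub>i\<close> and four
  families of four points. The same identities hold in the local rings of the point scheme.
  There one factor of each \<open>S\<^sub>iT\<^sub>i\<close> is a unit at a point of a family, so the other one is zero, which
  forces every coordinate to be constant and the local ring to be \<open>k\<close>; at \<open>e\<^sub>i\<close> the relations
  show that the maximal ideal equals its square.
\<close>

section \<open>Linear functionals on finitely supported functions\<close>

text \<open>The relations of the twist have elements of every degree and a point of the point scheme
  has infinitely many factors, so every statement has to be brought back to two neighbouring
  factors. To reach the quadratic relations, they are prefixed with a word in the normalised
  coordinates of the preceding factors: its monomial has the value 1. Conversely, the vanishing of
  all relations follows by induction over the ideal.

  The calculation with S and T divides only by 2, by nonzero constants and by elements of nonzero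
  value. It is therefore done for congruences modulo an ideal J of a local ring R with residue field
  k. With R = k and J = 0 it helps to find the points; with R the ambient local ring and J the stalk
  ideal it gives the multiplicities. Once all affine coordinates are congruent to constants modulo
  J, so is every fraction, and the quotient is k.\<close>

definition lin_ext :: "('a \<Rightarrow> 'k) \<Rightarrow> ('a \<Rightarrow>\<^sub>0 'k) \<Rightarrow> 'k::comm_ring_1" where
  "lin_ext t f = (\<Sum>w\<in>Poly_Mapping.keys f. Poly_Mapping.lookup f w * t w)"

lemma lin_ext_superset:
  assumes "finite A" "Poly_Mapping.keys f \<subseteq> A"
  shows "lin_ext t f = (\<Sum>w\<in>A. Poly_Mapping.lookup f w * t w)"
  unfolding lin_ext_def
  by (rule sum.mono_neutral_left) (use assms in \<open>auto simp: in_keys_iff\<close>)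

lemma lin_ext_zero [simp]: "lin_ext t 0 = 0"
  by (simp add: lin_ext_def)

lemma lin_ext_add: "lin_ext t (f + g) = lin_ext t f + lin_ext t g"
proof -
  let ?A = "Poly_Mapping.keys f \<union> Poly_Mapping.keys g"
  have "Poly_Mapping.keys (f + g) \<subseteq> ?A" by (rule Poly_Mapping.keys_add)
  then show ?thesis
    by (simp add: lin_ext_superset[of ?A] lookup_add distrib_right sum.distrib)
qed

lemma lin_ext_single [simp]: "lin_ext t (Poly_Mapping.single w c) = c * t w"
  by (simp add: lin_ext_def)

lemma lin_ext_cong:
  "(\<And>w. w \<in> Poly_Mapping.keys f \<Longrightarrow> s w = t w) \<Longrightarrow> lin_ext s f = lin_ext t f"
  by (simp add: lin_ext_def)

lemma lin_ext_scale: "lin_ext (\<lambda>w. c * t w) f = c * lin_ext t f"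
  by (simp add: lin_ext_def sum_distrib_left mult.left_commute)

text \<open>No freshness of \<open>w\<close> enters the step, so additive maps can be treated term
  by term without looking at keys.\<close>

lemma poly_mapping_single_induct [case_names zero add]:
  assumes "P 0"
    and "\<And>w c f. P f \<Longrightarrow> P (Poly_Mapping.single w c + f)"
  shows "P (f :: 'a \<Rightarrow>\<^sub>0 'k::comm_ring_1)"
proof (induction f rule: update_induct)
  case const
  show ?case by (simp add: assms)
next
  case (update f a b)
  have "Poly_Mapping.update a b f = Poly_Mapping.single a b + f"
    by (rule poly_mapping_eqI)
      (use update(1) in \<open>auto simp: lookup_update lookup_add lookup_single when_def in_keys_iff\<close>)
  then show ?case using update assms by simp
qed

text \<open>A functional on words is in general not multiplicative; multiplying by a single term
  translates it. Inductions over an ideal use this form, while \<open>lin_ext_mult\<close> is for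
  monoid homomorphisms such as evaluation of polynomials.\<close>

lemma lin_ext_single_mult:
  "lin_ext t (Poly_Mapping.single u c * f) = c * lin_ext (\<lambda>w. t (u + w)) f"
  by (induction f rule: poly_mapping_single_induct)
    (simp_all add: distrib_left lin_ext_add mult_single mult.assoc)

lemma lin_ext_mult_single:
  "lin_ext t (f * Poly_Mapping.single u c) = c * lin_ext (\<lambda>w. t (w + u)) f"
  by (induction f rule: poly_mapping_single_induct)
    (simp_all add: distrib_left distrib_right lin_ext_add mult_single mult.assoc mult.left_commute)

lemma lin_ext_mult:
  assumes "\<And>u w. t (u + w) = t u * t w"
  shows "lin_ext t (f * g) = lin_ext t f * lin_ext t g"
  by (induction f rule: poly_mapping_single_induct)
    (simp_all add: distrib_right lin_ext_add lin_ext_single_mult assms lin_ext_scale mult.assoc)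

text \<open>Signs as weights carry the twisted product to the ordinary one, weights 0 and 1 project
  onto a G-degree, and constant weights are scalars.\<close>

definition rescale :: "('a \<Rightarrow> 'k) \<Rightarrow> ('a \<Rightarrow>\<^sub>0 'k) \<Rightarrow> 'a \<Rightarrow>\<^sub>0 'k::comm_ring_1" where
  "rescale s f = Poly_Mapping.mapp (\<lambda>w c. s w * c) f"

lemma lookup_rescale [simp]:
  "Poly_Mapping.lookup (rescale s f) w = s w * Poly_Mapping.lookup f w"
  by (simp add: rescale_def lookup_mapp when_def in_keys_iff)

lemma rescale_zero [simp]: "rescale s 0 = 0"
  by (rule poly_mapping_eqI) simp

lemma rescale_add: "rescale s (f + g) = rescale s f + rescale s g"
  by (rule poly_mapping_eqI) (simp add: lookup_add distrib_left)

lemma rescale_single [simp]: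
  "rescale s (Poly_Mapping.single w c) = Poly_Mapping.single w (s w * c)"
  by (rule poly_mapping_eqI) (simp add: lookup_single when_def)

lemma rescale_diff: "rescale s (f - g) = rescale s f - rescale s g"
  by (rule poly_mapping_eqI) (simp add: lookup_minus right_diff_distrib)

lemma rescale_rescale: "rescale s (rescale t f) = rescale (\<lambda>w. s w * t w) f"
  by (rule poly_mapping_eqI) (simp add: mult.assoc)

lemma rescale_cong_id: "(\<And>w. w \<in> Poly_Mapping.keys f \<Longrightarrow> s w = 1) \<Longrightarrow> rescale s f = f"
  by (rule poly_mapping_eqI) (simp, metis in_keys_iff mult_1 mult_zero_right)

lemma rescale_cong_zero: "(\<And>w. w \<in> Poly_Mapping.keys f \<Longrightarrow> s w = 0) \<Longrightarrow> rescale s f = 0"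
  by (rule poly_mapping_eqI) (simp, metis in_keys_iff mult_zero_left mult_zero_right)

lemma lin_ext_rescale: "lin_ext t (rescale s f) = lin_ext (\<lambda>w. t w * s w) f"
  by (induction f rule: poly_mapping_single_induct)
    (simp_all add: rescale_add lin_ext_add mult_ac)

text \<open>The factor \<open>k\<close> collects what the weight owes to \<open>u\<close> alone, and
  \<open>s'\<close> is the weight left on the other factor: a shifted degree for projections, a
  cocycle times the old sign for twisting.\<close>

lemma rescale_single_mult:
  assumes "\<And>w. s (u + w) = k * s' w"
  shows "rescale s (Poly_Mapping.single u c * f) = Poly_Mapping.single u (k * c) * rescale s' f"
  by (induction f rule: poly_mapping_single_induct)
    (simp_all add: distrib_left rescale_add mult_single assms mult_ac)

lemma rescale_mult_single:
  assumes "\<And>w. s (w + u) = k * s' w"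
  shows "rescale s (f * Poly_Mapping.single u c) = rescale s' f * Poly_Mapping.single u (k * c)"
  by (induction f rule: poly_mapping_single_induct)
    (simp_all add: distrib_left distrib_right rescale_add mult_single assms mult_ac)

lemma univ4: "(UNIV :: 4 set) = {0, 1, 2, 3}"
proof -
  have "card {0, 1, 2, 3 :: 4} = 4" by simp
  then show ?thesis by (intro card_subset_eq[symmetric]) auto
qed

section \<open>The relations of the cocycle twist\<close>

lemma bit_pair_UNIV: "(UNIV :: (bit \<times> bit) set) = {(0,0), (0,1), (1,0), (1,1)}"
proof -
  have "x \<in> {(0,0), (0,1), (1,0), (1,1)}" for x :: "bit \<times> bit"
    by (cases x) (metis (full_types) bit_not_one_iff insert_iff)
  then show ?thesis by auto
qed

lemma bit_pair_finite [simp]: "finite (UNIV :: (bit \<times> bit) set)"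
  by (simp add: bit_pair_UNIV)

text \<open>Every element of the group is its own inverse, so a degree is moved to the other side by
  adding it again.\<close>

lemma bit_pair_add_eq_iff: "g + x = h \<longleftrightarrow> x = g + h" for g h x :: "bit \<times> bit"
  by (cases g; cases h; cases x) auto

section \<open>Degrees and signs of words\<close>

lemma word_degree_Nil [simp]: "word_degree [] = 0"
  and word_degree_Cons [simp]: "word_degree (i # w) = letter_degree i + word_degree w"
  and word_degree_append [simp]: "word_degree (u @ v) = word_degree u + word_degree v"
  by (simp_all add: word_degree_def)

lemma letter_degree_simps [simp]:
  "letter_degree 0 = 0" "letter_degree 1 = (1, 0)" "letter_degree 2 = (0, 1)"
  "letter_degree 3 = (1, 1)"
  by (simp_all add: letter_degree_def zero_prod_def)

lemma cocycle_zero [simp]: "cocycle 0 h = 1" "cocycle g 0 = 1"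
  by (simp_all add: cocycle_def)

lemma cocycle_square [simp]: "cocycle g h * cocycle g h = 1"
  by (simp add: cocycle_def)

text \<open>The cocycle is a bicharacter, which is stronger than the cocycle condition and lets the
  sign of a concatenation be computed from degrees.\<close>

lemma cocycle_add_left: "cocycle (g + g') h = cocycle g h * cocycle g' h"
  and cocycle_add_right: "cocycle h (g + g') = cocycle h g * cocycle h g'"
  by (cases "fst g"; cases "fst g'"; cases "snd g"; cases "snd g'"; cases "fst h"; cases "snd h";
      simp add: cocycle_def)+

text \<open>The sign relating the twisted product of the letters of a word, bracketed to the right
  as in \<open>eval_free\<close>, to the ordinary product.\<close>

fun twist_sign :: "4 list \<Rightarrow> 'k::comm_ring_1" where
  "twist_sign [] = 1"
| "twist_sign (i # w) = cocycle (letter_degree i) (word_degree w) * twist_sign w"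

lemma twist_sign_append:
  "twist_sign (u @ v) = twist_sign u * twist_sign v * cocycle (word_degree u) (word_degree v)"
  by (induction u) (simp_all add: cocycle_add_left cocycle_add_right mult_ac)

lemma twist_sign_square [simp]: "twist_sign w * twist_sign w = (1 :: 'k::comm_ring_1)"
proof (induction w)
  case (Cons i w)
  let ?c = "cocycle (letter_degree i) (word_degree w) :: 'k"
  have "twist_sign (i # w) * twist_sign (i # w) = (?c * ?c) * (twist_sign w * twist_sign w)"
    by (simp add: mult_ac)
  then show ?case by (simp only: Cons cocycle_square mult_1_left)
qed simp

text \<open>Common shape of the relations of both algebras, with the coefficient of
  \<open>[0, i]\<close> normalised to 1. For (i, j, k) cyclic in 1, 2, 3 the degree of i is the sum
  of those of j and k, so all four words have the same G-degree.\<close>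

definition rel4 :: "4 \<Rightarrow> 4 \<Rightarrow> 4 \<Rightarrow> 'k \<Rightarrow> 'k \<Rightarrow> 'k \<Rightarrow> 'k::comm_ring_1 free_alg" where
  "rel4 i j k p q r = Poly_Mapping.single [0, i] 1 + Poly_Mapping.single [i, 0] p +
     Poly_Mapping.single [j, k] q + Poly_Mapping.single [k, j] r"

lemma lin_ext_rel4: "lin_ext t (rel4 i j k p q r) =
    t [0, i] + p * t [i, 0] + q * t [j, k] + r * t [k, j]"
  by (simp add: rel4_def lin_ext_add)

lemma sklyanin_relations_eq:
  "sklyanin_relations \<alpha> \<beta> \<gamma> =
    {rel4 1 2 3 (- 1) (- \<alpha>) (- \<alpha>), rel4 1 2 3 1 (- 1) 1,
     rel4 2 3 1 (- 1) (- \<beta>) (- \<beta>), rel4 2 3 1 1 (- 1) 1,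
     rel4 3 1 2 (- 1) (- \<gamma>) (- \<gamma>), rel4 3 1 2 1 (- 1) 1}"
  unfolding sklyanin_relations_def rel4_def commutator_def anticommutator_def free_gen_def
    free_const_def Let_def
  by (simp add: mult_single plus_list_def distrib_left single_uminus algebra_simps)

lemma sklyanin_relationsE:
  assumes "f \<in> sklyanin_relations \<alpha> \<beta> \<gamma>"
  obtains i j k p q r where "f = rel4 i j k p q r"
    "letter_degree j + letter_degree k = letter_degree i"
proof -
  have "\<exists>i j k p q r. f = rel4 i j k p q r \<and> letter_degree j + letter_degree k = letter_degree i"
    by (insert assms, unfold sklyanin_relations_eq, elim insertE emptyE; simp only:;
        (rule exI)+; rule conjI, rule refl, simp)
  then show ?thesis using that by blast
qed

lemma word_degree_rel4:
  assumes "w \<in> Poly_Mapping.keys (rel4 i j k p q r)"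
    and "letter_degree j + letter_degree k = letter_degree i"
  shows "word_degree w = letter_degree i" "length w = 2"
proof -
  have "Poly_Mapping.keys (rel4 i j k p q r) \<subseteq> {[0, i], [i, 0], [j, k], [k, j]}"
    unfolding rel4_def by (auto dest!: subsetD[OF Poly_Mapping.keys_add] split: if_splits)
  then have "w \<in> {[0, i], [i, 0], [j, k], [k, j]}" using assms(1) by auto
  then show "word_degree w = letter_degree i" "length w = 2"
    using assms(2) by (auto simp: add.commute)
qed

text \<open>Among the words that occur, exactly \<open>[3, 2]\<close>, \<open>[1, 3]\<close> and
  \<open>[1, 2]\<close> have sign -1, and rescaling by the signs turns the Sklyanin relations into
  this list. In the last pair the negative word comes first, in the other pairs second, whence the
  reversed signs there.\<close>

definition twisted_relations :: "'k \<Rightarrow> 'k \<Rightarrow> 'k \<Rightarrow> 'k::comm_ring_1 free_alg set" where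
  "twisted_relations \<alpha> \<beta> \<gamma> =
    {rel4 1 2 3 (- 1) (- \<alpha>) \<alpha>, rel4 1 2 3 1 (- 1) (- 1),
     rel4 2 3 1 (- 1) (- \<beta>) \<beta>, rel4 2 3 1 1 (- 1) (- 1),
     rel4 3 1 2 (- 1) \<gamma> (- \<gamma>), rel4 3 1 2 1 1 1}"

section \<open>The Sklyanin algebra as a quotient ring, and its twisted product\<close>

lemma type_ring_simps [simp]:
  "carrier type_ring = UNIV" "x \<otimes>\<^bsub>type_ring\<^esub> y = x * y" "\<one>\<^bsub>type_ring\<^esub> = 1"
  "\<zero>\<^bsub>type_ring\<^esub> = 0" "x \<oplus>\<^bsub>type_ring\<^esub> y = x + y"
  by (simp_all add: type_ring_def)

lemma type_ring_ring: "ring (type_ring :: 'a::ring_1 ring)"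
  by (rule ringI; (rule abelian_groupI monoidI)?)
    (auto simp: algebra_simps intro: exI[of _ "- _"] right_minus left_minus)

lemma type_ring_idealI:
  fixes S :: "'a::ring_1 set"
  assumes "0 \<in> S" and add: "\<And>x y. x \<in> S \<Longrightarrow> y \<in> S \<Longrightarrow> x + y \<in> S"
    and left: "\<And>x r. x \<in> S \<Longrightarrow> r * x \<in> S" and "\<And>x r. x \<in> S \<Longrightarrow> x * r \<in> S"
  shows "ideal S type_ring"
proof -
  interpret ring "type_ring :: 'a ring" by (rule type_ring_ring)
  have minus: "\<ominus>\<^bsub>type_ring\<^esub> x = - x" for x :: 'a
    by (rule minus_equality) simp_all
  show ?thesis
    by (intro idealI add.subgroupI type_ring_ring)
      (use assms left[where r = "- 1"] in \<open>auto simp: minus minus[unfolded a_inv_def]\<close>)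
qed

context
  fixes \<alpha> \<beta> \<gamma> :: "'k::comm_ring_1"
begin

private abbreviation "I \<equiv> sklyanin_ideal \<alpha> \<beta> \<gamma>"
private abbreviation "A \<equiv> sklyanin \<alpha> \<beta> \<gamma>"
private abbreviation "B \<equiv> cocycle_twist \<alpha> \<beta> \<gamma>"
private abbreviation "cls \<equiv> sklyanin_class \<alpha> \<beta> \<gamma>"

lemma ideal_sklyanin_ideal: "ideal I type_ring"
  unfolding sklyanin_ideal_def by (rule ring.genideal_ideal[OF type_ring_ring]) simp

lemma sklyanin_ideal_closed:
  shows sklyanin_ideal_zero: "0 \<in> I"
    and sklyanin_ideal_add: "f \<in> I \<Longrightarrow> g \<in> I \<Longrightarrow> f + g \<in> I"
    and sklyanin_ideal_left: "f \<in> I \<Longrightarrow> r * f \<in> I"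
    and sklyanin_ideal_right: "f \<in> I \<Longrightarrow> f * r \<in> I"
    and sklyanin_ideal_rel: "f \<in> sklyanin_relations \<alpha> \<beta> \<gamma> \<Longrightarrow> f \<in> I"
proof -
  interpret ideal I type_ring by (rule ideal_sklyanin_ideal)
  show "0 \<in> I"
    using additive_subgroup.zero_closed[OF is_additive_subgroup] by simp
  show "f \<in> I \<Longrightarrow> g \<in> I \<Longrightarrow> f + g \<in> I" 
    using additive_subgroup.a_closed[OF is_additive_subgroup, of f g] by simp
  show "f \<in> I \<Longrightarrow> r * f \<in> I" using I_l_closed[of f r] by simp
  show "f \<in> I \<Longrightarrow> f * r \<in> I" using I_r_closed[of f r] by simp
  show "f \<in> sklyanin_relations \<alpha> \<beta> \<gamma> \<Longrightarrow> f \<in> I"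
    using genideal_self[of "sklyanin_relations \<alpha> \<beta> \<gamma>"] by (auto simp: sklyanin_ideal_def)
qed

lemma sklyanin_ideal_uminus: "f \<in> I \<Longrightarrow> - f \<in> I"
  using sklyanin_ideal_left[of f "- 1"] by simp

lemma sklyanin_ideal_diff: "f \<in> I \<Longrightarrow> g \<in> I \<Longrightarrow> f - g \<in> I"
  using sklyanin_ideal_add[OF _ sklyanin_ideal_uminus, of f g] by simp

text \<open>The elements with property \<open>P\<close> form a two-sided ideal: multiplication by an
  arbitrary element splits into single terms because \<open>P\<close> is additive.\<close>

lemma sklyanin_ideal_induct [consumes 1, case_names zero rel add left right]:
  assumes "f \<in> I" and zero: "P 0"
    and rel: "\<And>f. f \<in> sklyanin_relations \<alpha> \<beta> \<gamma> \<Longrightarrow> P f"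
    and add: "\<And>f g. P f \<Longrightarrow> P g \<Longrightarrow> P (f + g)"
    and left: "\<And>f u c. P f \<Longrightarrow> P (Poly_Mapping.single u c * f)"
    and right: "\<And>f u c. P f \<Longrightarrow> P (f * Poly_Mapping.single u c)"
  shows "P f"
proof -
  have "ideal {f. P f} type_ring"
  proof (rule type_ring_idealI; clarsimp simp: zero add)
    fix f r :: "'k free_alg"
    assume f: "P f"
    show "P (r * f)"
      by (induction r rule: poly_mapping_single_induct)
        (simp_all add: f zero add left distrib_right)
    show "P (f * r)"
      by (induction r rule: poly_mapping_single_induct)
        (simp_all add: f zero add right distrib_left)
  qed
  then have "I \<subseteq> {f. P f}" unfolding sklyanin_ideal_def
    by (rule ring.genideal_minimal[OF type_ring_ring]) (use rel in auto)
  then show ?thesis using assms(1) by auto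
qed

private abbreviation G_part :: "bit \<times> bit \<Rightarrow> 'k free_alg \<Rightarrow> 'k free_alg" where
  "G_part g \<equiv> rescale (\<lambda>w. if word_degree w = g then 1 else 0)"

text \<open>The generators are homogeneous for G, so the ideal is graded. The degree
  \<open>g\<close> stays arbitrary in the induction because multiplication by a word shifts
  it.\<close>

lemma G_part_in_sklyanin_ideal: "f \<in> I \<Longrightarrow> G_part g f \<in> I"
proof (induction f arbitrary: g rule: sklyanin_ideal_induct)
  case (rel f)
  then obtain h where h: "\<And>w. w \<in> Poly_Mapping.keys f \<Longrightarrow> word_degree w = h"
    by (metis sklyanin_relationsE word_degree_rel4(1))
  show ?case
  proof (cases "g = h")
    case True
    then have "G_part g f = f" by (intro rescale_cong_id) (use h in auto)
    then show ?thesis using rel sklyanin_ideal_rel by simp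
  next
    case False
    then have "G_part g f = 0" by (intro rescale_cong_zero) (use h in auto)
    then show ?thesis by (simp add: sklyanin_ideal_zero)
  qed
next
  case (left f u c)
  have "G_part g (Poly_Mapping.single u c * f) =
      Poly_Mapping.single u (1 * c) * G_part (word_degree u + g) f"
    by (rule rescale_single_mult) (simp add: plus_list_def bit_pair_add_eq_iff)
  then show ?case using left by (simp add: sklyanin_ideal_left)
next
  case (right f u c)
  have "G_part g (f * Poly_Mapping.single u c) =
      G_part (word_degree u + g) f * Poly_Mapping.single u (1 * c)"
    by (rule rescale_mult_single)
      (simp add: plus_list_def bit_pair_add_eq_iff add.commute[of _ "word_degree u"])
  then show ?case using right by (simp add: sklyanin_ideal_right)
qed (simp_all add: sklyanin_ideal_zero rescale_add sklyanin_ideal_add)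

lemma cls_eq_iff: "cls f = cls g \<longleftrightarrow> f - g \<in> I"
proof -
  have eq: "cls f = {h + f | h. h \<in> I}" for f
    by (auto simp: sklyanin_class_def a_r_coset_def r_coset_def type_ring_def)
  show ?thesis
  proof
    assume "cls f = cls g"
    moreover have "f \<in> cls f" unfolding eq using sklyanin_ideal_zero by force
    ultimately show "f - g \<in> I" unfolding eq by auto
  next
    assume *: "f - g \<in> I"
    have "h + f \<in> cls g" if "h \<in> I" for h
      unfolding eq using sklyanin_ideal_add[OF that *] by (auto intro!: exI[of _ "h + (f - g)"])
    moreover have "h + g \<in> cls f" if "h \<in> I" for h
      unfolding eq using sklyanin_ideal_diff[OF that *] by (auto intro!: exI[of _ "h - (f - g)"])
    ultimately show "cls f = cls g" unfolding eq by auto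
  qed
qed

lemma cls_zero: "cls 0 = I"
  by (auto simp: sklyanin_class_def a_r_coset_def r_coset_def type_ring_def)

lemma sklyanin_ring: "ring A"
  unfolding sklyanin_def by (rule ideal.quotient_is_ring[OF ideal_sklyanin_ideal])

lemma sklyanin_ops:
  shows carrier_sklyanin: "carrier A = range cls"
    and zero_sklyanin: "\<zero>\<^bsub>A\<^esub> = cls 0"
    and one_sklyanin: "\<one>\<^bsub>A\<^esub> = cls 1"
    and add_sklyanin: "cls f \<oplus>\<^bsub>A\<^esub> cls g = cls (f + g)"
    and mult_sklyanin: "cls f \<otimes>\<^bsub>A\<^esub> cls g = cls (f * g)"
proof -
  interpret ideal I type_ring by (rule ideal_sklyanin_ideal)
  show "carrier A = range cls"
    by (auto simp: sklyanin_def FactRing_def A_RCOSETS_defs sklyanin_class_def a_r_coset_def)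
  show "\<zero>\<^bsub>A\<^esub> = cls 0"
    by (simp add: cls_zero sklyanin_def FactRing_def)
  show "\<one>\<^bsub>A\<^esub> = cls 1"
    by (simp add: sklyanin_class_def sklyanin_def FactRing_def)
  show "cls f \<oplus>\<^bsub>A\<^esub> cls g = cls (f + g)"
    using a_rcos_sum[of f g] by (simp add: sklyanin_class_def sklyanin_def FactRing_def)
  show "cls f \<otimes>\<^bsub>A\<^esub> cls g = cls (f * g)"
    using rcoset_mult_add[of f g] by (simp add: sklyanin_class_def sklyanin_def FactRing_def)
qed

lemma finsum_cls:
  assumes "finite S"
  shows "finsum A (\<lambda>x. cls (h x)) S = cls (\<Sum>x\<in>S. h x)"
proof -
  interpret ring A by (rule sklyanin_ring)
  show ?thesis using assms
    by (induction S rule: finite_induct)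
      (auto simp: finsum_insert carrier_sklyanin zero_sklyanin add_sklyanin)
qed

lemma sum_G_part: "(\<Sum>g\<in>UNIV. G_part g f) = f"
  by (rule poly_mapping_eqI) (simp add: lookup_sum sum_distrib_right[symmetric])

text \<open>The description by \<open>THE\<close> is legitimate because the ideal is graded: the
  parts of one representative give a decomposition, and any other decomposition agrees with it after
  projection to each degree.\<close>

lemma G_component_cls: "sklyanin_G_component \<alpha> \<beta> \<gamma> (cls f) = (\<lambda>g. cls (G_part g f))"
  unfolding sklyanin_G_component_def
proof (rule the_equality)
  have "cls (G_part g f) \<in> sklyanin_G_part \<alpha> \<beta> \<gamma> g" for g
    unfolding sklyanin_G_part_def
    by (rule imageI) (auto simp: in_keys_iff split: if_splits)
  then show "(\<forall>g. cls (G_part g f) \<in> sklyanin_G_part \<alpha> \<beta> \<gamma> g) \<and>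
      finsum A (\<lambda>g. cls (G_part g f)) UNIV = cls f"
    by (simp add: finsum_cls sum_G_part)
next
  fix c
  assume c: "(\<forall>g. c g \<in> sklyanin_G_part \<alpha> \<beta> \<gamma> g) \<and> finsum A c UNIV = cls f"
  then have "\<forall>g. \<exists>f. c g = cls f \<and> (\<forall>w\<in>Poly_Mapping.keys f. word_degree w = g)"
    unfolding sklyanin_G_part_def by blast
  then obtain F where F: "\<And>g. c g = cls (F g)"
    and keys: "\<And>g w. w \<in> Poly_Mapping.keys (F g) \<Longrightarrow> word_degree w = g" by metis
  have c_eq: "c = (\<lambda>g. cls (F g))" using F by auto
  have "cls (\<Sum>g\<in>UNIV. F g) = cls f" using c unfolding c_eq by (simp add: finsum_cls)
  then have in_I: "(\<Sum>g\<in>UNIV. F g) - f \<in> I" by (simp add: cls_eq_iff)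
  have "cls (F g) = cls (G_part g f)" for g
  proof -
    have "G_part g (\<Sum>h\<in>UNIV. F h) = F g"
    proof (rule poly_mapping_eqI)
      fix w
      have zero: "Poly_Mapping.lookup (F h) w = 0" if "h \<noteq> word_degree w" for h
        using keys[of w h] that by (auto simp: in_keys_iff)
      have "(\<Sum>h\<in>UNIV. Poly_Mapping.lookup (F h) w) = Poly_Mapping.lookup (F (word_degree w)) w"
        by (subst sum.mono_neutral_right[of UNIV "{word_degree w}"]) (auto simp: zero)
      then show "Poly_Mapping.lookup (G_part g (\<Sum>h\<in>UNIV. F h)) w = Poly_Mapping.lookup (F g) w"
        using zero[of g] by (auto simp: lookup_sum)
    qed
    then show ?thesis
      using G_part_in_sklyanin_ideal[OF in_I, of g] by (simp add: cls_eq_iff rescale_diff)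
  qed
  then show "c = (\<lambda>g. cls (G_part g f))" using F by auto
qed

text \<open>Words are homogeneous, so only one pair of degrees contributes to the double
  sum.\<close>

lemma twist_mult_cls_single:
  "twist_mult \<alpha> \<beta> \<gamma> (cls (Poly_Mapping.single u c)) (cls (Poly_Mapping.single v d)) =
    cls (Poly_Mapping.single (u @ v) (cocycle (word_degree u) (word_degree v) * (c * d)))"
proof -
  have part: "G_part g (Poly_Mapping.single w e) =
      (if g = word_degree w then Poly_Mapping.single w e else 0)" for g w e
    by simp
  let ?t = "\<lambda>(g, h). free_const (cocycle g h) *
       (G_part g (Poly_Mapping.single u c) * G_part h (Poly_Mapping.single v d))"
  have "twist_mult \<alpha> \<beta> \<gamma> (cls (Poly_Mapping.single u c)) (cls (Poly_Mapping.single v d)) =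
      finsum A (\<lambda>x. cls (?t x)) UNIV"
    unfolding twist_mult_def Let_def G_component_cls
    by (rule arg_cong[where f = "\<lambda>h. finsum A h UNIV"]) (auto simp: mult_sklyanin)
  also have "\<dots> = cls (\<Sum>x\<in>UNIV. ?t x)"
    by (rule finsum_cls) (simp add: finite_prod)
  also have "(\<Sum>x\<in>UNIV. ?t x) = ?t (word_degree u, word_degree v)"
    by (subst sum.mono_neutral_right[of UNIV "{(word_degree u, word_degree v)}"])
      (auto simp: part finite_prod simp del: rescale_single split: if_splits)
  also have "\<dots> = Poly_Mapping.single (u @ v) (cocycle (word_degree u) (word_degree v) * (c * d))"
    by (simp add: free_const_def mult_single plus_list_def)
  finally show ?thesis .
qed

lemma sum_keys_single: "(\<Sum>w\<in>Poly_Mapping.keys f. Poly_Mapping.single w (s w * Poly_Mapping.lookup f w)) = rescale s f"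
  by (rule poly_mapping_eqI)
    (auto simp: lookup_sum lookup_single when_def in_keys_iff sum.delta')

text \<open>The recursion of \<open>twist_sign\<close> mirrors the right-nested product. Additively
  the twist is the Sklyanin algebra itself, so sums of words need no correction.\<close>

lemma eval_free_twist:
  "eval_free B (sklyanin_scalar \<alpha> \<beta> \<gamma>) (sklyanin_gen \<alpha> \<beta> \<gamma>) f = cls (rescale twist_sign f)"
proof -
  have word: "foldr (\<lambda>i b. sklyanin_gen \<alpha> \<beta> \<gamma> i \<otimes>\<^bsub>B\<^esub> b) w \<one>\<^bsub>B\<^esub> =
      cls (Poly_Mapping.single w (twist_sign w))" for w
  proof (induction w)
    case Nil
    have "(1 :: 'k free_alg) = Poly_Mapping.single [] 1"
      using single_one[where ?'a = "4 list" and ?'b = 'k] by (simp add: zero_list_def)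
    then show ?case by (simp add: cocycle_twist_def one_sklyanin)
  next
    case (Cons i w)
    then show ?case
      by (simp add: cocycle_twist_def free_gen_def twist_mult_cls_single)
  qed
  have "eval_free B (sklyanin_scalar \<alpha> \<beta> \<gamma>) (sklyanin_gen \<alpha> \<beta> \<gamma>) f =
      finsum A (\<lambda>w. cls (Poly_Mapping.single w (twist_sign w * Poly_Mapping.lookup f w)))
        (Poly_Mapping.keys f)"
    unfolding eval_free_def word
    by (simp add: finsum_def cocycle_twist_def free_const_def twist_mult_cls_single mult.commute)
  then show ?thesis by (simp add: finsum_cls sum_keys_single)
qed

end

text \<open>Replaces evaluation in the twist by membership in an ideal with known generators, which
  opens the way to \<open>sklyanin_ideal_induct\<close>.\<close>

lemma in_twist_relations_iff:
  "f \<in> twist_relations \<alpha> \<beta> \<gamma> \<longleftrightarrow> rescale twist_sign f \<in> sklyanin_ideal \<alpha> \<beta> \<gamma>"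
proof -
  have "\<zero>\<^bsub>cocycle_twist \<alpha> \<beta> \<gamma>\<^esub> = sklyanin_class \<alpha> \<beta> \<gamma> 0"
    by (simp add: cocycle_twist_def zero_sklyanin)
  then show ?thesis
    by (simp add: twist_relations_def relation_ideal_def eval_free_twist cls_eq_iff)
qed

section \<open>Vanishing of all relations of the twist along a sequence\<close>

definition twist_pair :: "'k \<Rightarrow> 'k \<Rightarrow> 'k \<Rightarrow> (4 \<Rightarrow> 'k) \<Rightarrow> (4 \<Rightarrow> 'k::comm_ring_1) \<Rightarrow> bool" where
  "twist_pair \<alpha> \<beta> \<gamma> y z \<longleftrightarrow>
     y 0 * z 1 - y 1 * z 0 - \<alpha> * (y 2 * z 3 - y 3 * z 2) = 0 \<and>
     y 0 * z 1 + y 1 * z 0 - (y 2 * z 3 + y 3 * z 2) = 0 \<and>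
     y 0 * z 2 - y 2 * z 0 - \<beta> * (y 3 * z 1 - y 1 * z 3) = 0 \<and>
     y 0 * z 2 + y 2 * z 0 - (y 3 * z 1 + y 1 * z 3) = 0 \<and>
     y 0 * z 3 - y 3 * z 0 + \<gamma> * (y 1 * z 2 - y 2 * z 1) = 0 \<and>
     y 0 * z 3 + y 3 * z 0 + (y 1 * z 2 + y 2 * z 1) = 0"

text \<open>Value of a multilinearised word at a sequence of vectors. The recursion shifts the
  sequence instead of counting positions, which makes concatenation tractable.\<close>

fun word_monomial :: "(nat \<Rightarrow> 4 \<Rightarrow> 'k) \<Rightarrow> 4 list \<Rightarrow> 'k::comm_ring_1" where
  "word_monomial y [] = 1"
| "word_monomial y (i # w) = y 0 i * word_monomial (\<lambda>j. y (Suc j)) w"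

lemma word_monomial_append:
  "word_monomial y (u @ v) = word_monomial y u * word_monomial (\<lambda>j. y (length u + j)) v"
  by (induction u arbitrary: y) (simp_all add: mult.assoc)

lemma word_monomial_prod: "word_monomial y w = (\<Prod>j<length w. y j (w ! j))"
  by (induction w arbitrary: y) (simp_all add: prod.lessThan_Suc_shift del: prod.lessThan_Suc)

lemma lin_ext_twisted_relations:
  "(\<forall>r\<in>twisted_relations \<alpha> \<beta> \<gamma>. lin_ext (word_monomial y) r = 0) \<longleftrightarrow>
     twist_pair \<alpha> \<beta> \<gamma> (y 0) (y 1)"
proof -
  have commutator_rel: "lin_ext (word_monomial y) (rel4 i j k (- 1) (- c) c) =
      y 0 0 * y 1 i - y 0 i * y 1 0 - c * (y 0 j * y 1 k - y 0 k * y 1 j)" for i j k c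
    by (simp add: lin_ext_rel4 right_diff_distrib)
  have "lin_ext (word_monomial y) (rel4 i j k (- 1) c (- c)) =
      y 0 0 * y 1 i - y 0 i * y 1 0 + c * (y 0 j * y 1 k - y 0 k * y 1 j)" for i j k c
    by (simp add: lin_ext_rel4 right_diff_distrib)
  moreover have "lin_ext (word_monomial y) (rel4 i j k 1 (- 1) (- 1)) =
      y 0 0 * y 1 i + y 0 i * y 1 0 - (y 0 j * y 1 k + y 0 k * y 1 j)" for i j k
    by (simp add: lin_ext_rel4)
  moreover have "lin_ext (word_monomial y) (rel4 i j k 1 1 1) =
      y 0 0 * y 1 i + y 0 i * y 1 0 + (y 0 j * y 1 k + y 0 k * y 1 j)" for i j k
    by (simp add: lin_ext_rel4)
  ultimately show ?thesis
    by (simp only: twisted_relations_def twist_pair_def commutator_rel ball_simps simp_thms)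
qed

text \<open>
  Separating word lengths and \<open>G\<close>-degrees makes the vanishing condition stable under
  multiplication: the sign \<^const>\<open>twist_sign\<close> of a product of words depends on the factors only
  through their own signs and their \<open>G\<close>-degrees.
\<close>

lemma sklyanin_ideal_vanishing:
  assumes "f \<in> sklyanin_ideal \<alpha> \<beta> \<gamma>" and "\<And>j. twist_pair \<alpha> \<beta> \<gamma> (y j) (y (Suc j))"
  shows "lin_ext (\<lambda>w. if length w = d \<and> word_degree w = h then twist_sign w * word_monomial y w
           else 0) f = 0"
  using assms
proof (induction f arbitrary: y d h rule: sklyanin_ideal_induct)
  case (rel f)
  then obtain h' where h': "\<And>w. w \<in> Poly_Mapping.keys f \<Longrightarrow> word_degree w = h' \<and> length w = 2"
    by (metis sklyanin_relationsE word_degree_rel4)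
  have "rescale twist_sign f \<in> twisted_relations \<alpha> \<beta> \<gamma>"
    using rel(1) unfolding twisted_relations_def sklyanin_relations_eq
    by (elim insertE emptyE) (simp_all add: rel4_def rescale_add cocycle_def)
  then have "lin_ext (word_monomial y) (rescale twist_sign f) = 0"
    using lin_ext_twisted_relations[of \<alpha> \<beta> \<gamma> y] rel(2)[of 0] by auto
  \<comment> \<open>A relation lives in length 2 and in one G-degree, so the case distinction is
    constant on its words.\<close>
  moreover have "lin_ext (\<lambda>w. if length w = d \<and> word_degree w = h
      then twist_sign w * word_monomial y w else 0) f =
    lin_ext (\<lambda>w. (if d = 2 \<and> h = h' then 1 else 0) * (word_monomial y w * twist_sign w)) f"
    by (rule lin_ext_cong) (use h' in \<open>auto simp: mult.commute\<close>)
  ultimately show ?case by (simp add: lin_ext_rescale lin_ext_scale)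
next
  case (left f u c)
  show ?case
  proof (cases "length u \<le> d")
    case True
    \<comment> \<open>Prefixing \<open>u\<close> shifts the sequence by its length. The remaining
      word must have degree \<open>word_degree u + h\<close>, so its cocycle with \<open>u\<close>
      is a constant.\<close>
    let ?K = "twist_sign u * word_monomial y u * cocycle (word_degree u) (word_degree u + h)"
    let ?y = "\<lambda>j. y (length u + j)"
    have "(\<lambda>w. if length (u + w) = d \<and> word_degree (u + w) = h
            then twist_sign (u + w) * word_monomial y (u + w) else 0) =
        (\<lambda>w. ?K * (if length w = d - length u \<and> word_degree w = word_degree u + h
            then twist_sign w * word_monomial ?y w else 0))"
      using True by (auto simp: fun_eq_iff plus_list_def bit_pair_add_eq_iff twist_sign_append
          word_monomial_append mult_ac)
    then show ?thesis using left.IH[of ?y] left.prems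
      by (simp add: lin_ext_single_mult lin_ext_scale)
  next
    case False
    then have "length (u + w) \<noteq> d" for w by (simp add: plus_list_def)
    then show ?thesis by (subst lin_ext_single_mult) (simp add: lin_ext_def)
  qed
next
  case (right f u c)
  show ?case
  proof (cases "length u \<le> d")
    case True
    \<comment> \<open>A suffix \<open>u\<close> of a word of length \<open>d\<close> starts at
      position \<open>d - length u\<close>; here the rest of the word keeps the unshifted
      sequence.\<close>
    let ?K = "twist_sign u * word_monomial (\<lambda>j. y (d - length u + j)) u *
       cocycle (word_degree u + h) (word_degree u)"
    have "(\<lambda>w. if length (w + u) = d \<and> word_degree (w + u) = h
            then twist_sign (w + u) * word_monomial y (w + u) else 0) =
        (\<lambda>w. ?K * (if length w = d - length u \<and> word_degree w = word_degree u + h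
            then twist_sign w * word_monomial y w else 0))"
      using True by (auto simp: fun_eq_iff plus_list_def bit_pair_add_eq_iff twist_sign_append
          word_monomial_append mult_ac add.commute[of _ "word_degree u"])
    then show ?thesis using right.IH[of y] right.prems
      by (simp add: lin_ext_mult_single lin_ext_scale)
  next
    case False
    then have "length (w + u) \<noteq> d" for w by (simp add: plus_list_def)
    then show ?thesis by (subst lin_ext_mult_single) (simp add: lin_ext_def)
  qed
qed (simp_all add: lin_ext_add)

text \<open>On words of length \<open>d\<close> the monomial is the sum over the four degrees of the
  signed functionals of \<open>sklyanin_ideal_vanishing\<close>, a second sign undoing the
  first.\<close>

lemma twist_relations_vanishing:
  assumes "f \<in> twist_relations \<alpha> \<beta> \<gamma>" "f \<in> free_homogeneous d"
    and "\<And>j. twist_pair \<alpha> \<beta> \<gamma> (y j) (y (Suc j))"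
  shows "lin_ext (word_monomial y) f = 0"
proof -
  let ?t = "\<lambda>h w. if length w = d \<and> word_degree w = h then twist_sign w * word_monomial y w else 0"
  have sgn: "twist_sign w * (twist_sign w * x) = x" for w and x :: 'a
    by (simp add: mult.assoc[symmetric])
  have "lin_ext (word_monomial y) f = lin_ext (\<lambda>w. \<Sum>h\<in>UNIV. ?t h w * twist_sign w) f"
  proof (rule lin_ext_cong)
    fix w assume "w \<in> Poly_Mapping.keys f"
    then have "length w = d" using assms(2) by (simp add: free_homogeneous_def)
    then show "word_monomial y w = (\<Sum>h\<in>UNIV. ?t h w * twist_sign w)"
      by (subst sum_distrib_right[symmetric]) (simp add: mult.commute[of _ "twist_sign w"] sgn)
  qed
  also have "\<dots> = (\<Sum>h\<in>UNIV. lin_ext (\<lambda>w. ?t h w * twist_sign w) f)"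
    unfolding lin_ext_def sum_distrib_left by (rule sum.swap)
  also have "\<dots> = 0"
    unfolding lin_ext_rescale[symmetric]
    using sklyanin_ideal_vanishing[of "rescale twist_sign f" \<alpha> \<beta> \<gamma> y, OF _ assms(3)] assms(1)
    by (simp add: in_twist_relations_iff)
  finally show ?thesis .
qed

lemma rescale_const: "rescale (\<lambda>w. c) f = Poly_Mapping.single 0 c * f"
  by (induction f rule: poly_mapping_single_induct)
    (simp_all add: distrib_left rescale_add mult_single)

lemma rescale_cong:
  "(\<And>w. w \<in> Poly_Mapping.keys f \<Longrightarrow> s w = t w) \<Longrightarrow> rescale s f = rescale t f"
  by (rule poly_mapping_eqI) (simp, metis in_keys_iff mult_zero_right)

text \<open>The relation is homogeneous for G, so the cocycle with the prefix \<open>u\<close> is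
  one overall sign. Such products are the test elements for a single pair of neighbouring
  factors.\<close>

lemma word_twisted_relation_in:
  assumes "r \<in> twisted_relations \<alpha> \<beta> \<gamma>"
  shows "Poly_Mapping.single u 1 * r \<in> twist_relations \<alpha> \<beta> \<gamma>"
proof -
  have r': "rescale twist_sign r \<in> sklyanin_relations \<alpha> \<beta> \<gamma>" (is "?r' \<in> _")
    using assms unfolding twisted_relations_def sklyanin_relations_eq
    by (elim insertE emptyE) (simp_all add: rel4_def rescale_add cocycle_def)
  then obtain h where h: "\<And>w. w \<in> Poly_Mapping.keys ?r' \<Longrightarrow> word_degree w = h"
    by (metis sklyanin_relationsE word_degree_rel4(1))
  have "rescale twist_sign (Poly_Mapping.single u 1 * r) =
      Poly_Mapping.single u (twist_sign u * 1) *
      rescale (\<lambda>w. cocycle (word_degree u) (word_degree w) * twist_sign w) r"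
    by (rule rescale_single_mult) (simp add: plus_list_def twist_sign_append mult_ac)
  also have "rescale (\<lambda>w. cocycle (word_degree u) (word_degree w) * twist_sign w) r =
      rescale (\<lambda>w. cocycle (word_degree u) (word_degree w)) ?r'"
    by (simp add: rescale_rescale)
  also have "\<dots> = rescale (\<lambda>w. cocycle (word_degree u) h) ?r'"
    by (rule rescale_cong) (use h in auto)
  finally show ?thesis
    using r' by (simp add: in_twist_relations_iff rescale_const sklyanin_ideal_left
        sklyanin_ideal_rel)
qed

section \<open>The multilinearised relations modulo an ideal of a local ring\<close>

text \<open>\<open>R\<close> plays the role of a local ring with constants \<open>K\<close> and
  residue map \<open>val\<close>, and \<open>J\<close> that of an ideal. For \<open>R = UNIV\<close>
  and \<open>J = {0}\<close> this is the field itself; otherwise it is the ambient local ring at a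
  point with its stalk ideal.\<close>

locale local_ideal =
  fixes R J :: "'f::field set" and K :: "'k::field \<Rightarrow> 'f" and val :: "'f \<Rightarrow> 'k"
  assumes R_K: "K c \<in> R"
    and R_add: "x \<in> R \<Longrightarrow> y \<in> R \<Longrightarrow> x + y \<in> R"
    and R_mult: "x \<in> R \<Longrightarrow> y \<in> R \<Longrightarrow> x * y \<in> R"
    and R_inverse: "x \<in> R \<Longrightarrow> val x \<noteq> 0 \<Longrightarrow> inverse x \<in> R"
    and K_add: "K (c + d) = K c + K d"
    and K_mult: "K (c * d) = K c * K d"
    and K_1: "K 1 = 1"
    and val_add: "x \<in> R \<Longrightarrow> y \<in> R \<Longrightarrow> val (x + y) = val x + val y"
    and val_mult: "x \<in> R \<Longrightarrow> y \<in> R \<Longrightarrow> val (x * y) = val x * val y"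
    and val_K: "val (K c) = c"
    and J_0: "0 \<in> J"
    and J_add: "x \<in> J \<Longrightarrow> y \<in> J \<Longrightarrow> x + y \<in> J"
    and J_left: "r \<in> R \<Longrightarrow> x \<in> J \<Longrightarrow> r * x \<in> J"
begin

lemma K_0: "K 0 = 0"
  by (metis K_add add.right_neutral add_cancel_right_right)

lemma K_uminus: "K (- c) = - K c"
  using K_add[of c "- c"] by (simp add: K_0 eq_neg_iff_add_eq_0 add.commute)

lemma K_diff: "K (c - d) = K c - K d"
  using K_add[of c "- d"] by (simp add: K_uminus)

lemma K_2: "K 2 = 2"
  using K_add[of 1 1] by (simp add: K_1)

lemma R_1: "1 \<in> R" and R_0: "0 \<in> R" and R_2: "2 \<in> R"
  using R_K[of 1] R_K[of 0] R_K[of 2] by (simp_all add: K_1 K_0 K_2)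

lemma val_1: "val 1 = 1" and val_0: "val 0 = 0" and val_2: "val 2 = 2"
  using val_K[of 1] val_K[of 0] val_K[of 2] by (simp_all add: K_1 K_0 K_2)

lemma R_uminus: "x \<in> R \<Longrightarrow> - x \<in> R"
  using R_mult[OF R_K[of "- 1"], of x] by (simp add: K_uminus K_1)

lemma R_diff: "x \<in> R \<Longrightarrow> y \<in> R \<Longrightarrow> x - y \<in> R"
  using R_add[OF _ R_uminus, of x y] by simp

lemma val_uminus: "x \<in> R \<Longrightarrow> val (- x) = - val x"
  using val_mult[OF R_K[of "- 1"], of x] val_K[of "- 1"] by (simp add: K_uminus K_1)

lemma val_diff: "x \<in> R \<Longrightarrow> y \<in> R \<Longrightarrow> val (x - y) = val x - val y"
  using val_add[OF _ R_uminus, of x y] by (simp add: val_uminus)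

lemma J_uminus: "x \<in> J \<Longrightarrow> - x \<in> J"
  using J_left[OF R_K[of "- 1"], of x] by (simp add: K_uminus K_1)

lemma J_diff: "x \<in> J \<Longrightarrow> y \<in> J \<Longrightarrow> x - y \<in> J"
  using J_add[OF _ J_uminus, of x y] by simp

lemmas R_intros = R_K R_add R_mult R_diff R_uminus R_1 R_0 R_2
lemmas val_simps = val_add val_mult val_diff val_uminus val_K val_1 val_0 val_2 R_intros

lemma J_cancel:
  assumes "x * y \<in> J" "x \<in> R" "val x \<noteq> 0"
  shows "y \<in> J"
proof -
  have "x \<noteq> 0" using assms(3) val_0 by auto
  then have "inverse x * (x * y) = y" by (simp add: mult.assoc[symmetric])
  then show ?thesis using J_left[OF R_inverse[OF assms(2,3)] assms(1)] by (simp only:)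
qed

lemma J_cancel_K: "K c * y \<in> J \<Longrightarrow> c \<noteq> 0 \<Longrightarrow> y \<in> J"
  by (rule J_cancel[of "K c"]) (simp_all add: R_K val_K)

text \<open>
  With \<open>A\<^sub>i = y\<^sub>0z\<^sub>i\<close>, \<open>B\<^sub>i = y\<^sub>iz\<^sub>0\<close>, \<open>C\<^sub>i = y\<^sub>jz\<^sub>k\<close>, \<open>D\<^sub>i = y\<^sub>kz\<^sub>j\<close> for \<open>(i, j, k)\<close> cyclic and \<open>S\<^sub>i = C\<^sub>i + D\<^sub>i\<close>,
  \<open>T\<^sub>i = C\<^sub>i - D\<^sub>i\<close>, the relations express \<open>A\<^sub>i, B\<^sub>i\<close> by \<open>S\<^sub>i, T\<^sub>i\<close>. The three identities
  \<open>A\<^sub>1C\<^sub>1 - B\<^sub>1D\<^sub>1 = A\<^sub>3D\<^sub>3 - B\<^sub>3C\<^sub>3\<close>, \<open>A\<^sub>1D\<^sub>1 - B\<^sub>1C\<^sub>1 = A\<^sub>2C\<^sub>2 - B\<^sub>2D\<^sub>2\<close>, \<open>A\<^sub>2D\<^sub>2 - B\<^sub>2C\<^sub>2 = A\<^sub>3C\<^sub>3 - B\<^sub>3D\<^sub>3\<close>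
  become linear equations for the products \<open>S\<^sub>iT\<^sub>i\<close>, of determinant \<open>2(1 + \<alpha>)(1 + \<beta>)(1 + \<gamma>)\<close>.
\<close>

lemma products_in_J:
  assumes R: "y0 \<in> R" "y1 \<in> R" "y2 \<in> R" "y3 \<in> R" "z0 \<in> R" "z1 \<in> R" "z2 \<in> R" "z3 \<in> R"
    and f1: "y0 * z1 - y1 * z0 - K \<alpha> * (y2 * z3 - y3 * z2) \<in> J" (is "?f1 \<in> J")
    and f2: "y0 * z1 + y1 * z0 - (y2 * z3 + y3 * z2) \<in> J" (is "?f2 \<in> J")
    and f3: "y0 * z2 - y2 * z0 - K \<beta> * (y3 * z1 - y1 * z3) \<in> J" (is "?f3 \<in> J")
    and f4: "y0 * z2 + y2 * z0 - (y3 * z1 + y1 * z3) \<in> J" (is "?f4 \<in> J")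
    and f5: "y0 * z3 - y3 * z0 + K \<gamma> * (y1 * z2 - y2 * z1) \<in> J" (is "?f5 \<in> J")
    and f6: "y0 * z3 + y3 * z0 + (y1 * z2 + y2 * z1) \<in> J" (is "?f6 \<in> J")
    and two: "(2::'k) \<noteq> 0" and par: "\<alpha> + \<beta> + \<gamma> + \<alpha> * \<beta> * \<gamma> = 0"
    and nz: "{\<alpha>, \<beta>, \<gamma>} \<inter> {0, 1, - 1} = {}"
  shows "(y2 * z3 + y3 * z2) * (y2 * z3 - y3 * z2) \<in> J"
    and "(y3 * z1 + y1 * z3) * (y3 * z1 - y1 * z3) \<in> J"
    and "(y1 * z2 + y2 * z1) * (y1 * z2 - y2 * z1) \<in> J"
proof -
  define S1 T1 S2 T2 S3 T3 where ST: "S1 = y2 * z3 + y3 * z2" "T1 = y2 * z3 - y3 * z2"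
    "S2 = y3 * z1 + y1 * z3" "T2 = y3 * z1 - y1 * z3"
    "S3 = y1 * z2 + y2 * z1" "T3 = y1 * z2 - y2 * z1"
  have STR: "S1 \<in> R" "T1 \<in> R" "S2 \<in> R" "T2 \<in> R" "S3 \<in> R" "T3 \<in> R"
    unfolding ST by (intro R_intros R)+
  \<comment> \<open>In A_1 C_1 - B_1 D_1 the squares cancel and only a multiple of S_1 T_1 survives,
    and likewise for index 3 on the other side of the identity. The right-hand side expresses the
    resulting difference by the relations.\<close>
  have "(1 + K \<alpha>) * (S1 * T1) - (1 - K \<gamma>) * (S3 * T3) =
      S3 * ?f5 - T3 * ?f6 - S1 * ?f1 - T1 * ?f2"
    unfolding ST by (simp add: algebra_simps)
  then have "(1 + K \<alpha>) * (S1 * T1) - (1 - K \<gamma>) * (S3 * T3) \<in> J"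
    by (simp only:) (rule J_diff[OF J_diff[OF J_diff[OF J_left[OF STR(5) f5] J_left[OF STR(6) f6]]
      J_left[OF STR(1) f1]] J_left[OF STR(2) f2]])
  then have E1: "K (1 + \<alpha>) * (S1 * T1) - K (1 - \<gamma>) * (S3 * T3) \<in> J" (is "?E1 \<in> J")
    by (simp add: K_add K_diff K_1)
  have "(K \<alpha> - 1) * (S1 * T1) - (1 + K \<beta>) * (S2 * T2) =
      S2 * ?f3 + T2 * ?f4 - S1 * ?f1 + T1 * ?f2"
    unfolding ST by (simp add: algebra_simps)
  then have "(K \<alpha> - 1) * (S1 * T1) - (1 + K \<beta>) * (S2 * T2) \<in> J"
    by (simp only:) (rule J_add[OF J_diff[OF J_add[OF J_left[OF STR(3) f3] J_left[OF STR(4) f4]]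
      J_left[OF STR(1) f1]] J_left[OF STR(2) f2]])
  then have E2: "K (\<alpha> - 1) * (S1 * T1) - K (1 + \<beta>) * (S2 * T2) \<in> J" (is "?E2 \<in> J")
    by (simp add: K_add K_diff K_1)
  have "(K \<beta> - 1) * (S2 * T2) + (1 + K \<gamma>) * (S3 * T3) =
      S3 * ?f5 + T3 * ?f6 - S2 * ?f3 + T2 * ?f4"
    unfolding ST by (simp add: algebra_simps)
  then have "(K \<beta> - 1) * (S2 * T2) + (1 + K \<gamma>) * (S3 * T3) \<in> J"
    by (simp only:) (rule J_add[OF J_diff[OF J_add[OF J_left[OF STR(5) f5] J_left[OF STR(6) f6]]
      J_left[OF STR(3) f3]] J_left[OF STR(4) f4]])
  then have E3: "K (\<beta> - 1) * (S2 * T2) + K (1 + \<gamma>) * (S3 * T3) \<in> J" (is "?E3 \<in> J")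
    by (simp add: K_add K_diff K_1)
  have plus: "1 + \<alpha> \<noteq> 0" "1 + \<beta> \<noteq> 0" "1 + \<gamma> \<noteq> 0" and minus: "1 - \<gamma> \<noteq> 0"
    using nz by (auto simp: add_eq_0_iff)
  \<comment> \<open>The summands are p(1) and p(-1) for p(t) = (1 + \<alpha> t)(1 + \<beta> t)(1 +
    \<gamma> t). The condition on the parameters says that the odd part of p vanishes at 1, so the
    sum is 2 p(1).\<close>
  let ?det = "(1 + \<alpha>) * (1 + \<beta>) * (1 + \<gamma>) + (1 - \<gamma>) * (\<beta> - 1) * (\<alpha> - 1)"
  have "?det = 2 * ((1 + \<alpha>) * (1 + \<beta>) * (1 + \<gamma>)) - 2 * (\<alpha> + \<beta> + \<gamma> + \<alpha> * \<beta> * \<gamma>)"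
    by (simp add: algebra_simps)
  then have det: "?det \<noteq> 0" using plus two by (simp add: par)
  \<comment> \<open>The multipliers are cofactors: the last two terms together eliminate S_2 T_2,
    and the first then removes S_3 T_3.\<close>
  have "K ?det * (S1 * T1) = K ((1 + \<gamma>) * (1 + \<beta>)) * ?E1 + K ((1 - \<gamma>) * (1 + \<beta>)) * ?E3
      + K ((1 - \<gamma>) * (\<beta> - 1)) * ?E2"
    by (simp add: K_add K_diff K_mult K_1 K_2 algebra_simps)
  then have "K ?det * (S1 * T1) \<in> J"
    by (simp only:)
      (rule J_add[OF J_add[OF J_left[OF R_K E1] J_left[OF R_K E3]] J_left[OF R_K E2]])
  then have X1: "S1 * T1 \<in> J" using det by (rule J_cancel_K)
  have "K (1 + \<beta>) * (S2 * T2) = K (\<alpha> - 1) * (S1 * T1) - ?E2" by simp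
  also have "\<dots> \<in> J" by (rule J_diff[OF J_left[OF R_K X1] E2])
  finally have X2: "S2 * T2 \<in> J" using plus(2) by (rule J_cancel_K)
  have "K (1 - \<gamma>) * (S3 * T3) = K (1 + \<alpha>) * (S1 * T1) - ?E1" by simp
  also have "\<dots> \<in> J" by (rule J_diff[OF J_left[OF R_K X1] E1])
  finally have X3: "S3 * T3 \<in> J" using minus by (rule J_cancel_K)
  show "(y2 * z3 + y3 * z2) * (y2 * z3 - y3 * z2) \<in> J" using X1 by (simp only: ST)
  show "(y3 * z1 + y1 * z3) * (y3 * z1 - y1 * z3) \<in> J" using X2 by (simp only: ST)
  show "(y1 * z2 + y2 * z1) * (y1 * z2 - y2 * z1) \<in> J" using X3 by (simp only: ST)
qed

end

text \<open>
  The points other than the \<open>e\<^sub>i\<close> lie in four families, indexed by sign triples: in the sequence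
  given by a point module, \<open>(1, p\<^sub>1, p\<^sub>2, p\<^sub>3)\<close> is followed by \<open>(1, e\<^sub>1p\<^sub>1, e\<^sub>2p\<^sub>2, e\<^sub>3p\<^sub>3)\<close>.
\<close>

definition sign_triple :: "'k::field \<Rightarrow> 'k \<Rightarrow> 'k \<Rightarrow> bool" where
  "sign_triple e1 e2 e3 \<longleftrightarrow> (e1, e2, e3) \<in> {(1, 1, 1), (1, - 1, - 1), (- 1, 1, - 1), (- 1, - 1, 1)}"

text \<open>With b = e a coordinatewise the two relations for index i read (e_i - 1) a_i = c (e_k -
  e_j) a_j a_k and (e_i + 1) a_i = d (e_k + e_j) a_j a_k. In a sign triple e_j = e_i e_k, so one of
  them is trivial and the other, halved, gives this coefficient of a_j a_k.\<close>

definition family_coeff :: "'k::field \<Rightarrow> 'k \<Rightarrow> 'k \<Rightarrow> 'k \<Rightarrow> 'k" where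
  "family_coeff c d ei ek = (if ei = 1 then d * ek else - c * ek)"

context local_ideal
begin

text \<open>Written for one cyclic (i, j, k), with c and d the constants of the difference and the
  sum relation, so that it serves all three indices; the third has c = -\<gamma> and d = -1. The
  values at j and k decide which of S and T is a unit, and the relation containing the other one
  gives b_i.\<close>

lemma coordinate_step:
  assumes R: "ai \<in> R" "bi \<in> R" "aj \<in> R" "bj \<in> R" "ak \<in> R" "bk \<in> R"
    and f: "bi - ai - K c * (aj * bk - ak * bj) \<in> J" (is "?f \<in> J")
    and g: "bi + ai - K d * (aj * bk + ak * bj) \<in> J" (is "?g \<in> J")
    and U: "(aj * bk + ak * bj) * (aj * bk - ak * bj) \<in> J"
    and two: "(2::'k) \<noteq> 0" and e: "sign_triple ei ej ek"
    and val: "val bj = ej * val aj" "val bk = ek * val ak" "val aj \<noteq> 0" "val ak \<noteq> 0"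
  shows "bi - K ei * ai \<in> J"
proof -
  have ee: "ei = 1 \<and> ek = ej \<and> ej \<noteq> 0 \<or> ei = - 1 \<and> ek = - ej \<and> ej \<noteq> 0"
    using e by (auto simp: sign_triple_def)
  have SR: "aj * bk + ak * bj \<in> R" and TR: "aj * bk - ak * bj \<in> R" by (intro R_intros R)+
  from ee show ?thesis
  proof (elim disjE conjE)
    assume ei: "ei = 1" and "ek = ej" "ej \<noteq> 0"
    then have "val (aj * bk + ak * bj) = 2 * ej * val aj * val ak"
      using val R by (simp add: val_simps algebra_simps)
    then have "val (aj * bk + ak * bj) \<noteq> 0" using val two \<open>ej \<noteq> 0\<close> by simp
    then have T: "aj * bk - ak * bj \<in> J" using J_cancel[OF U SR] by simp
    have "bi - K ei * ai = ?f + K c * (aj * bk - ak * bj)" by (simp add: ei K_1)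
    also have "\<dots> \<in> J" by (rule J_add[OF f J_left[OF R_K T]])
    finally show ?thesis .
  next
    assume ei: "ei = - 1" and "ek = - ej" "ej \<noteq> 0"
    then have "val (aj * bk - ak * bj) = - 2 * ej * val aj * val ak"
      using val R by (simp add: val_simps algebra_simps)
    then have "val (aj * bk - ak * bj) \<noteq> 0" using val two \<open>ej \<noteq> 0\<close> by simp
    then have S: "aj * bk + ak * bj \<in> J"
      using J_cancel[of "aj * bk - ak * bj" "aj * bk + ak * bj"] U TR by (simp add: mult.commute)
    have "bi - K ei * ai = ?g + K d * (aj * bk + ak * bj)" by (simp add: ei K_1 K_uminus)
    also have "\<dots> \<in> J" by (rule J_add[OF g J_left[OF R_K S]])
    finally show ?thesis .
  qed
qed

text \<open>Substituting b = e a modulo J into the one of the two relations that does not become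
  trivial gives twice the asserted equation.\<close>

lemma family_step:
  assumes R: "ai \<in> R" "bi \<in> R" "aj \<in> R" "bj \<in> R" "ak \<in> R" "bk \<in> R"
    and f: "bi - ai - K c * (aj * bk - ak * bj) \<in> J" (is "?f \<in> J")
    and g: "bi + ai - K d * (aj * bk + ak * bj) \<in> J" (is "?g \<in> J")
    and two: "(2::'k) \<noteq> 0" and e: "sign_triple ei ej ek"
    and ai: "bi - K ei * ai \<in> J" and aj: "bj - K ej * aj \<in> J" and ak: "bk - K ek * ak \<in> J"
  shows "ai - K (family_coeff c d ei ek) * aj * ak \<in> J"
proof -
  have ee: "ei = 1 \<and> ek = ej \<or> ei = - 1 \<and> ek = - ej"
    using e by (auto simp: sign_triple_def)
  have "K 2 * (ai - K (family_coeff c d ei ek) * aj * ak) \<in> J"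
    using ee
  proof (elim disjE conjE)
    assume e: "ei = 1" "ek = ej"
    have "K 2 * (ai - K (family_coeff c d ei ek) * aj * ak) =
        ?g - (bi - K ei * ai) + K d * (aj * (bk - K ek * ak) + ak * (bj - K ej * aj))"
      by (simp add: e family_coeff_def K_2 K_1 K_mult algebra_simps)
    also have "\<dots> \<in> J" by (rule J_add[OF J_diff[OF g ai]
          J_left[OF R_K J_add[OF J_left[OF R(3) ak] J_left[OF R(5) aj]]]])
    finally show ?thesis .
  next
    assume e: "ei = - 1" "ek = - ej"
    have ne: "(- 1 :: 'k) \<noteq> 1" using two by (metis add.right_inverse one_add_one)
    have "K 2 * (ai - K (family_coeff c d ei ek) * aj * ak) =
        (bi - K ei * ai) - ?f - K c * (aj * (bk - K ek * ak) - ak * (bj - K ej * aj))"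
      by (simp add: e ne family_coeff_def K_2 K_1 K_mult K_uminus algebra_simps)
    also have "\<dots> \<in> J" by (rule J_diff[OF J_diff[OF ai f]
          J_left[OF R_K J_diff[OF J_left[OF R(3) ak] J_left[OF R(5) aj]]]])
    finally show ?thesis .
  qed
  then show ?thesis using two by (rule J_cancel_K)
qed

text \<open>Modulo J the two equations give x (1 - l m z^2) = 0 with x a unit, so z is a square root
  of a constant. As 2 is invertible the two roots have different values: z + val z is a unit and can
  be cancelled.\<close>

lemma family_rigid:
  assumes R: "x \<in> R" "y \<in> R" "z \<in> R"
    and x: "x - K l * y * z \<in> J" and y: "y - K m * z * x \<in> J"
    and two: "(2::'k) \<noteq> 0"
    and val: "val x = l * val y * val z" "val y = m * val z * val x" "val x \<noteq> 0" "val z \<noteq> 0"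
  shows "z - K (val z) \<in> J"
proof -
  have lm: "l * m \<noteq> 0" using val by auto
  have "val x * (l * m * val z * val z) = val x * 1" using val(1,2) by (simp add: mult_ac)
  then have sq: "l * m * (val z * val z) = 1" using val(3) by (simp add: mult.assoc)
  have "x * (1 - K (l * m) * (z * z)) = (x - K l * y * z) + K l * z * (y - K m * z * x)"
    by (simp add: K_mult algebra_simps)
  also have "\<dots> \<in> J" by (rule J_add[OF x J_left[OF R_mult[OF R_K R(3)] y]])
  finally have "1 - K (l * m) * (z * z) \<in> J" using J_cancel R val by blast
  moreover have "1 - K (l * m) * (z * z) = K (- (l * m)) * ((z + K (val z)) * (z - K (val z)))"
  proof -
    have "K (l * m) * (K (val z) * K (val z)) = 1"
      using sq by (simp add: K_mult[symmetric] K_1)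
    then show ?thesis by (simp add: K_uminus algebra_simps)
  qed
  ultimately have "(z + K (val z)) * (z - K (val z)) \<in> J"
    using J_cancel_K[of "- (l * m)"] lm by simp
  moreover have "val (z + K (val z)) \<noteq> 0"
    using R val two by (simp add: val_simps flip: mult_2)
  ultimately show ?thesis using J_cancel R_add[OF R(3) R_K] by blast
qed

text \<open>Nakayama's lemma for three elements: x = M x modulo J with all entries of M of value 0.
  Eliminating x1 leaves a 2 by 2 system whose pivots and determinant have value 1.\<close>

lemma contraction:
  assumes R: "x1 \<in> R" "x2 \<in> R" "x3 \<in> R"
    and m: "m12 \<in> R" "m13 \<in> R" "m21 \<in> R" "m23 \<in> R" "m31 \<in> R" "m32 \<in> R"
    and v: "val m12 = 0" "val m13 = 0" "val m21 = 0" "val m23 = 0" "val m31 = 0" "val m32 = 0"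
    and x1: "x1 - (m12 * x2 + m13 * x3) \<in> J" (is "?f1 \<in> J")
    and x2: "x2 - (m21 * x1 + m23 * x3) \<in> J" (is "?f2 \<in> J")
    and x3: "x3 - (m31 * x1 + m32 * x2) \<in> J" (is "?f3 \<in> J")
  shows "x1 \<in> J" "x2 \<in> J" "x3 \<in> J"
proof -
  have "(1 - m21 * m12) * x2 - (m23 + m21 * m13) * x3 = ?f2 + m21 * ?f1"
    by (simp add: algebra_simps)
  also have "\<dots> \<in> J" by (rule J_add[OF x2 J_left[OF m(3) x1]])
  finally have g2: "(1 - m21 * m12) * x2 - (m23 + m21 * m13) * x3 \<in> J" (is "?g2 \<in> J") .
  have "(1 - m31 * m13) * x3 - (m32 + m31 * m12) * x2 = ?f3 + m31 * ?f1"
    by (simp add: algebra_simps)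
  also have "\<dots> \<in> J" by (rule J_add[OF x3 J_left[OF m(5) x1]])
  finally have g3: "(1 - m31 * m13) * x3 - (m32 + m31 * m12) * x2 \<in> J" (is "?g3 \<in> J") .
  let ?u = "(1 - m21 * m12) * (1 - m31 * m13) - (m32 + m31 * m12) * (m23 + m21 * m13)"
  have "?u * x3 = (1 - m21 * m12) * ?g3 + (m32 + m31 * m12) * ?g2"
    by (simp add: algebra_simps)
  also have "\<dots> \<in> J" by (rule J_add[OF J_left[OF _ g3] J_left[OF _ g2]]) (intro R_intros m)+
  finally show X3: "x3 \<in> J"
    by (rule J_cancel) (intro R_intros m, simp add: val_simps m v)
  have "(1 - m21 * m12) * x2 = ?g2 + (m23 + m21 * m13) * x3" by simp
  also have "\<dots> \<in> J" by (rule J_add[OF g2 J_left[OF _ X3]]) (intro R_intros m)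
  finally show X2: "x2 \<in> J"
    by (rule J_cancel) (intro R_intros m, simp add: val_simps m v)
  have "x1 = ?f1 + (m12 * x2 + m13 * x3)" by simp
  also have "\<dots> \<in> J" by (rule J_add[OF x1 J_add[OF J_left[OF m(1) X2] J_left[OF m(2) X3]]])
  finally show "x1 \<in> J" .
qed

text \<open>The a and b are the coordinates of two neighbours other than the normalised one. The
  equations are regarded as linear in b with coefficients built from a, which have value 0, so
  \<open>contraction\<close> applies; the sum relations then give a.\<close>

lemma coordinate_point_rigid:
  assumes R: "a1 \<in> R" "a2 \<in> R" "a3 \<in> R" "b1 \<in> R" "b2 \<in> R" "b3 \<in> R"
    and val: "val a1 = 0" "val a2 = 0" "val a3 = 0" "val b1 = 0" "val b2 = 0" "val b3 = 0"
    and two: "(2::'k) \<noteq> 0"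
    and f: "b1 - a1 - K c1 * (a2 * b3 - a3 * b2) \<in> J" "b1 + a1 - K d1 * (a2 * b3 + a3 * b2) \<in> J"
      "b2 - a2 - K c2 * (a3 * b1 - a1 * b3) \<in> J" "b2 + a2 - K d2 * (a3 * b1 + a1 * b3) \<in> J"
      "b3 - a3 - K c3 * (a1 * b2 - a2 * b1) \<in> J" "b3 + a3 - K d3 * (a1 * b2 + a2 * b1) \<in> J"
  shows "a1 \<in> J" "a2 \<in> J" "a3 \<in> J" "b1 \<in> J" "b2 \<in> J" "b3 \<in> J"
proof -
  \<comment> \<open>Adding the two relations removes a and leaves 2 b = (d - c) w b_j + (d + c) u
    b_k.\<close>
  have solve: "b - (K ((d - c) / 2) * w * bj + K ((d + c) / 2) * u * bk) \<in> J"
    if "b - a - K c * (u * bk - w * bj) \<in> J" "b + a - K d * (u * bk + w * bj) \<in> J"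
    for a b c d u w bj bk
  proof -
    have half: "K 2 * K ((d - c) / 2) = K d - K c" "K 2 * K ((d + c) / 2) = K d + K c"
      unfolding K_mult[symmetric] times_divide_eq_right nonzero_mult_div_cancel_left[OF two]
      by (simp_all add: K_diff K_add)
    have "K 2 * (b - (K ((d - c) / 2) * w * bj + K ((d + c) / 2) * u * bk)) =
        K 2 * b - ((K 2 * K ((d - c) / 2)) * (w * bj) + (K 2 * K ((d + c) / 2)) * (u * bk))"
      by (simp add: algebra_simps)
    also have "\<dots> = (b - a - K c * (u * bk - w * bj)) + (b + a - K d * (u * bk + w * bj))"
      unfolding half by (simp add: K_2 algebra_simps)
    also have "\<dots> \<in> J" using that by (rule J_add)
    finally show ?thesis using two by (rule J_cancel_K)
  qed
  \<comment> \<open>The second index has its neighbours in the cyclic order 3, 1, so the summands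
    are exchanged to fit the system.\<close>
  have g2: "b2 - (K ((d2 + c2) / 2) * a3 * b1 + K ((d2 - c2) / 2) * a1 * b3) \<in> J"
    using solve[OF f(3,4)] by (simp add: add.commute)
  note b = contraction[OF R(4-6) _ _ _ _ _ _ _ _ _ _ _ _
      solve[OF f(1,2)] g2 solve[OF f(5,6)]]
  show b1: "b1 \<in> J" by (rule b(1)) (simp_all add: val_simps R val)
  show b2: "b2 \<in> J" by (rule b(2)) (simp_all add: val_simps R val)
  show b3: "b3 \<in> J" by (rule b(3)) (simp_all add: val_simps R val)
  have a: "a \<in> J" if "b + a - K d * (u * bk + w * bj) \<in> J" "b \<in> J" "bk \<in> J" "bj \<in> J" "u \<in> R" "w \<in> R"
    for a b d u w bj bk
  proof -
    have "a = (b + a - K d * (u * bk + w * bj)) - b + K d * (u * bk + w * bj)" by simp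
    also have "\<dots> \<in> J" by (rule J_add[OF J_diff[OF that(1,2)]
          J_left[OF R_K J_add[OF J_left[OF that(5,3)] J_left[OF that(6,4)]]]])
    finally show ?thesis .
  qed
  show "a1 \<in> J" by (rule a[OF f(2)]) (simp_all add: b1 b2 b3 R)
  show "a2 \<in> J" by (rule a[OF f(4)]) (simp_all add: b1 b2 b3 R)
  show "a3 \<in> J" by (rule a[OF f(6)]) (simp_all add: b1 b2 b3 R)
qed

end

text \<open>Equations of a family in the chart where coordinate 0 is 1, one for each cyclic rotation
  of (1, 2, 3). The constants -\<gamma> and -1 reflect the reversed signs in the last pair of
  twisted relations.\<close>

definition on_family ::
  "'k \<Rightarrow> 'k \<Rightarrow> 'k \<Rightarrow> 'k \<Rightarrow> 'k \<Rightarrow> 'k \<Rightarrow> 'k \<Rightarrow> 'k \<Rightarrow> 'k::field \<Rightarrow> bool" where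
  "on_family \<alpha> \<beta> \<gamma> e1 e2 e3 p1 p2 p3 \<longleftrightarrow> sign_triple e1 e2 e3 \<and>
     p1 \<noteq> 0 \<and> p2 \<noteq> 0 \<and> p3 \<noteq> 0 \<and>
     p1 = family_coeff \<alpha> 1 e1 e3 * p2 * p3 \<and>
     p2 = family_coeff \<beta> 1 e2 e1 * p3 * p1 \<and>
     p3 = family_coeff (- \<gamma>) (- 1) e3 e2 * p1 * p2"

context local_ideal
begin

text \<open>The values of the successor decide the units in \<open>coordinate_step\<close>. Each
  step is taken in all three rotations, since a coordinate is pinned down by the family equations of
  the other two.\<close>

lemma family_point_rigid:
  assumes R: "a1 \<in> R" "a2 \<in> R" "a3 \<in> R" "b1 \<in> R" "b2 \<in> R" "b3 \<in> R"
    and f: "b1 - a1 - K \<alpha> * (a2 * b3 - a3 * b2) \<in> J" "b1 + a1 - (a2 * b3 + a3 * b2) \<in> J"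
      "b2 - a2 - K \<beta> * (a3 * b1 - a1 * b3) \<in> J" "b2 + a2 - (a3 * b1 + a1 * b3) \<in> J"
      "b3 - a3 + K \<gamma> * (a1 * b2 - a2 * b1) \<in> J" "b3 + a3 + (a1 * b2 + a2 * b1) \<in> J"
    and two: "(2::'k) \<noteq> 0" and par: "\<alpha> + \<beta> + \<gamma> + \<alpha> * \<beta> * \<gamma> = 0"
    and nz: "{\<alpha>, \<beta>, \<gamma>} \<inter> {0, 1, - 1} = {}"
    and fam: "on_family \<alpha> \<beta> \<gamma> e1 e2 e3 (val a1) (val a2) (val a3)"
    and val: "val b1 = e1 * val a1" "val b2 = e2 * val a2" "val b3 = e3 * val a3"
  shows "a1 - K (val a1) \<in> J" "a2 - K (val a2) \<in> J" "a3 - K (val a3) \<in> J"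
proof -
  have e1: "sign_triple e1 e2 e3" using fam unfolding on_family_def by blast
  then have e: "sign_triple e1 e2 e3" "sign_triple e2 e3 e1" "sign_triple e3 e1 e2"
    by (auto simp: sign_triple_def)
  have p: "val a1 \<noteq> 0" "val a2 \<noteq> 0" "val a3 \<noteq> 0"
    "val a1 = family_coeff \<alpha> 1 e1 e3 * val a2 * val a3"
    "val a2 = family_coeff \<beta> 1 e2 e1 * val a3 * val a1"
    "val a3 = family_coeff (- \<gamma>) (- 1) e3 e2 * val a1 * val a2"
    using fam unfolding on_family_def by blast+
  have f': "b1 + a1 - K 1 * (a2 * b3 + a3 * b2) \<in> J" "b2 + a2 - K 1 * (a3 * b1 + a1 * b3) \<in> J"
    "b3 - a3 - K (- \<gamma>) * (a1 * b2 - a2 * b1) \<in> J" "b3 + a3 - K (- 1) * (a1 * b2 + a2 * b1) \<in> J"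
    using f by (simp_all only: K_1 K_uminus mult_minus_left diff_minus_eq_add mult_1_left)
  have f1: "1 * b1 - a1 * 1 - K \<alpha> * (a2 * b3 - a3 * b2) \<in> J" "1 * b1 + a1 * 1 - (a2 * b3 + a3 * b2) \<in> J"
      "1 * b2 - a2 * 1 - K \<beta> * (a3 * b1 - a1 * b3) \<in> J" "1 * b2 + a2 * 1 - (a3 * b1 + a1 * b3) \<in> J"
      "1 * b3 - a3 * 1 + K \<gamma> * (a1 * b2 - a2 * b1) \<in> J" "1 * b3 + a3 * 1 + (a1 * b2 + a2 * b1) \<in> J"
    using f by simp_all
  note U = products_in_J[OF R_1 R(1-3) R_1 R(4-6) f1 two par nz]
  have ab: "b1 - K e1 * a1 \<in> J" "b2 - K e2 * a2 \<in> J" "b3 - K e3 * a3 \<in> J"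
    using coordinate_step[OF R(1,4,2,5,3,6) f(1) f'(1) U(1) two e(1) val(2,3) p(2,3)]
      coordinate_step[OF R(2,5,3,6,1,4) f(3) f'(2) U(2) two e(2) val(3,1) p(3,1)]
      coordinate_step[OF R(3,6,1,4,2,5) f'(3,4) U(3) two e(3) val(1,2) p(1,2)]
    by simp_all
  have q: "a1 - K (family_coeff \<alpha> 1 e1 e3) * a2 * a3 \<in> J"
    "a2 - K (family_coeff \<beta> 1 e2 e1) * a3 * a1 \<in> J"
    "a3 - K (family_coeff (- \<gamma>) (- 1) e3 e2) * a1 * a2 \<in> J"
    using family_step[OF R(1,4,2,5,3,6) f(1) f'(1) two e(1) ab]
      family_step[OF R(2,5,3,6,1,4) f(3) f'(2) two e(2) ab(2,3,1)]
      family_step[OF R(3,6,1,4,2,5) f'(3,4) two e(3) ab(3,1,2)]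
    by simp_all
  show "a3 - K (val a3) \<in> J" by (rule family_rigid[OF R(1-3) q(1,2) two p(4,5,1,3)])
  show "a1 - K (val a1) \<in> J" by (rule family_rigid[OF R(2,3,1) q(2,3) two p(5,6,2,1)])
  show "a2 - K (val a2) \<in> J" by (rule family_rigid[OF R(3,1,2) q(3,1) two p(6,4,3,2)])
qed

end

section \<open>The solutions of the multilinearised relations\<close>

text \<open>Here s and t are the squares of S and T. If s vanishes by choice for an odd number of
  indices and t for the others, the equations force some x = -x and everything is zero. For an even
  number the three remaining unknowns, scaled by the parameters, agree up to sign, so they are all
  zero or all nonzero.\<close>

lemma square_cases:
  fixes s1 t1 s2 t2 s3 t3 :: "'k::field"
  assumes two: "(2::'k) \<noteq> 0" and nz: "\<alpha> \<noteq> 0" "\<beta> \<noteq> 0" "\<gamma> \<noteq> 0"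
    and eq: "s1 + \<alpha> * t1 = - s3 + \<gamma> * t3" "s1 - \<alpha> * t1 = s2 + \<beta> * t2" "s2 - \<beta> * t2 = - s3 - \<gamma> * t3"
    and st: "s1 = 0 \<or> t1 = 0" "s2 = 0 \<or> t2 = 0" "s3 = 0 \<or> t3 = 0"
  obtains "s1 = 0" "t1 = 0" "s2 = 0" "t2 = 0" "s3 = 0" "t3 = 0"
  | "s1 \<noteq> 0" "t1 = 0" "s2 \<noteq> 0" "t2 = 0" "s3 \<noteq> 0" "t3 = 0"
  | "s1 \<noteq> 0" "t1 = 0" "s2 = 0" "t2 \<noteq> 0" "s3 = 0" "t3 \<noteq> 0"
  | "s1 = 0" "t1 \<noteq> 0" "s2 \<noteq> 0" "t2 = 0" "s3 = 0" "t3 \<noteq> 0"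
  | "s1 = 0" "t1 \<noteq> 0" "s2 = 0" "t2 \<noteq> 0" "s3 \<noteq> 0" "t3 = 0"
proof -
  have self_neg: "x = 0" if "x = - x" for x :: 'k
    using that two by (metis add.right_inverse mult_2 mult_eq_0_iff)
  define a b g where abg: "a = \<alpha> * t1" "b = \<beta> * t2" "g = \<gamma> * t3"
  have zero: "a = 0 \<longleftrightarrow> t1 = 0" "b = 0 \<longleftrightarrow> t2 = 0" "g = 0 \<longleftrightarrow> t3 = 0"
    using nz by (simp_all add: abg)
  have eq': "s1 + a = - s3 + g" "s1 - a = s2 + b" "s2 - b = - s3 - g"
    using eq by (simp_all add: abg)
  note all_zero = that(1)[unfolded zero[symmetric]] and TTT = that(2)[unfolded zero[symmetric]]
    and TSS = that(3)[unfolded zero[symmetric]] and STS = that(4)[unfolded zero[symmetric]]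
    and SST = that(5)[unfolded zero[symmetric]]
  show thesis
    using st[folded zero]
  proof (elim disjE)
    assume *: "s1 = 0" "s2 = 0" "s3 = 0"
    have abg: "a = g" using eq'(1) * by simp
    moreover have "b = - a" using eq'(2) * by simp
    moreover have "b = g" using eq'(3) * by simp
    ultimately have "a = - a" by metis
    then have "a = 0" by (rule self_neg)
    moreover from this have "g = 0" "b = 0" using abg \<open>b = - a\<close> by simp_all
    ultimately show thesis using * all_zero by simp
  next
    assume *: "s1 = 0" "s2 = 0" "g = 0"
    then have "a = - s3" "b = - a" using eq' by simp_all
    then show thesis using * all_zero SST by (cases "s3 = 0") simp_all
  next
    assume *: "s1 = 0" "b = 0" "s3 = 0"
    then have "a = g" "s2 = - g" using eq' by simp_all
    then show thesis using * all_zero STS by (cases "g = 0") simp_all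
  next
    assume *: "s1 = 0" "b = 0" "g = 0"
    then have "a = - s3" "s2 = - a" "s2 = - s3" using eq' by simp_all
    then show thesis using self_neg[of s3] * all_zero by simp
  next
    assume *: "a = 0" "s2 = 0" "s3 = 0"
    then have "s1 = g" "s1 = b" using eq' by simp_all
    then show thesis using * all_zero TSS by (cases "g = 0") simp_all
  next
    assume *: "a = 0" "s2 = 0" "g = 0"
    have s1: "s1 = b" using eq'(2) * by simp
    moreover have "s1 = - s3" using eq'(1) * by simp
    moreover have b: "b = s3" using eq'(3) * by simp
    ultimately have "s3 = - s3" by metis
    then have "s3 = 0" by (rule self_neg)
    then show thesis using s1 b * all_zero by simp
  next
    assume *: "a = 0" "b = 0" "s3 = 0"
    then have "s1 = g" "s1 = s2" "s2 = - g" using eq' by simp_all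
    then show thesis using self_neg[of g] * all_zero by simp
  next
    assume *: "a = 0" "b = 0" "g = 0"
    then have "s1 = - s3" "s1 = s2" using eq' by simp_all
    then show thesis using * all_zero TTT by (cases "s3 = 0") simp_all
  qed
qed

text \<open>The equations S_i T_i = 0 alone leave all mixed patterns open; linear equations between
  the squares, from the same quartic monomials, exclude the wrong ones.\<close>

lemma twist_pair_cases:
  fixes y z :: "4 \<Rightarrow> 'k::field"
  assumes two: "(2::'k) \<noteq> 0" and par: "\<alpha> + \<beta> + \<gamma> + \<alpha> * \<beta> * \<gamma> = 0"
    and nz: "{\<alpha>, \<beta>, \<gamma>} \<inter> {0, 1, - 1} = {}"
    and pair: "twist_pair \<alpha> \<beta> \<gamma> y z" and yz: "y \<noteq> (\<lambda>i. 0)" "z \<noteq> (\<lambda>i. 0)"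
  obtains (coordinate) i where "\<And>j. j \<noteq> i \<Longrightarrow> y j = 0 \<and> z j = 0"
  | (family) e1 e2 e3 where "y 0 \<noteq> 0" "z 0 \<noteq> 0"
      "on_family \<alpha> \<beta> \<gamma> e1 e2 e3 (y 1 / y 0) (y 2 / y 0) (y 3 / y 0)"
      "z 1 / z 0 = e1 * (y 1 / y 0)" "z 2 / z 0 = e2 * (y 2 / y 0)" "z 3 / z 0 = e3 * (y 3 / y 0)"
proof -
  \<comment> \<open>The field as a local ring with zero ideal, so that congruences become
    equations.\<close>
  interpret local_ideal UNIV "{0}" "\<lambda>c. c" "\<lambda>c::'k. c"
    by unfold_locales auto
  have family_intro: thesis
    if e: "sign_triple e1 e2 e3" and n: "y 0 \<noteq> 0" "z 0 \<noteq> 0" "y 1 \<noteq> 0" "y 2 \<noteq> 0" "y 3 \<noteq> 0"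
      and ze: "y 0 * z 1 = e1 * y 1 * z 0" "y 0 * z 2 = e2 * y 2 * z 0" "y 0 * z 3 = e3 * y 3 * z 0"
    for e1 e2 e3
  proof -
    define a1 a2 a3 b1 b2 b3 where ab: "a1 = y 1 / y 0" "a2 = y 2 / y 0" "a3 = y 3 / y 0"
      "b1 = z 1 / z 0" "b2 = z 2 / z 0" "b3 = z 3 / z 0"
    have e': "sign_triple e2 e3 e1" "sign_triple e3 e1 e2" using e by (auto simp: sign_triple_def)
    have y: "y 1 = y 0 * a1" "y 2 = y 0 * a2" "y 3 = y 0 * a3"
      "z 1 = z 0 * b1" "z 2 = z 0 * b2" "z 3 = z 0 * b3" using n by (simp_all add: ab)
    have b: "b1 = e1 * a1" "b2 = e2 * a2" "b3 = e3 * a3"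
      using ze n unfolding y by (simp_all add: mult_ac)
    have "y 0 * z 0 * (b1 - a1 - \<alpha> * (a2 * b3 - a3 * b2)) = 0"
      "y 0 * z 0 * (b1 + a1 - 1 * (a2 * b3 + a3 * b2)) = 0"
      "y 0 * z 0 * (b2 - a2 - \<beta> * (a3 * b1 - a1 * b3)) = 0"
      "y 0 * z 0 * (b2 + a2 - 1 * (a3 * b1 + a1 * b3)) = 0"
      "y 0 * z 0 * (b3 - a3 - (- \<gamma>) * (a1 * b2 - a2 * b1)) = 0"
      "y 0 * z 0 * (b3 + a3 - (- 1) * (a1 * b2 + a2 * b1)) = 0"
      using pair unfolding twist_pair_def y by (simp_all add: algebra_simps)
    then have f: "b1 - a1 - \<alpha> * (a2 * b3 - a3 * b2) \<in> {0}"
      "b1 + a1 - 1 * (a2 * b3 + a3 * b2) \<in> {0}"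
      "b2 - a2 - \<beta> * (a3 * b1 - a1 * b3) \<in> {0}"
      "b2 + a2 - 1 * (a3 * b1 + a1 * b3) \<in> {0}"
      "b3 - a3 - (- \<gamma>) * (a1 * b2 - a2 * b1) \<in> {0}"
      "b3 + a3 - (- 1) * (a1 * b2 + a2 * b1) \<in> {0}"
      using n by (simp_all only: mult_eq_0_iff simp_thms singleton_iff)
    have an: "a1 \<noteq> 0" "a2 \<noteq> 0" "a3 \<noteq> 0" using n by (simp_all add: ab)
    have in0: "b1 - e1 * a1 \<in> {0}" "b2 - e2 * a2 \<in> {0}" "b3 - e3 * a3 \<in> {0}" using b by simp_all
    have "a1 - family_coeff \<alpha> 1 e1 e3 * a2 * a3 \<in> {0}"
      "a2 - family_coeff \<beta> 1 e2 e1 * a3 * a1 \<in> {0}"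
      "a3 - family_coeff (- \<gamma>) (- 1) e3 e2 * a1 * a2 \<in> {0}"
      using family_step[OF UNIV_I UNIV_I UNIV_I UNIV_I UNIV_I UNIV_I f(1,2) two e in0]
        family_step[OF UNIV_I UNIV_I UNIV_I UNIV_I UNIV_I UNIV_I f(3,4) two e'(1) in0(2,3,1)]
        family_step[OF UNIV_I UNIV_I UNIV_I UNIV_I UNIV_I UNIV_I f(5,6) two e'(2) in0(3,1,2)] .
    then have "on_family \<alpha> \<beta> \<gamma> e1 e2 e3 a1 a2 a3"
      unfolding on_family_def singleton_iff right_minus_eq using e an by blast
    then show thesis using family n b unfolding ab by blast
  qed
  define S1 T1 S2 T2 S3 T3 where ST: "S1 = y 2 * z 3 + y 3 * z 2" "T1 = y 2 * z 3 - y 3 * z 2"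
    "S2 = y 3 * z 1 + y 1 * z 3" "T2 = y 3 * z 1 - y 1 * z 3"
    "S3 = y 1 * z 2 + y 2 * z 1" "T3 = y 1 * z 2 - y 2 * z 1"
  have "S1 * T1 = 0 \<and> S2 * T2 = 0 \<and> S3 * T3 = 0"
    using products_in_J[OF UNIV_I UNIV_I UNIV_I UNIV_I UNIV_I UNIV_I UNIV_I UNIV_I _ _ _ _ _ _ two par nz,
        of "y 0" "z 1" "y 1" "z 0" "y 2" "z 3" "y 3" "z 2"] pair
    unfolding twist_pair_def ST singleton_iff by blast
  then have st: "S1\<^sup>2 = 0 \<or> T1\<^sup>2 = 0" "S2\<^sup>2 = 0 \<or> T2\<^sup>2 = 0" "S3\<^sup>2 = 0 \<or> T3\<^sup>2 = 0" by auto
  have AB: "2 * (y 0 * z 1) = S1 + \<alpha> * T1" "2 * (y 1 * z 0) = S1 - \<alpha> * T1"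
    "2 * (y 0 * z 2) = S2 + \<beta> * T2" "2 * (y 2 * z 0) = S2 - \<beta> * T2"
    "2 * (y 0 * z 3) = - S3 - \<gamma> * T3" "2 * (y 3 * z 0) = - S3 + \<gamma> * T3"
  proof -
    have p: "y 0 * z 1 - y 1 * z 0 = \<alpha> * T1" "y 0 * z 1 + y 1 * z 0 = S1"
      "y 0 * z 2 - y 2 * z 0 = \<beta> * T2" "y 0 * z 2 + y 2 * z 0 = S2"
      "y 0 * z 3 - y 3 * z 0 = - \<gamma> * T3" "y 0 * z 3 + y 3 * z 0 = - S3"
      using pair unfolding twist_pair_def ST
      by (simp_all only: eq_neg_iff_add_eq_0 right_minus_eq mult_minus_left)
    show "2 * (y 0 * z 1) = S1 + \<alpha> * T1" "2 * (y 1 * z 0) = S1 - \<alpha> * T1"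
      unfolding p(1,2)[symmetric] by simp_all
    show "2 * (y 0 * z 2) = S2 + \<beta> * T2" "2 * (y 2 * z 0) = S2 - \<beta> * T2"
      unfolding p(3,4)[symmetric] by simp_all
    have "2 * (y 0 * z 3) = (y 0 * z 3 + y 3 * z 0) + (y 0 * z 3 - y 3 * z 0)"
      "2 * (y 3 * z 0) = (y 0 * z 3 + y 3 * z 0) - (y 0 * z 3 - y 3 * z 0)" by simp_all
    then show "2 * (y 0 * z 3) = - S3 - \<gamma> * T3" "2 * (y 3 * z 0) = - S3 + \<gamma> * T3"
      unfolding p by simp_all
  qed
  have CD: "2 * (y 2 * z 3) = S1 + T1" "2 * (y 3 * z 2) = S1 - T1"
    "2 * (y 3 * z 1) = S2 + T2" "2 * (y 1 * z 3) = S2 - T2"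
    "2 * (y 1 * z 2) = S3 + T3" "2 * (y 2 * z 1) = S3 - T3"
    by (simp_all add: ST)
  \<comment> \<open>The quartic identities are now added instead of subtracted: A_1 C_1 = A_3 D_3
    and B_1 D_1 = B_3 C_3. The mixed terms cancel and the squares remain.\<close>
  have eq1: "S1\<^sup>2 + \<alpha> * T1\<^sup>2 = - S3\<^sup>2 + \<gamma> * T3\<^sup>2"
  proof -
    have eqs: "(S1 + \<alpha> * T1) * (S1 + T1) = (- S3 - \<gamma> * T3) * (S3 - T3)"
      "(S1 - \<alpha> * T1) * (S1 - T1) = (- S3 + \<gamma> * T3) * (S3 + T3)"
      unfolding AB[symmetric] CD[symmetric] by (simp_all only: mult_ac)
    have "2 * (S1\<^sup>2 + \<alpha> * T1\<^sup>2) = (S1 + \<alpha> * T1) * (S1 + T1) + (S1 - \<alpha> * T1) * (S1 - T1)"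
      by (simp add: power2_eq_square algebra_simps)
    also have "\<dots> = (- S3 - \<gamma> * T3) * (S3 - T3) + (- S3 + \<gamma> * T3) * (S3 + T3)"
      unfolding eqs ..
    also have "\<dots> = 2 * (- S3\<^sup>2 + \<gamma> * T3\<^sup>2)"
      by (simp add: power2_eq_square algebra_simps)
    finally have "2 * (S1\<^sup>2 + \<alpha> * T1\<^sup>2) = 2 * (- S3\<^sup>2 + \<gamma> * T3\<^sup>2)" .
    then show ?thesis using two by (simp only: mult_cancel_left simp_thms)
  qed
  have eq2: "S1\<^sup>2 - \<alpha> * T1\<^sup>2 = S2\<^sup>2 + \<beta> * T2\<^sup>2"
  proof -
    have eqs: "(S1 + \<alpha> * T1) * (S1 - T1) = (S2 + \<beta> * T2) * (S2 + T2)"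
      "(S1 - \<alpha> * T1) * (S1 + T1) = (S2 - \<beta> * T2) * (S2 - T2)"
      unfolding AB[symmetric] CD[symmetric] by (simp_all only: mult_ac)
    have "2 * (S1\<^sup>2 - \<alpha> * T1\<^sup>2) = (S1 + \<alpha> * T1) * (S1 - T1) + (S1 - \<alpha> * T1) * (S1 + T1)"
      by (simp add: power2_eq_square algebra_simps)
    also have "\<dots> = (S2 + \<beta> * T2) * (S2 + T2) + (S2 - \<beta> * T2) * (S2 - T2)"
      unfolding eqs ..
    also have "\<dots> = 2 * (S2\<^sup>2 + \<beta> * T2\<^sup>2)"
      by (simp add: power2_eq_square algebra_simps)
    finally have "2 * (S1\<^sup>2 - \<alpha> * T1\<^sup>2) = 2 * (S2\<^sup>2 + \<beta> * T2\<^sup>2)" .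
    then show ?thesis using two by (simp only: mult_cancel_left simp_thms)
  qed
  have eq3: "S2\<^sup>2 - \<beta> * T2\<^sup>2 = - S3\<^sup>2 - \<gamma> * T3\<^sup>2"
  proof -
    have eqs: "(S2 + \<beta> * T2) * (S2 - T2) = (- S3 - \<gamma> * T3) * (S3 + T3)"
      "(S2 - \<beta> * T2) * (S2 + T2) = (- S3 + \<gamma> * T3) * (S3 - T3)"
      unfolding AB[symmetric] CD[symmetric] by (simp_all only: mult_ac)
    have "2 * (S2\<^sup>2 - \<beta> * T2\<^sup>2) = (S2 + \<beta> * T2) * (S2 - T2) + (S2 - \<beta> * T2) * (S2 + T2)"
      by (simp add: power2_eq_square algebra_simps)
    also have "\<dots> = (- S3 - \<gamma> * T3) * (S3 + T3) + (- S3 + \<gamma> * T3) * (S3 - T3)"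
      unfolding eqs ..
    also have "\<dots> = 2 * (- S3\<^sup>2 - \<gamma> * T3\<^sup>2)"
      by (simp add: power2_eq_square algebra_simps)
    finally have "2 * (S2\<^sup>2 - \<beta> * T2\<^sup>2) = 2 * (- S3\<^sup>2 - \<gamma> * T3\<^sup>2)" .
    then show ?thesis using two by (simp only: mult_cancel_left simp_thms)
  qed
  have n0: "\<alpha> \<noteq> 0" "\<beta> \<noteq> 0" "\<gamma> \<noteq> 0" using nz by auto
  \<comment> \<open>If T_i = 0, then 2 y_0 z_i and 2 y_i z_0 are equal, so e_i = 1; if S_i = 0 they
    are opposite, so e_i = -1. A nonzero common value also makes y_0, z_0 and y_i nonzero.\<close>
  have plus: "y 0 \<noteq> 0 \<and> z 0 \<noteq> 0 \<and> yi \<noteq> 0 \<and> y 0 * zi = 1 * yi * z 0"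
    if "2 * (y 0 * zi) = s" "2 * (yi * z 0) = s" "s \<noteq> 0" for yi zi s
    using that two by auto
  have minus: "y 0 \<noteq> 0 \<and> z 0 \<noteq> 0 \<and> yi \<noteq> 0 \<and> y 0 * zi = - 1 * yi * z 0"
    if "2 * (y 0 * zi) = s" "2 * (yi * z 0) = - s" "s \<noteq> 0" for yi zi s
  proof -
    have "2 * (y 0 * zi + yi * z 0) = 0" using that by (simp add: distrib_left)
    then have "y 0 * zi = - (yi * z 0)"
      using two by (simp only: mult_eq_0_iff simp_thms eq_neg_iff_add_eq_0)
    then show ?thesis using that by auto
  qed
  show thesis
    using two n0 eq1 eq2 eq3 st
  proof (cases rule: square_cases)
    case 1
    \<comment> \<open>When all S and T vanish, every product of entries with different indices is
      zero, which confines both vectors to one common index.\<close>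
    then have "y 0 * z 1 = 0" "y 1 * z 0 = 0" "y 0 * z 2 = 0" "y 2 * z 0 = 0" "y 0 * z 3 = 0"
      "y 3 * z 0 = 0" "y 2 * z 3 = 0" "y 3 * z 2 = 0" "y 3 * z 1 = 0" "y 1 * z 3 = 0"
      "y 1 * z 2 = 0" "y 2 * z 1 = 0"
      using AB CD two by simp_all
    then have "\<forall>i\<in>UNIV. \<forall>j\<in>UNIV. i \<noteq> j \<longrightarrow> y i * z j = 0"
      unfolding univ4 ball_simps by (simp del: mult_eq_0_iff)
    then have off: "y i * z j = 0" if "i \<noteq> j" for i j using that by blast
    obtain i where "y i \<noteq> 0" using yz(1) by auto
    then have z: "z j = 0" if "j \<noteq> i" for j using off[of i j] that by auto
    then have "z i \<noteq> 0" using yz(2) by (metis ext)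
    then have "y j = 0" if "j \<noteq> i" for j using off[of j i] that by auto
    then show thesis using coordinate z by blast
  next
    case 2
    then show thesis
      using family_intro[of 1 1 1] plus[OF AB(1)] plus[OF AB(3)] plus[OF AB(5)] AB
      by (simp add: sign_triple_def)
  next
    case 3
    then show thesis
      using family_intro[of 1 "- 1" "- 1"] plus[OF AB(1)] minus[OF AB(3)] minus[OF AB(5)] AB n0
      by (simp add: sign_triple_def)
  next
    case 4
    then show thesis
      using family_intro[of "- 1" 1 "- 1"] minus[OF AB(1)] plus[OF AB(3)] minus[OF AB(5)] AB n0
      by (simp add: sign_triple_def)
  next
    case 5
    then show thesis
      using family_intro[of "- 1" "- 1" 1] minus[OF AB(1)] minus[OF AB(3)] plus[OF AB(5)] AB n0
      by (simp add: sign_triple_def)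
  qed
qed

section \<open>Multihomogeneous polynomials\<close>

text \<open>Used at numbers for evaluation, at the variables themselves for expanding polynomials,
  and at affine coordinates in the fraction field.\<close>

definition exponent_monomial ::
  "(nat \<Rightarrow> 4 \<Rightarrow> 'a) \<Rightarrow> (nat \<Rightarrow>\<^sub>0 (4 \<Rightarrow>\<^sub>0 nat)) \<Rightarrow> 'a::comm_monoid_mult" where
  "exponent_monomial u e =
    (\<Prod>j\<in>Poly_Mapping.keys e. \<Prod>i\<in>UNIV. u j i ^ Poly_Mapping.lookup (Poly_Mapping.lookup e j) i)"

lemma exponent_monomial_superset:
  assumes "finite A" "Poly_Mapping.keys e \<subseteq> A"
  shows "exponent_monomial u e =
    (\<Prod>j\<in>A. \<Prod>i\<in>UNIV. u j i ^ Poly_Mapping.lookup (Poly_Mapping.lookup e j) i)"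
  unfolding exponent_monomial_def
  by (rule prod.mono_neutral_left) (use assms in \<open>auto simp: in_keys_iff\<close>)

lemma exponent_monomial_add:
  "exponent_monomial u (e + e') = exponent_monomial u e * exponent_monomial u e'"
proof -
  let ?A = "Poly_Mapping.keys e \<union> Poly_Mapping.keys e'"
  have "Poly_Mapping.keys (e + e') \<subseteq> ?A" by (rule Poly_Mapping.keys_add)
  then show ?thesis
    by (simp add: exponent_monomial_superset[of ?A] lookup_add power_add prod.distrib)
qed

lemma meval_eq_lin_ext: "meval y P = lin_ext (exponent_monomial y) P"
  by (simp add: meval_def lin_ext_def exponent_monomial_def)

lemma meval_add: "meval y (P + Q) = meval y P + meval y Q"
  and meval_mult: "meval y (P * Q) = meval y P * meval y Q"
  and meval_zero: "meval y 0 = 0"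
  by (simp_all add: meval_eq_lin_ext lin_ext_add lin_ext_mult exponent_monomial_add)

lemma meval_mconst: "meval y (mconst c) = c"
  by (simp add: meval_eq_lin_ext mconst_def exponent_monomial_def)

lemma meval_mvar: "meval y (mvar j i) = y j i"
proof -
  have "(\<Prod>l\<in>UNIV. y j l ^ Poly_Mapping.lookup (Poly_Mapping.single i 1) l) =
      (\<Prod>l\<in>{i}. y j l ^ Poly_Mapping.lookup (Poly_Mapping.single i 1) l)"
    by (rule prod.mono_neutral_right) (auto simp: lookup_single when_def)
  moreover have "Poly_Mapping.single i (1::nat) \<noteq> 0"
    by (metis lookup_single_eq lookup_zero zero_neq_one)
  ultimately show ?thesis
    by (simp add: meval_eq_lin_ext mvar_def exponent_monomial_def)
qed

lemma mconst_one: "mconst 1 = 1"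
  by (simp add: mconst_def)

lemma meval_one: "meval y 1 = 1"
  using meval_mconst[of y 1] by (simp add: mconst_one)

lemma mconst_hom: "mconst (c + d) = mconst c + mconst d" "mconst (c * d) = mconst c * mconst d"
  "mconst 0 = 0"
  by (simp_all add: mconst_def single_add mult_single)

lemma meval_sum: "meval y (sum f A) = (\<Sum>x\<in>A. meval y (f x))"
  by (induction A rule: infinite_finite_induct) (simp_all add: meval_zero meval_add)

lemma meval_prod: "meval y (prod f A) = (\<Prod>x\<in>A. meval y (f x))"
  by (induction A rule: infinite_finite_induct) (simp_all add: meval_one meval_mult)

lemma multihomogeneous_zero: "0 \<in> multihomogeneous m"
  by (simp add: multihomogeneous_def)

lemma multihomogeneous_add:
  "P \<in> multihomogeneous m \<Longrightarrow> Q \<in> multihomogeneous m \<Longrightarrow> P + Q \<in> multihomogeneous m"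
  unfolding multihomogeneous_def by (auto dest!: subsetD[OF Poly_Mapping.keys_add])

lemma multihomogeneous_sum:
  "(\<And>x. x \<in> A \<Longrightarrow> f x \<in> multihomogeneous m) \<Longrightarrow> sum f A \<in> multihomogeneous m"
  by (induction A rule: infinite_finite_induct)
    (auto simp: multihomogeneous_zero intro: multihomogeneous_add)

lemma multihomogeneous_mult:
  assumes "P \<in> multihomogeneous m" "Q \<in> multihomogeneous n"
  shows "P * Q \<in> multihomogeneous (\<lambda>j. m j + n j)"
  unfolding multihomogeneous_def
proof (rule CollectI, rule ballI, rule allI)
  fix e j assume "e \<in> Poly_Mapping.keys (P * Q)"
  then obtain d d' where "e = d + d'" "d \<in> Poly_Mapping.keys P" "d' \<in> Poly_Mapping.keys Q"
    using Poly_Mapping.keys_mult[of P Q] by auto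
  then show "(\<Sum>i\<in>UNIV. Poly_Mapping.lookup (Poly_Mapping.lookup e j) i) = m j + n j"
    using assms by (simp add: multihomogeneous_def lookup_add sum.distrib)
qed

lemma multihomogeneous_mconst: "mconst c \<in> multihomogeneous (\<lambda>j. 0)"
  by (auto simp: multihomogeneous_def mconst_def in_keys_iff lookup_single when_def split: if_splits)

lemma multihomogeneous_one: "1 \<in> multihomogeneous (\<lambda>j. 0)"
  using multihomogeneous_mconst[of 1] by (simp add: mconst_one)

lemma multihomogeneous_mvar: "mvar j i \<in> multihomogeneous (\<lambda>l. if l = j then 1 else 0)"
proof -
  have "(\<Sum>l\<in>UNIV. Poly_Mapping.lookup (Poly_Mapping.single i (1::nat)) l) =
      (\<Sum>l\<in>{i}. Poly_Mapping.lookup (Poly_Mapping.single i 1) l)"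
    by (rule sum.mono_neutral_right) (auto simp: lookup_single when_def)
  then show ?thesis
    by (auto simp: multihomogeneous_def mvar_def in_keys_iff lookup_single when_def split: if_splits)
qed

lemma multihomogeneous_prod:
  "(\<And>x. x \<in> A \<Longrightarrow> f x \<in> multihomogeneous (m x)) \<Longrightarrow>
    prod f A \<in> multihomogeneous (\<lambda>j. \<Sum>x\<in>A. m x j)"
  by (induction A rule: infinite_finite_induct)
    (auto simp: multihomogeneous_one intro: multihomogeneous_mult)

lemma multihomogeneous_power:
  "P \<in> multihomogeneous m \<Longrightarrow> P ^ n \<in> multihomogeneous (\<lambda>j. n * m j)"
  by (induction n) (auto simp: multihomogeneous_one intro: multihomogeneous_mult)

lemma multihomogeneous_word:
  "(\<Prod>j<d. mvar j (w j)) \<in> multihomogeneous (\<lambda>l. if l < d then 1 else 0)"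
  using multihomogeneous_prod[of "{..<d}" "\<lambda>j. mvar j (w j)" "\<lambda>j l. if l = j then 1 else 0"]
  by (simp add: multihomogeneous_mvar)

text \<open>A multidegree is an arbitrary function on the naturals; a nonzero polynomial of that
  degree forces its support to be finite.\<close>

lemma keys_multihomogeneous:
  assumes "P \<in> multihomogeneous m" "e \<in> Poly_Mapping.keys P"
  shows "Poly_Mapping.keys e = {j. m j \<noteq> 0}"
proof -
  have "j \<in> Poly_Mapping.keys e \<longleftrightarrow> m j \<noteq> 0" for j
  proof -
    have "m j = (\<Sum>i\<in>UNIV. Poly_Mapping.lookup (Poly_Mapping.lookup e j) i)"
      using assms by (simp add: multihomogeneous_def)
    then show ?thesis by (auto simp: in_keys_iff poly_mapping_eq_iff fun_eq_iff)
  qed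
  then show ?thesis by blast
qed

lemma meval_scale:
  assumes "P \<in> multihomogeneous m"
  shows "meval (\<lambda>j i. s j * y j i) P = (\<Prod>j\<in>{j. m j \<noteq> 0}. s j ^ m j) * meval y P"
proof -
  have "exponent_monomial (\<lambda>j i. s j * y j i) e =
      (\<Prod>j\<in>{j. m j \<noteq> 0}. s j ^ m j) * exponent_monomial y e" if e: "e \<in> Poly_Mapping.keys P" for e
  proof -
    have m: "m j = (\<Sum>i\<in>UNIV. Poly_Mapping.lookup (Poly_Mapping.lookup e j) i)" for j
      using assms e by (simp add: multihomogeneous_def)
    show ?thesis
      unfolding exponent_monomial_def keys_multihomogeneous[OF assms e] prod.distrib[symmetric]
      by (simp add: power_mult_distrib prod.distrib power_sum m)
  qed
  then have "lin_ext (exponent_monomial (\<lambda>j i. s j * y j i)) P =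
      lin_ext (\<lambda>e. (\<Prod>j\<in>{j. m j \<noteq> 0}. s j ^ m j) * exponent_monomial y e) P"
    by (rule lin_ext_cong)
  then show ?thesis by (simp add: meval_eq_lin_ext lin_ext_scale)
qed

text \<open>A change of representatives multiplies the value by a product of nonzero powers, so a
  single representative decides.\<close>

lemma nonvanishing_at_iff:
  fixes y :: "nat \<Rightarrow> 4 \<Rightarrow> 'k::field"
  assumes "b \<in> multihomogeneous m"
  shows "b \<in> nonvanishing_at (\<lambda>j. proj (y j)) \<longleftrightarrow> meval y b \<noteq> 0"
proof
  have "y j \<in> proj (y j)" for j by (auto simp: proj_def intro!: exI[of _ 1])
  then show "b \<in> nonvanishing_at (\<lambda>j. proj (y j)) \<Longrightarrow> meval y b \<noteq> 0"
    by (simp add: nonvanishing_at_def)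
next
  assume ne: "meval y b \<noteq> 0"
  have "meval y' b \<noteq> 0" if y': "\<forall>j. y' j \<in> proj (y j)" for y'
  proof -
    have "\<forall>j. \<exists>s. s \<noteq> 0 \<and> y' j = (\<lambda>i. s * y j i)" using y' by (auto simp: proj_def)
    then obtain s where s: "\<And>j. s j \<noteq> 0" "\<And>j. y' j = (\<lambda>i. s j * y j i)" by metis
    then have "y' = (\<lambda>j i. s j * y j i)" by auto
    \<comment> \<open>A product over an infinite set is 1 by convention, hence nonzero in either
      case.\<close>
    moreover have "(\<Prod>j\<in>{j. m j \<noteq> 0}. s j ^ m j) \<noteq> 0"
      by (cases "finite {j. m j \<noteq> 0}") (simp_all add: s(1))
    ultimately show ?thesis using meval_scale[OF assms, of s y] ne by simp
  qed
  then show "b \<in> nonvanishing_at (\<lambda>j. proj (y j))" by (simp add: nonvanishing_at_def)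
qed

section \<open>Multilinearisations as multihomogeneous polynomials\<close>

lemma multilinearisation_superset:
  assumes "finite A" "Poly_Mapping.keys f \<subseteq> A"
  shows "multilinearisation f =
    (\<Sum>w\<in>A. mconst (Poly_Mapping.lookup f w) * (\<Prod>j<length w. mvar j (w ! j)))"
  unfolding multilinearisation_def
  by (rule sum.mono_neutral_left) (use assms in \<open>auto simp: in_keys_iff mconst_hom\<close>)

lemma multilinearisation_add:
  "multilinearisation (f + g) = multilinearisation f + multilinearisation g"
proof -
  let ?A = "Poly_Mapping.keys f \<union> Poly_Mapping.keys g"
  have "Poly_Mapping.keys (f + g) \<subseteq> ?A" by (rule Poly_Mapping.keys_add)
  then show ?thesis
    by (simp add: multilinearisation_superset[of ?A] lookup_add mconst_hom distrib_right sum.distrib)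
qed

lemma multilinearisation_single:
  "multilinearisation (Poly_Mapping.single w c) = mconst c * (\<Prod>j<length w. mvar j (w ! j))"
  by (simp add: multilinearisation_def mconst_hom)

lemma meval_multilinearisation:
  "meval y (multilinearisation f) = lin_ext (word_monomial y) f"
  by (simp add: multilinearisation_def meval_sum meval_mult meval_mconst meval_prod meval_mvar
      lin_ext_def word_monomial_prod)

lemma multihomogeneous_multilinearisation:
  assumes "f \<in> free_homogeneous d"
  shows "multilinearisation f \<in> multihomogeneous (\<lambda>j. if j < d then 1 else 0)"
  unfolding multilinearisation_def
proof (rule multihomogeneous_sum)
  fix w assume "w \<in> Poly_Mapping.keys f"
  then have "length w = d" using assms by (simp add: free_homogeneous_def)
  then show "mconst (Poly_Mapping.lookup f w) * (\<Prod>j<length w. mvar j (w ! j))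
      \<in> multihomogeneous (\<lambda>j. if j < d then 1 else 0)"
    using multihomogeneous_mult[OF multihomogeneous_mconst multihomogeneous_word[where d = d and w = "\<lambda>j. w ! j"]]
    by simp
qed

lemma prod_single:
  "(\<Prod>x\<in>A. Poly_Mapping.single (h x) 1) = Poly_Mapping.single (\<Sum>x\<in>A. h x) (1::'k::comm_ring_1)"
  for h :: "'x \<Rightarrow> 'b::comm_monoid_add"
  by (induction A rule: infinite_finite_induct) (simp_all add: mult_single)

lemma mvar_power:
  "mvar j i ^ n = Poly_Mapping.single (Poly_Mapping.single j (Poly_Mapping.single i n)) 1"
  by (induction n) (simp_all add: mvar_def mult_single flip: single_add)

text \<open>Together with \<open>Fract_monomial\<close> this expands a dehomogenised polynomial in
  the affine coordinates.\<close>

lemma single_eq_monomial: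
  "Poly_Mapping.single e c = mconst (c::'k::comm_ring_1) * exponent_monomial mvar e"
proof -
  have "(\<Sum>j\<in>Poly_Mapping.keys e. \<Sum>i\<in>UNIV. Poly_Mapping.single j
      (Poly_Mapping.single i (Poly_Mapping.lookup (Poly_Mapping.lookup e j) i))) = e"
  proof (intro poly_mapping_eqI)
    fix l k
    have "(\<Sum>i\<in>UNIV. Poly_Mapping.lookup (Poly_Mapping.lookup (Poly_Mapping.single j
        (Poly_Mapping.single i (Poly_Mapping.lookup (Poly_Mapping.lookup e j) i))) l) k) =
        (if j = l then Poly_Mapping.lookup (Poly_Mapping.lookup e j) k else 0)" for j
      by (simp add: lookup_single when_def)
    then show "Poly_Mapping.lookup (Poly_Mapping.lookup (\<Sum>j\<in>Poly_Mapping.keys e. \<Sum>i\<in>UNIV.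
        Poly_Mapping.single j (Poly_Mapping.single i
          (Poly_Mapping.lookup (Poly_Mapping.lookup e j) i))) l) k =
        Poly_Mapping.lookup (Poly_Mapping.lookup e l) k"
      by (simp add: lookup_sum in_keys_iff)
  qed
  then have "exponent_monomial mvar e = Poly_Mapping.single e (1::'k)"
    by (simp add: exponent_monomial_def mvar_power prod_single)
  then show ?thesis by (simp add: mconst_def mult_single)
qed

section \<open>Products and sums of fractions\<close>

lemma Fract_mult_distrib: "Fract (a * c) (b * d) = Fract a b * Fract c d"
  by simp

lemma Fract_prod: "Fract (prod f A) (prod g A) = (\<Prod>x\<in>A. Fract (f x) (g x))"
  by (induction A rule: infinite_finite_induct) (simp_all add: One_fract_def Fract_mult_distrib del: mult_fract)

lemma Fract_power: "Fract (a ^ n) (b ^ n) = Fract a b ^ n"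
  by (induction n) (simp_all add: One_fract_def Fract_mult_distrib del: mult_fract)

lemma Fract_add_same: "b \<noteq> 0 \<Longrightarrow> Fract (a + c) b = Fract a b + Fract c b"
  by (simp add: eq_fract algebra_simps)

lemma Fract_sum_same: "b \<noteq> 0 \<Longrightarrow> Fract (sum f A) b = (\<Sum>x\<in>A. Fract (f x) b)"
  by (induction A rule: infinite_finite_induct) (simp_all add: Fract_add_same Zero_fract_def eq_fract)

section \<open>The local rings of the point scheme\<close>

context local_ideal
begin

text \<open>Elements of \<open>R\<close> congruent to constants modulo \<open>J\<close> are closed
  under the ring operations, so a polynomial in them is congruent to its value.\<close>

lemma cong_mult:
  assumes "x \<in> R" "y \<in> R" "x - K c \<in> J" "y - K d \<in> J"
  shows "x * y - K (c * d) \<in> J"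
proof -
  have "x * y - K (c * d) = y * (x - K c) + K c * (y - K d)"
    by (simp add: K_mult algebra_simps)
  also have "\<dots> \<in> J" by (rule J_add[OF J_left[OF assms(2,3)] J_left[OF R_K assms(4)]])
  finally show ?thesis .
qed

lemma R_prod: "(\<And>x. x \<in> A \<Longrightarrow> f x \<in> R) \<Longrightarrow> prod f A \<in> R"
  by (induction A rule: infinite_finite_induct) (auto intro: R_1 R_mult)

lemma R_power: "x \<in> R \<Longrightarrow> x ^ n \<in> R"
  by (induction n) (auto intro: R_1 R_mult)

lemma cong_prod:
  assumes "\<And>x. x \<in> A \<Longrightarrow> f x \<in> R" "\<And>x. x \<in> A \<Longrightarrow> f x - K (g x) \<in> J"
  shows "prod f A - K (prod g A) \<in> J"
  using assms
  by (induction A rule: infinite_finite_induct)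
    (auto simp: K_1 J_0 intro!: cong_mult R_prod)

lemma cong_power: "x \<in> R \<Longrightarrow> x - K c \<in> J \<Longrightarrow> x ^ n - K (c ^ n) \<in> J"
  by (induction n) (auto simp: K_1 J_0 intro!: cong_mult R_power)

lemma cong_sum:
  assumes "\<And>x. x \<in> A \<Longrightarrow> f x - K (g x) \<in> J"
  shows "sum f A - K (sum g A) \<in> J"
  using assms
proof (induction A rule: infinite_finite_induct)
  case (insert x F)
  have "sum f (insert x F) - K (sum g (insert x F)) = (f x - K (g x)) + (sum f F - K (sum g F))"
    using insert(1,2) by (simp add: K_add)
  also have "\<dots> \<in> J" by (rule J_add) (use insert in auto)
  finally show ?case .
qed (simp_all add: K_0 J_0)

end

section \<open>The ambient local ring at a sequence of points, in fixed affine charts\<close>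

locale projective_sequence =
  fixes y :: "nat \<Rightarrow> 4 \<Rightarrow> 'k::field" and r :: "nat \<Rightarrow> 4"
  assumes chart: "y j (r j) = 1"
begin

definition "P = (\<lambda>j. proj (y j))"
definition "L = ambient_local_ring P"
definition "R = carrier L"
definition "K c = Fract (mconst c) (1 :: 'k mpoly)"
text \<open>Value of a fraction at the point, read off from some presentation with nonvanishing
  denominator; \<open>val_Fract\<close> shows independence of the presentation.\<close>

definition "val x = (SOME v. \<exists>a b. meval y b \<noteq> 0 \<and> x = Fract a b \<and> v = meval y a / meval y b)"
text \<open>Affine coordinate \<open>i\<close> of factor \<open>j\<close> in the chart with
  denominator \<open>r j\<close>.\<close>

definition "u j i = Fract (mvar j i) (mvar j (r j) :: 'k mpoly)"

lemma meval_nonzero: "meval y b \<noteq> 0 \<Longrightarrow> b \<noteq> 0"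
  by (auto simp: meval_zero)

lemma R_iff: "x \<in> R \<longleftrightarrow> (\<exists>a b m. x = Fract a b \<and> a \<in> multihomogeneous m \<and>
    b \<in> multihomogeneous m \<and> meval y b \<noteq> 0)"
proof -
  have *: "(a \<in> multihomogeneous m \<and> b \<in> multihomogeneous m \<and> b \<in> nonvanishing_at P) =
      (a \<in> multihomogeneous m \<and> b \<in> multihomogeneous m \<and> meval y b \<noteq> 0)" for a b m
    unfolding P_def using nonvanishing_at_iff by blast
  show ?thesis unfolding R_def L_def ambient_local_ring_def * by simp
qed

lemma R_I: "a \<in> multihomogeneous m \<Longrightarrow> b \<in> multihomogeneous m \<Longrightarrow> meval y b \<noteq> 0 \<Longrightarrow> Fract a b \<in> R"
  unfolding R_iff by blast

lemma val_Fract: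
  assumes "meval y b \<noteq> 0"
  shows "val (Fract a b) = meval y a / meval y b"
  unfolding val_def
proof (rule some_equality)
  show "\<exists>a' b'. meval y b' \<noteq> 0 \<and> Fract a b = Fract a' b' \<and> meval y a / meval y b = meval y a' / meval y b'"
    using assms by blast
next
  fix v assume "\<exists>a' b'. meval y b' \<noteq> 0 \<and> Fract a b = Fract a' b' \<and> v = meval y a' / meval y b'"
  then obtain a' b' where *: "meval y b' \<noteq> 0" "Fract a b = Fract a' b'" "v = meval y a' / meval y b'"
    by blast
  then have "a * b' = a' * b" using meval_nonzero assms by (simp add: eq_fract)
  then have "meval y a * meval y b' = meval y a' * meval y b" by (simp flip: meval_mult)
  also have "meval y a' = v * meval y b'" using * by simp
  finally show "v = meval y a / meval y b" using *(1) assms by (simp add: field_simps)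
qed

lemma L_simps [simp]:
  "carrier L = R" "x \<otimes>\<^bsub>L\<^esub> x' = x * x'" "\<one>\<^bsub>L\<^esub> = 1" "\<zero>\<^bsub>L\<^esub> = 0" "x \<oplus>\<^bsub>L\<^esub> x' = x + x'"
  by (simp_all add: R_def) (simp_all add: L_def ambient_local_ring_def type_ring_def)

lemma R_closed:
  assumes "x \<in> R" "x' \<in> R"
  shows "x + x' \<in> R" "x * x' \<in> R" "val (x + x') = val x + val x'" "val (x * x') = val x * val x'"
proof -
  obtain a b m where x: "x = Fract a b" "a \<in> multihomogeneous m" "b \<in> multihomogeneous m" "meval y b \<noteq> 0"
    using assms(1) unfolding R_iff by blast
  obtain a' b' m' where x': "x' = Fract a' b'" "a' \<in> multihomogeneous m'" "b' \<in> multihomogeneous m'"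
    "meval y b' \<noteq> 0"
    using assms(2) unfolding R_iff by blast
  have bb: "meval y (b * b') \<noteq> 0" using x x' by (simp add: meval_mult)
  have add: "x + x' = Fract (a * b' + a' * b) (b * b')"
    using x x' meval_nonzero by simp
  have mult: "x * x' = Fract (a * a') (b * b')" using x x' by simp
  have "a' * b \<in> multihomogeneous (\<lambda>j. m j + m' j)"
    using multihomogeneous_mult[OF x'(2) x(3)] by (simp add: add.commute)
  then show "x + x' \<in> R" unfolding add
    by (rule R_I[OF multihomogeneous_add[OF multihomogeneous_mult[OF x(2) x'(3)]]
          multihomogeneous_mult[OF x(3) x'(3)] bb])
  show "x * x' \<in> R" unfolding mult
    by (rule R_I[OF multihomogeneous_mult[OF x(2) x'(2)] multihomogeneous_mult[OF x(3) x'(3)] bb])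
  show "val (x + x') = val x + val x'" unfolding add val_Fract[OF bb] using x x'
    by (simp add: val_Fract meval_add meval_mult field_simps)
  show "val (x * x') = val x * val x'" unfolding mult val_Fract[OF bb] using x x'
    by (simp add: val_Fract meval_mult)
qed

lemma R_K: "K c \<in> R" and val_K: "val (K c) = c"
  unfolding K_def by (auto simp: val_Fract meval_one meval_mconst
      intro: R_I multihomogeneous_mconst multihomogeneous_one)

lemma K_hom: "K (c + d) = K c + K d" "K (c * d) = K c * K d" "K 1 = 1" "K 0 = 0"
  by (simp_all add: K_def mconst_hom mconst_one One_fract_def Zero_fract_def)

lemma R_inverse:
  assumes "x \<in> R" "val x \<noteq> 0"
  shows "inverse x \<in> R"
proof -
  obtain a b m where x: "x = Fract a b" "a \<in> multihomogeneous m" "b \<in> multihomogeneous m" "meval y b \<noteq> 0"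
    using assms(1) unfolding R_iff by blast
  then have "meval y a \<noteq> 0" using assms(2) by (auto simp: val_Fract)
  then show ?thesis using x by (auto intro: R_I)
qed

lemma R_uminus: "x \<in> R \<Longrightarrow> - x \<in> R"
  using R_closed(2)[OF R_K[of "- 1"], of x] K_hom(1)[of 1 "- 1"]
  by (simp add: K_hom(3,4) add_eq_0_iff)

lemma ring_L: "ring L"
proof (intro ringI abelian_groupI monoidI)
  fix x assume "x \<in> carrier L"
  then show "\<exists>x'\<in>carrier L. x' \<oplus>\<^bsub>L\<^esub> x = \<zero>\<^bsub>L\<^esub>"
    by (intro bexI[of _ "- x"]) (simp_all add: R_uminus)
qed (use R_closed R_K[of 0] R_K[of 1] in \<open>auto simp: K_hom algebra_simps\<close>)

lemma local_ideal_if_ideal: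
  assumes "ideal J L"
  shows "local_ideal R J K val"
proof -
  interpret ideal J L by (rule assms)
  show ?thesis
    using R_closed R_K R_inverse K_hom val_K Icarr I_l_closed
      additive_subgroup.zero_closed[OF is_additive_subgroup]
      additive_subgroup.a_closed[OF is_additive_subgroup]
    by unfold_locales auto
qed

lemma R_u: "u j i \<in> R" and val_u: "val (u j i) = y j i" and u_chart: "u j (r j) = 1"
proof -
  have ne: "meval y (mvar j (r j)) \<noteq> 0" by (simp add: meval_mvar chart)
  show "u j i \<in> R" unfolding u_def by (rule R_I[OF multihomogeneous_mvar multihomogeneous_mvar ne])
  show "val (u j i) = y j i" unfolding u_def val_Fract[OF ne] by (simp add: meval_mvar chart)
  show "u j (r j) = 1" using meval_nonzero[OF ne] by (simp add: u_def One_fract_def eq_fract)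
qed

text \<open>Dehomogenisation: each factor of the monomial is divided by the chart variable as often
  as its degree demands.\<close>

lemma Fract_monomial:
  assumes e: "\<And>j. (\<Sum>i\<in>UNIV. Poly_Mapping.lookup (Poly_Mapping.lookup e j) i) = m j"
    "Poly_Mapping.keys e = {j. m j \<noteq> 0}"
  shows "Fract (exponent_monomial mvar e) (\<Prod>j\<in>{j. m j \<noteq> 0}. mvar j (r j) ^ m j) =
    exponent_monomial u e"
  unfolding exponent_monomial_def e(2) e(1)[symmetric] power_sum Fract_prod Fract_power u_def ..

text \<open>A fraction a / b is D / b times a / D, where D is the monomial of chart variables of the
  same multidegree. Here D / b lies in \<open>R\<close>, and a / D is a polynomial in affine
  coordinates, hence congruent modulo \<open>J\<close> to its value 0.\<close>

lemma vanishing_in_ideal: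
  assumes J: "ideal J L" and u: "\<And>i j. u j i - K (y j i) \<in> J" and x: "x \<in> R" "val x = 0"
  shows "x \<in> J"
proof -
  interpret local_ideal R J K val by (rule local_ideal_if_ideal[OF J])
  obtain a b m where ab: "x = Fract a b" "a \<in> multihomogeneous m" "b \<in> multihomogeneous m" "meval y b \<noteq> 0"
    using x(1) unfolding R_iff by blast
  have a0: "meval y a = 0" using x(2) ab by (simp add: val_Fract)
  define D :: "'k mpoly" where "D = (\<Prod>j\<in>{j. m j \<noteq> 0}. mvar j (r j) ^ m j)"
  have D1: "meval y D = 1"
  proof -
    have "meval y (mvar j (r j) ^ n) = 1" for j n
      by (induction n) (simp_all add: meval_one meval_mult meval_mvar chart)
    then show ?thesis by (simp add: D_def meval_prod)
  qed
  then have D0: "D \<noteq> 0" using meval_nonzero[of D] by simp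
  \<comment> \<open>A nonzero denominator makes the multidegree finitely supported, so that D really
    has multidegree \<open>m\<close>.\<close>
  have "b \<noteq> 0" using ab meval_nonzero by blast
  then obtain e where "e \<in> Poly_Mapping.keys b" by fastforce
  then have fin: "finite {j. m j \<noteq> 0}" using keys_multihomogeneous[OF ab(3)] finite_keys by metis
  have "D \<in> multihomogeneous (\<lambda>l. \<Sum>j\<in>{j. m j \<noteq> 0}. m j * (if l = j then 1 else 0))"
    unfolding D_def by (rule multihomogeneous_prod) (rule multihomogeneous_power[OF multihomogeneous_mvar])
  moreover have "(\<Sum>j\<in>{j. m j \<noteq> 0}. m j * (if l = j then 1 else 0)) = m l" for l
    using fin by (simp add: if_distrib sum.delta cong: if_cong)
  ultimately have Dm: "D \<in> multihomogeneous m" by simp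
  have "Fract a D = (\<Sum>e\<in>Poly_Mapping.keys a. K (Poly_Mapping.lookup a e) * exponent_monomial u e)"
  proof -
    have "a = (\<Sum>e\<in>Poly_Mapping.keys a. Poly_Mapping.single e (Poly_Mapping.lookup a e))"
      by (rule poly_mapping_eqI) (simp add: lookup_sum lookup_single when_def in_keys_iff)
    then have "Fract a D = Fract (\<Sum>e\<in>Poly_Mapping.keys a. Poly_Mapping.single e (Poly_Mapping.lookup a e)) D"
      by (rule arg_cong)
    also have "\<dots> = (\<Sum>e\<in>Poly_Mapping.keys a. Fract (Poly_Mapping.single e (Poly_Mapping.lookup a e)) D)"
      by (rule Fract_sum_same[OF D0])
    also have "\<dots> = (\<Sum>e\<in>Poly_Mapping.keys a. K (Poly_Mapping.lookup a e) * exponent_monomial u e)"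
    proof (rule sum.cong[OF refl])
      fix e assume e: "e \<in> Poly_Mapping.keys a"
      have "Fract (exponent_monomial mvar e) D = exponent_monomial u e"
        unfolding D_def
        using ab(2) e
        by (intro Fract_monomial keys_multihomogeneous[OF ab(2) e]) (simp add: multihomogeneous_def)
      then show "Fract (Poly_Mapping.single e (Poly_Mapping.lookup a e)) D =
          K (Poly_Mapping.lookup a e) * exponent_monomial u e"
        unfolding single_eq_monomial K_def
        using Fract_mult_distrib[of "mconst (Poly_Mapping.lookup a e)" "exponent_monomial mvar e" 1 D]
        by simp
    qed
    finally show ?thesis .
  qed
  moreover have "(\<Sum>e\<in>Poly_Mapping.keys a. K (Poly_Mapping.lookup a e) * exponent_monomial u e) -
      K (\<Sum>e\<in>Poly_Mapping.keys a. Poly_Mapping.lookup a e * exponent_monomial y e) \<in> J"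
  proof (rule cong_sum)
    fix e
    have "exponent_monomial u e \<in> R"
      unfolding exponent_monomial_def by (intro R_prod R_power R_u)
    moreover have "exponent_monomial u e - K (exponent_monomial y e) \<in> J"
      unfolding exponent_monomial_def by (intro cong_prod cong_power R_prod R_power R_u u)
    ultimately show "K (Poly_Mapping.lookup a e) * exponent_monomial u e -
        K (Poly_Mapping.lookup a e * exponent_monomial y e) \<in> J"
      by (intro cong_mult R_K) (simp_all add: J_0)
  qed
  ultimately have "Fract a D \<in> J"
    using a0 by (simp add: meval_eq_lin_ext lin_ext_def K_0)
  moreover have "x = Fract D b * Fract a D"
    using ab(1) D0 by (simp add: mult.commute mult_fract_cancel)
  ultimately show ?thesis using J_left[OF R_I[OF Dm ab(3,4)]] by (simp only:)
qed


text \<open>The chart variables supply a denominator for each generator. The last part will show the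
  stalk ideal to be proper at a point of the scheme: the fractions of value 0 form an ideal that
  contains all generators.\<close>

lemma stalk_ideal: "ideal (point_scheme_stalk_ideal I P) L"
  and stalk_ideal_generator: "f \<in> I \<Longrightarrow> f \<in> free_homogeneous d \<Longrightarrow>
    Fract (multilinearisation f) (\<Prod>j<d. mvar j (r j)) \<in> point_scheme_stalk_ideal I P"
  and stalk_ideal_val: "(\<And>f d. f \<in> I \<Longrightarrow> f \<in> free_homogeneous d \<Longrightarrow> lin_ext (word_monomial y) f = 0) \<Longrightarrow>
    x \<in> point_scheme_stalk_ideal I P \<Longrightarrow> val x = 0"
proof -
  interpret ring L by (rule ring_L)
  let ?G = "{Fract (multilinearisation f) b | f b d. f \<in> I \<inter> free_homogeneous d \<and>
         b \<in> multihomogeneous (\<lambda>j. if j < d then 1 else 0) \<and> b \<in> nonvanishing_at P}"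
  have eq: "point_scheme_stalk_ideal I P = genideal L ?G"
    by (simp add: point_scheme_stalk_ideal_def L_def)
  have G: "\<exists>f b d. x = Fract (multilinearisation f) b \<and> f \<in> I \<and> f \<in> free_homogeneous d \<and>
      multilinearisation f \<in> multihomogeneous (\<lambda>j. if j < d then 1 else 0) \<and>
      b \<in> multihomogeneous (\<lambda>j. if j < d then 1 else 0) \<and> meval y b \<noteq> 0" if "x \<in> ?G" for x
    using that multihomogeneous_multilinearisation nonvanishing_at_iff[of _ _ y]
    unfolding P_def by blast
  have G_R: "?G \<subseteq> carrier L"
  proof
    fix x assume "x \<in> ?G"
    then show "x \<in> carrier L" using G[of x] R_I by auto
  qed
  show ideal: "ideal (point_scheme_stalk_ideal I P) L"
    unfolding eq by (rule genideal_ideal[OF G_R])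
  show "Fract (multilinearisation f) (\<Prod>j<d. mvar j (r j)) \<in> point_scheme_stalk_ideal I P"
    if f: "f \<in> I" "f \<in> free_homogeneous d"
  proof -
    have "meval y (\<Prod>j<d. mvar j (r j)) \<noteq> 0" by (simp add: meval_prod meval_mvar chart)
    then have "(\<Prod>j<d. mvar j (r j)) \<in> nonvanishing_at P"
      unfolding P_def using nonvanishing_at_iff[OF multihomogeneous_word] by blast
    then show ?thesis using f multihomogeneous_word[where d = d and w = r] genideal_self[OF G_R]
      unfolding eq by blast
  qed
  show "val x = 0"
    if van: "\<And>f d. f \<in> I \<Longrightarrow> f \<in> free_homogeneous d \<Longrightarrow> lin_ext (word_monomial y) f = 0"
      and x: "x \<in> point_scheme_stalk_ideal I P"
  proof -
    have "ideal {x \<in> R. val x = 0} L"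
    proof (intro idealI ring_L add.subgroupI)
      show "{x \<in> R. val x = 0} \<noteq> {}" using R_K val_K by blast
      fix x assume x: "x \<in> {x \<in> R. val x = 0}"
      have "\<ominus>\<^bsub>L\<^esub> x = - x" by (rule minus_equality) (use x R_uminus in auto)
      moreover have "val (- x) = 0"
        using x R_closed(3)[of x "- x"] R_uminus[of x] val_K[of 0] by (simp add: K_hom)
      ultimately show "\<ominus>\<^bsub>L\<^esub> x \<in> {x \<in> R. val x = 0}"
        using x R_uminus[of x] by simp
    qed (auto simp: R_closed)
    moreover have "?G \<subseteq> {x \<in> R. val x = 0}"
    proof
      fix x assume "x \<in> ?G"
      then show "x \<in> {x \<in> R. val x = 0}"
        using G[of x] R_I van by (auto simp: val_Fract meval_multilinearisation)
    qed
    ultimately have "point_scheme_stalk_ideal I P \<subseteq> {x \<in> R. val x = 0}"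
      unfolding eq by (rule genideal_minimal)
    then show "val x = 0" using x by auto
  qed
qed

text \<open>Every fraction is congruent to its value, so the quotient consists of classes of
  constants; vanishing of the relations at the point keeps it from being zero.\<close>

lemma has_multiplicity_1:
  assumes van: "\<And>f d. f \<in> I \<Longrightarrow> f \<in> free_homogeneous d \<Longrightarrow> lin_ext (word_monomial y) f = 0"
    and rigid: "\<And>i j. u j i - K (y j i) \<in> point_scheme_stalk_ideal I P"
  shows "has_multiplicity I P 1"
proof -
  define J where "J = point_scheme_stalk_ideal I P"
  have J: "ideal J L" unfolding J_def by (rule stalk_ideal)
  interpret ideal J L by (rule J)
  interpret li: local_ideal R J K val by (rule local_ideal_if_ideal[OF J])
  have Q_ring: "ring (L Quot J)" by (rule quotient_is_ring)
  interpret Q: ring "L Quot J" by (rule Q_ring)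
  let ?k = "range (\<lambda>c. J +>\<^bsub>L\<^esub> K c)"
  have coset: "J +>\<^bsub>L\<^esub> x = {h + x | h. h \<in> J}" for x
    by (auto simp: a_r_coset_def r_coset_def)
  have carrier: "carrier (L Quot J) = ?k"
  proof -
    have "J +>\<^bsub>L\<^esub> x = J +>\<^bsub>L\<^esub> K (val x)" if x: "x \<in> R" for x
    proof -
      have "val (x - K (val x)) = 0"
        using li.val_diff[OF x R_K, of "val x"] by (simp add: val_K)
      then have d: "x - K (val x) \<in> J"
        by (rule vanishing_in_ideal[OF J rigid[folded J_def] li.R_diff[OF x R_K]])
      have "h + x \<in> J +>\<^bsub>L\<^esub> K (val x)" if "h \<in> J" for h
        unfolding coset using li.J_add[OF that d] by (auto intro!: exI[of _ "h + (x - K (val x))"])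
      moreover have "h + K (val x) \<in> J +>\<^bsub>L\<^esub> x" if "h \<in> J" for h
        unfolding coset using li.J_diff[OF that d] by (auto intro!: exI[of _ "h - (x - K (val x))"])
      ultimately show ?thesis unfolding coset by blast
    qed
    then have "(\<lambda>x. J +>\<^bsub>L\<^esub> x) ` R \<subseteq> ?k" by (intro image_subsetI) (rule range_eqI)
    then have "(\<lambda>x. J +>\<^bsub>L\<^esub> x) ` R = ?k" using R_K by (intro equalityI) auto
    moreover have "carrier (L Quot J) = (\<lambda>x. J +>\<^bsub>L\<^esub> x) ` R"
      by (auto simp: FactRing_def A_RCOSETS_defs a_r_coset_def)
    ultimately show ?thesis by (rule trans[rotated])
  qed
  have "val 1 = 0" if "1 \<in> J"
    using that unfolding J_def by (rule stalk_ideal_val[rotated]) (rule van)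
  then have "1 \<notin> J" using val_K[of 1] by (auto simp: K_hom)
  then have "J +>\<^bsub>L\<^esub> 1 \<noteq> J"
    unfolding coset using li.J_0 by force
  then have one: "\<one>\<^bsub>L Quot J\<^esub> \<notin> {\<zero>\<^bsub>L Quot J\<^esub>}" by (simp add: FactRing_def)
  \<comment> \<open>Over the classes of constants the quotient is the line through its unit, so one
    extension of the zero space exhausts it.\<close>
  have "Q.line_extension ?k \<one>\<^bsub>L Quot J\<^esub> {\<zero>\<^bsub>L Quot J\<^esub>} = ?k"
    unfolding carrier[symmetric]
    by (intro equalityI subsetI) (auto simp: Q.line_extension_mem_iff)
  then have "Q.dimension (Suc 0) ?k ?k"
    using Q.dimension.Suc_dim[OF Q.one_closed one Q.dimension.zero_dim[of ?k]] by simp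
  then have "Q.dimension 1 ?k (carrier (L Quot J))" by (simp add: carrier)
  then show ?thesis
    unfolding has_multiplicity_def point_scheme_local_ring_def L_def[symmetric] J_def[symmetric]
      K_def[symmetric] .
qed

lemma Fract_word:
  assumes "length w = d"
  shows "Fract (mconst c * (\<Prod>j<length w. mvar j (w ! j))) (\<Prod>j<d. mvar j (r j)) =
    K c * (\<Prod>j<d. u j (w ! j))"
  using Fract_mult_distrib[of "mconst c" "\<Prod>j<d. mvar j (w ! j)" 1 "\<Prod>j<d. mvar j (r j)"]
  by (simp add: assms K_def u_def Fract_prod)

text \<open>The prefix of chart letters contributes affine coordinates equal to 1. Dividing the
  multilinearised relation of degree n + 2 by the chart variables therefore leaves the quadratic
  relation in the factors n and n + 1.\<close>

lemma relation_in_stalk_ideal: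
  assumes "rel4 i j k p q s \<in> twisted_relations \<alpha> \<beta> \<gamma>"
  shows "u n 0 * u (Suc n) i + K p * (u n i * u (Suc n) 0) + K q * (u n j * u (Suc n) k) +
    K s * (u n k * u (Suc n) j) \<in> point_scheme_stalk_ideal (twist_relations \<alpha> \<beta> \<gamma>) P"
proof -
  let ?w = "\<lambda>l l'. map r [0..<n] @ [l, l']"
  let ?D = "\<Prod>j<n + 2. mvar j (r j) :: 'k mpoly"
  define f where "f = Poly_Mapping.single (map r [0..<n]) 1 * rel4 i j k p q s"
  have f: "f = Poly_Mapping.single (?w 0 i) 1 + Poly_Mapping.single (?w i 0) p +
      Poly_Mapping.single (?w j k) q + Poly_Mapping.single (?w k j) s"
    by (simp add: f_def rel4_def distrib_left mult_single plus_list_def)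
  have "length w = n + 2" if "w \<in> Poly_Mapping.keys f" for w
    using that unfolding f by (auto dest!: subsetD[OF Poly_Mapping.keys_add] split: if_splits)
  then have "f \<in> free_homogeneous (n + 2)" by (simp add: free_homogeneous_def)
  moreover have "f \<in> twist_relations \<alpha> \<beta> \<gamma>"
    unfolding f_def using assms by (rule word_twisted_relation_in)
  ultimately have "Fract (multilinearisation f) ?D \<in> point_scheme_stalk_ideal (twist_relations \<alpha> \<beta> \<gamma>) P"
    by (intro stalk_ideal_generator)
  moreover have D: "?D \<noteq> 0"
    by (rule meval_nonzero) (simp add: meval_prod meval_mult meval_mvar chart)
  have prod: "(\<Prod>m<n + 2. u m (?w l l' ! m)) = u n l * u (Suc n) l'" for l l'
  proof -
    have "(\<Prod>m<n. u m (?w l l' ! m)) = 1"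
      by (rule prod.neutral) (simp add: nth_append u_chart)
    then show ?thesis by (simp add: nth_append)
  qed
  have "Fract (mconst x * (\<Prod>m<length (?w l l'). mvar m (?w l l' ! m))) ?D =
      K x * (u n l * u (Suc n) l')" for x l l'
    unfolding prod[symmetric] by (rule Fract_word) simp
  then have "Fract (multilinearisation f) ?D = K 1 * (u n 0 * u (Suc n) i) +
      K p * (u n i * u (Suc n) 0) + K q * (u n j * u (Suc n) k) + K s * (u n k * u (Suc n) j)"
    unfolding f multilinearisation_add multilinearisation_single Fract_add_same[OF D] by simp
  ultimately show ?thesis by (simp add: K_hom)
qed

lemma relations_in_stalk_ideal:
  fixes \<alpha> \<beta> \<gamma>
  defines "J \<equiv> point_scheme_stalk_ideal (twist_relations \<alpha> \<beta> \<gamma>) P"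
  shows "u n 0 * u (Suc n) 1 - u n 1 * u (Suc n) 0 - K \<alpha> * (u n 2 * u (Suc n) 3 - u n 3 * u (Suc n) 2) \<in> J"
    and "u n 0 * u (Suc n) 1 + u n 1 * u (Suc n) 0 - (u n 2 * u (Suc n) 3 + u n 3 * u (Suc n) 2) \<in> J"
    and "u n 0 * u (Suc n) 2 - u n 2 * u (Suc n) 0 - K \<beta> * (u n 3 * u (Suc n) 1 - u n 1 * u (Suc n) 3) \<in> J"
    and "u n 0 * u (Suc n) 2 + u n 2 * u (Suc n) 0 - (u n 3 * u (Suc n) 1 + u n 1 * u (Suc n) 3) \<in> J"
    and "u n 0 * u (Suc n) 3 - u n 3 * u (Suc n) 0 + K \<gamma> * (u n 1 * u (Suc n) 2 - u n 2 * u (Suc n) 1) \<in> J"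
    and "u n 0 * u (Suc n) 3 + u n 3 * u (Suc n) 0 + (u n 1 * u (Suc n) 2 + u n 2 * u (Suc n) 1) \<in> J"
proof -
  interpret li: local_ideal R J K val
    unfolding J_def by (rule local_ideal_if_ideal[OF stalk_ideal])
  note rel = relation_in_stalk_ideal[where \<alpha> = \<alpha> and \<beta> = \<beta> and \<gamma> = \<gamma> and n = n,
      folded J_def, unfolded twisted_relations_def]
  note simps = li.K_uminus li.K_1 algebra_simps
  show "u n 0 * u (Suc n) 1 - u n 1 * u (Suc n) 0 - K \<alpha> * (u n 2 * u (Suc n) 3 - u n 3 * u (Suc n) 2) \<in> J"
    using rel[of 1 2 3 "- 1" "- \<alpha>" \<alpha>] by (simp add: simps)
  show "u n 0 * u (Suc n) 1 + u n 1 * u (Suc n) 0 - (u n 2 * u (Suc n) 3 + u n 3 * u (Suc n) 2) \<in> J"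
    using rel[of 1 2 3 1 "- 1" "- 1"] by (simp add: simps)
  show "u n 0 * u (Suc n) 2 - u n 2 * u (Suc n) 0 - K \<beta> * (u n 3 * u (Suc n) 1 - u n 1 * u (Suc n) 3) \<in> J"
    using rel[of 2 3 1 "- 1" "- \<beta>" \<beta>] by (simp add: simps)
  show "u n 0 * u (Suc n) 2 + u n 2 * u (Suc n) 0 - (u n 3 * u (Suc n) 1 + u n 1 * u (Suc n) 3) \<in> J"
    using rel[of 2 3 1 1 "- 1" "- 1"] by (simp add: simps)
  show "u n 0 * u (Suc n) 3 - u n 3 * u (Suc n) 0 + K \<gamma> * (u n 1 * u (Suc n) 2 - u n 2 * u (Suc n) 1) \<in> J"
    using rel[of 3 1 2 "- 1" \<gamma> "- \<gamma>"] by (simp add: simps)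
  show "u n 0 * u (Suc n) 3 + u n 3 * u (Suc n) 0 + (u n 1 * u (Suc n) 2 + u n 2 * u (Suc n) 1) \<in> J"
    using rel[of 3 1 2 1 1 1] by (simp add: simps)
qed

end

lemma forall_4: "(\<forall>i::4. Q i) \<longleftrightarrow> Q 0 \<and> Q 1 \<and> Q 2 \<and> Q 3"
  by (metis UNIV_I univ4 insertE emptyE)

context local_ideal
begin

lemma J_scaled: "x \<in> J \<Longrightarrow> z = K c * x \<Longrightarrow> z \<in> J"
  using J_left[OF R_K] by simp

text \<open>Coordinate i takes over the role of coordinate 0, the linear terms being the products
  with an index i. Where these carry a parameter the relation is divided by it; the result has the
  form of \<open>coordinate_point_rigid\<close> with other constants.\<close>

lemma coordinate_rigid:
  fixes y z :: "4 \<Rightarrow> 'f"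
  assumes R: "\<And>l. y l \<in> R" "\<And>l. z l \<in> R"
    and f1: "y 0 * z 1 - y 1 * z 0 - K \<alpha> * (y 2 * z 3 - y 3 * z 2) \<in> J"
    and f2: "y 0 * z 1 + y 1 * z 0 - (y 2 * z 3 + y 3 * z 2) \<in> J"
    and f3: "y 0 * z 2 - y 2 * z 0 - K \<beta> * (y 3 * z 1 - y 1 * z 3) \<in> J"
    and f4: "y 0 * z 2 + y 2 * z 0 - (y 3 * z 1 + y 1 * z 3) \<in> J"
    and f5: "y 0 * z 3 - y 3 * z 0 + K \<gamma> * (y 1 * z 2 - y 2 * z 1) \<in> J"
    and f6: "y 0 * z 3 + y 3 * z 0 + (y 1 * z 2 + y 2 * z 1) \<in> J"
    and two: "(2::'k) \<noteq> 0" and nz: "{\<alpha>, \<beta>, \<gamma>} \<inter> {0, 1, - 1} = {}"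
    and i: "y i = 1" "z i = 1" and val: "\<And>l. l \<noteq> i \<Longrightarrow> val (y l) = 0" "\<And>l. l \<noteq> i \<Longrightarrow> val (z l) = 0"
    and l: "l \<noteq> i"
  shows "y l \<in> J"
proof -
  have inv: "K (inverse \<alpha>) * (K \<alpha> * x) = x" "K (inverse \<beta>) * (K \<beta> * x) = x"
    "K (inverse \<gamma>) * (K \<gamma> * x) = x" for x
    using nz by (simp_all add: mult.assoc[symmetric] K_mult[symmetric] K_1)
  have f1': "K (inverse \<alpha>) * (y 0 * z 1 - y 1 * z 0) - (y 2 * z 3 - y 3 * z 2) \<in> J"
    by (rule J_scaled[OF f1, of _ "inverse \<alpha>"]) (simp only: right_diff_distrib[of "K _" "_ - _"] inv)
  have f3': "K (inverse \<beta>) * (y 0 * z 2 - y 2 * z 0) - (y 3 * z 1 - y 1 * z 3) \<in> J"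
    by (rule J_scaled[OF f3, of _ "inverse \<beta>"]) (simp only: right_diff_distrib[of "K _" "_ - _"] inv)
  have f5': "K (inverse \<gamma>) * (y 0 * z 3 - y 3 * z 0) + (y 1 * z 2 - y 2 * z 1) \<in> J"
    by (rule J_scaled[OF f5, of _ "inverse \<gamma>"]) (simp only: distrib_left inv)
  note simps = K_uminus K_1 algebra_simps
  have "i \<in> {0, 1, 2, 3}" using univ4 by auto
  then consider "i = 0" | "i = 1" | "i = 2" | "i = 3" by blast
  then show ?thesis
  proof cases
    case 1
    have v: "val (y 1) = 0" "val (y 2) = 0" "val (y 3) = 0" "val (z 1) = 0" "val (z 2) = 0" "val (z 3) = 0"
      using val 1 by simp_all
    have g1: "z 1 - y 1 - K \<alpha> * (y 2 * z 3 - y 3 * z 2) \<in> J"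
      using i unfolding 1 by (intro J_scaled[OF f1, of _ 1]) (simp add: simps)
    have g2: "z 1 + y 1 - K 1 * (y 2 * z 3 + y 3 * z 2) \<in> J"
      using i unfolding 1 by (intro J_scaled[OF f2, of _ 1]) (simp add: simps)
    have g3: "z 2 - y 2 - K \<beta> * (y 3 * z 1 - y 1 * z 3) \<in> J"
      using i unfolding 1 by (intro J_scaled[OF f3, of _ 1]) (simp add: simps)
    have g4: "z 2 + y 2 - K 1 * (y 3 * z 1 + y 1 * z 3) \<in> J"
      using i unfolding 1 by (intro J_scaled[OF f4, of _ 1]) (simp add: simps)
    have g5: "z 3 - y 3 - K (- \<gamma>) * (y 1 * z 2 - y 2 * z 1) \<in> J"
      using i unfolding 1 by (intro J_scaled[OF f5, of _ 1]) (simp add: simps)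
    have g6: "z 3 + y 3 - K (- 1) * (y 1 * z 2 + y 2 * z 1) \<in> J"
      using i unfolding 1 by (intro J_scaled[OF f6, of _ 1]) (simp add: simps)
    have "y 1 \<in> J \<and> y 2 \<in> J \<and> y 3 \<in> J"
      using coordinate_point_rigid(1-3)[OF R(1) R(1) R(1) R(2) R(2) R(2) v two g1 g2 g3 g4 g5 g6]
      by simp
    then have "\<forall>l. l \<noteq> i \<longrightarrow> y l \<in> J" unfolding forall_4 1 by simp
    then show ?thesis using l by blast
  next
    case 2
    have v: "val (y 0) = 0" "val (y 2) = 0" "val (y 3) = 0" "val (z 0) = 0" "val (z 2) = 0" "val (z 3) = 0"
      using val 2 by simp_all
    have g1: "z 0 - y 0 - K (- \<alpha>) * (y 2 * z 3 - y 3 * z 2) \<in> J"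
      using i unfolding 2 by (intro J_scaled[OF f1, of _ "- 1"]) (simp add: simps)
    have g2: "z 0 + y 0 - K 1 * (y 2 * z 3 + y 3 * z 2) \<in> J"
      using i unfolding 2 by (intro J_scaled[OF f2, of _ 1]) (simp add: simps)
    have g3: "z 2 - y 2 - K (inverse \<gamma>) * (y 3 * z 0 - y 0 * z 3) \<in> J"
      using i unfolding 2 by (intro J_scaled[OF f5', of _ 1]) (simp add: simps)
    have g4: "z 2 + y 2 - K (- 1) * (y 3 * z 0 + y 0 * z 3) \<in> J"
      using i unfolding 2 by (intro J_scaled[OF f6, of _ 1]) (simp add: simps)
    have g5: "z 3 - y 3 - K (- inverse \<beta>) * (y 0 * z 2 - y 2 * z 0) \<in> J"
      using i unfolding 2 by (intro J_scaled[OF f3', of _ 1]) (simp add: simps)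
    have g6: "z 3 + y 3 - K 1 * (y 0 * z 2 + y 2 * z 0) \<in> J"
      using i unfolding 2 by (intro J_scaled[OF f4, of _ "- 1"]) (simp add: simps)
    have "y 0 \<in> J \<and> y 2 \<in> J \<and> y 3 \<in> J"
      using coordinate_point_rigid(1-3)[OF R(1) R(1) R(1) R(2) R(2) R(2) v two g1 g2 g3 g4 g5 g6]
      by simp
    then have "\<forall>l. l \<noteq> i \<longrightarrow> y l \<in> J" unfolding forall_4 2 by simp
    then show ?thesis using l by blast
  next
    case 3
    have v: "val (y 0) = 0" "val (y 1) = 0" "val (y 3) = 0" "val (z 0) = 0" "val (z 1) = 0" "val (z 3) = 0"
      using val 3 by simp_all
    have g1: "z 0 - y 0 - K \<beta> * (y 1 * z 3 - y 3 * z 1) \<in> J"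
      using i unfolding 3 by (intro J_scaled[OF f3, of _ "- 1"]) (simp add: simps)
    have g2: "z 0 + y 0 - K 1 * (y 1 * z 3 + y 3 * z 1) \<in> J"
      using i unfolding 3 by (intro J_scaled[OF f4, of _ 1]) (simp add: simps)
    have g3: "z 1 - y 1 - K (- inverse \<gamma>) * (y 3 * z 0 - y 0 * z 3) \<in> J"
      using i unfolding 3 by (intro J_scaled[OF f5', of _ "- 1"]) (simp add: simps)
    have g4: "z 1 + y 1 - K (- 1) * (y 3 * z 0 + y 0 * z 3) \<in> J"
      using i unfolding 3 by (intro J_scaled[OF f6, of _ 1]) (simp add: simps)
    have g5: "z 3 - y 3 - K (inverse \<alpha>) * (y 0 * z 1 - y 1 * z 0) \<in> J"
      using i unfolding 3 by (intro J_scaled[OF f1', of _ "- 1"]) (simp add: simps)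
    have g6: "z 3 + y 3 - K 1 * (y 0 * z 1 + y 1 * z 0) \<in> J"
      using i unfolding 3 by (intro J_scaled[OF f2, of _ "- 1"]) (simp add: simps)
    have "y 0 \<in> J \<and> y 1 \<in> J \<and> y 3 \<in> J"
      using coordinate_point_rigid(1-3)[OF R(1) R(1) R(1) R(2) R(2) R(2) v two g1 g2 g3 g4 g5 g6]
      by simp
    then have "\<forall>l. l \<noteq> i \<longrightarrow> y l \<in> J" unfolding forall_4 3 by simp
    then show ?thesis using l by blast
  next
    case 4
    have v: "val (y 0) = 0" "val (y 1) = 0" "val (y 2) = 0" "val (z 0) = 0" "val (z 1) = 0" "val (z 2) = 0"
      using val 4 by simp_all
    have g1: "z 0 - y 0 - K \<gamma> * (y 1 * z 2 - y 2 * z 1) \<in> J"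
      using i unfolding 4 by (intro J_scaled[OF f5, of _ "- 1"]) (simp add: simps)
    have g2: "z 0 + y 0 - K (- 1) * (y 1 * z 2 + y 2 * z 1) \<in> J"
      using i unfolding 4 by (intro J_scaled[OF f6, of _ 1]) (simp add: simps)
    have g3: "z 1 - y 1 - K (- inverse \<beta>) * (y 2 * z 0 - y 0 * z 2) \<in> J"
      using i unfolding 4 by (intro J_scaled[OF f3', of _ "- 1"]) (simp add: simps)
    have g4: "z 1 + y 1 - K 1 * (y 2 * z 0 + y 0 * z 2) \<in> J"
      using i unfolding 4 by (intro J_scaled[OF f4, of _ "- 1"]) (simp add: simps)
    have g5: "z 2 - y 2 - K (- inverse \<alpha>) * (y 0 * z 1 - y 1 * z 0) \<in> J"
      using i unfolding 4 by (intro J_scaled[OF f1', of _ 1]) (simp add: simps)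
    have g6: "z 2 + y 2 - K 1 * (y 0 * z 1 + y 1 * z 0) \<in> J"
      using i unfolding 4 by (intro J_scaled[OF f2, of _ "- 1"]) (simp add: simps)
    have "y 0 \<in> J \<and> y 1 \<in> J \<and> y 2 \<in> J"
      using coordinate_point_rigid(1-3)[OF R(1) R(1) R(1) R(2) R(2) R(2) v two g1 g2 g3 g4 g5 g6]
      by simp
    then have "\<forall>l. l \<noteq> i \<longrightarrow> y l \<in> J" unfolding forall_4 4 by simp
    then show ?thesis using l by blast
  qed
qed

end

section \<open>The families of points\<close>

text \<open>In a sign triple the product of two signs is the third, so passing to the successor
  multiplies both sides of each equation by the same sign.\<close>

lemma on_family_succ:
  assumes "on_family \<alpha> \<beta> \<gamma> e1 e2 e3 p1 p2 p3"
  shows "on_family \<alpha> \<beta> \<gamma> e1 e2 e3 (e1 * p1) (e2 * p2) (e3 * p3)"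
proof -
  have e: "sign_triple e1 e2 e3" using assms unfolding on_family_def by blast
  have e': "e1 \<noteq> 0" "e2 \<noteq> 0" "e3 \<noteq> 0"
    using e by (auto simp: sign_triple_def)
  have mult: "e2 * p2 * (e3 * p3) = e1 * (p2 * p3)" "e3 * p3 * (e1 * p1) = e2 * (p3 * p1)"
    "e1 * p1 * (e2 * p2) = e3 * (p1 * p2)"
    using e by (auto simp: sign_triple_def)
  have p: "p1 = family_coeff \<alpha> 1 e1 e3 * (p2 * p3)" "p2 = family_coeff \<beta> 1 e2 e1 * (p3 * p1)"
    "p3 = family_coeff (- \<gamma>) (- 1) e3 e2 * (p1 * p2)"
    using assms unfolding on_family_def mult.assoc by blast+
  have eq1: "e1 * p1 = family_coeff \<alpha> 1 e1 e3 * (e2 * p2 * (e3 * p3))"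
    unfolding mult by (subst p(1)) (rule mult.left_commute)
  have eq2: "e2 * p2 = family_coeff \<beta> 1 e2 e1 * (e3 * p3 * (e1 * p1))"
    unfolding mult by (subst p(2)) (rule mult.left_commute)
  have eq3: "e3 * p3 = family_coeff (- \<gamma>) (- 1) e3 e2 * (e1 * p1 * (e2 * p2))"
    unfolding mult by (subst p(3)) (rule mult.left_commute)
  have "p1 \<noteq> 0" "p2 \<noteq> 0" "p3 \<noteq> 0" using assms unfolding on_family_def by blast+
  then have "e1 * p1 \<noteq> 0" "e2 * p2 \<noteq> 0" "e3 * p3 \<noteq> 0" using e' by simp_all
  then show ?thesis
    using e eq1 eq2 eq3 unfolding on_family_def mult.assoc by blast
qed

text \<open>The first family equation has coefficient 1, -1, \<alpha> or -\<alpha> according to the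
  triple. These are distinct, so a point determines its family.\<close>

lemma on_family_unique:
  fixes \<alpha> \<beta> \<gamma> :: "'k::field"
  assumes two: "(2::'k) \<noteq> 0" and nz: "{\<alpha>, \<beta>, \<gamma>} \<inter> {0, 1, - 1} = {}"
    and "on_family \<alpha> \<beta> \<gamma> e1 e2 e3 p1 p2 p3" "on_family \<alpha> \<beta> \<gamma> e1' e2' e3' p1 p2 p3"
  shows "e1' = e1 \<and> e2' = e2 \<and> e3' = e3"
proof -
  have e: "sign_triple e1 e2 e3" "sign_triple e1' e2' e3'" and p: "p2 \<noteq> 0" "p3 \<noteq> 0"
    and eq: "p1 = family_coeff \<alpha> 1 e1 e3 * (p2 * p3)" "p1 = family_coeff \<alpha> 1 e1' e3' * (p2 * p3)"
    using assms(3,4) unfolding on_family_def mult.assoc by blast+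
  have ne: "(- 1 :: 'k) \<noteq> 1" using two by (metis add.right_inverse one_add_one)
  have "\<alpha> \<noteq> - \<alpha>" using two nz by (auto simp: eq_neg_iff_add_eq_0 simp flip: mult_2)
  moreover have "family_coeff \<alpha> 1 e1 e3 = family_coeff \<alpha> 1 e1' e3'"
    using p eq(2)[unfolded eq(1)] by simp
  moreover have "\<alpha> \<noteq> 1" "\<alpha> \<noteq> - 1" "1 \<noteq> \<alpha>" "- 1 \<noteq> \<alpha>" "- \<alpha> \<noteq> 1" using nz by (auto simp: minus_equation_iff)
  ultimately show ?thesis using e ne unfolding sign_triple_def
    by (elim insertE; simp_all add: family_coeff_def)
qed

lemma on_family_twist_pair:
  fixes \<alpha> \<beta> \<gamma> :: "'k::field" and y z :: "4 \<Rightarrow> 'k"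
  assumes two: "(2::'k) \<noteq> 0" and fam: "on_family \<alpha> \<beta> \<gamma> e1 e2 e3 (y 1) (y 2) (y 3)"
    and yz: "y 0 = 1" "z 0 = 1" "z 1 = e1 * y 1" "z 2 = e2 * y 2" "z 3 = e3 * y 3"
  shows "twist_pair \<alpha> \<beta> \<gamma> y z"
proof -
  have e1: "sign_triple e1 e2 e3" using fam unfolding on_family_def by blast
  then have e2: "sign_triple e2 e3 e1" and e3: "sign_triple e3 e1 e2"
    by (auto simp: sign_triple_def)
  have ne: "(- 1 :: 'k) \<noteq> 1" using two by (metis add.right_inverse one_add_one)
  \<comment> \<open>One index at a time, with \<open>X\<close> standing for the product of the other
    two coordinates.\<close>
  have step: "ei * p - p - c * (ek * X - ej * X) = 0" "ei * p + p - d * (ek * X + ej * X) = 0"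
    if "sign_triple ei ej ek" "p = family_coeff c d ei ek * X" for ei ej ek p c d X
    using that(1) ne unfolding that(2) sign_triple_def
    by (auto simp: family_coeff_def algebra_simps)
  have p: "y 1 = family_coeff \<alpha> 1 e1 e3 * (y 2 * y 3)" "y 2 = family_coeff \<beta> 1 e2 e1 * (y 3 * y 1)"
    "y 3 = family_coeff (- \<gamma>) (- 1) e3 e2 * (y 1 * y 2)"
    using fam unfolding on_family_def mult.assoc by blast+
  show ?thesis
    unfolding twist_pair_def yz
    using step[OF e1 p(1)] step[OF e2 p(2)] step[OF e3 p(3)]
    by (simp add: mult_ac)
qed

section \<open>Projective points and normalised representatives\<close>

lemma proj_scale_subset: "s \<noteq> 0 \<Longrightarrow> proj (\<lambda>i. s * y i) \<subseteq> proj y"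
  unfolding proj_def by (clarsimp, rule_tac x = "c * s" in exI) (simp add: mult.assoc)

lemma proj_scale:
  assumes "s \<noteq> 0"
  shows "proj (\<lambda>i. s * y i) = proj y"
  using proj_scale_subset[of s y] proj_scale_subset[of "inverse s" "\<lambda>i. s * y i"] assms
  by (simp add: mult.assoc[symmetric])

lemma self_in_proj: "y \<in> proj y"
  unfolding proj_def by (rule CollectI, rule exI[of _ 1]) simp

lemma proj_memE:
  assumes "z \<in> proj y"
  obtains c where "c \<noteq> 0" "z = (\<lambda>i. c * y i)"
  using assms by (auto simp: proj_def)

text \<open>Coordinate 0 is preferred as chart, so that every family point is written as (1, p1, p2,
  p3).\<close>

lemma proj_space_normalised:
  assumes "p \<in> proj_space"
  obtains y i where "p = proj y" "y i = 1" "y 0 \<noteq> 0 \<longrightarrow> i = 0"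
proof -
  obtain y where y: "p = proj y" "y \<noteq> (\<lambda>i. 0)" using assms by (auto simp: proj_space_def)
  obtain i where i: "y i \<noteq> 0" "y 0 \<noteq> 0 \<Longrightarrow> i = 0"
    using y(2) by (cases "y 0 = 0") auto
  show thesis
    by (rule that[of "\<lambda>l. inverse (y i) * y l" i]) (use y i in \<open>simp_all add: proj_scale\<close>)
qed

lemma twist_pair_scale:
  assumes "twist_pair \<alpha> \<beta> \<gamma> y z"
  shows "twist_pair \<alpha> \<beta> \<gamma> (\<lambda>i. s * y i) (\<lambda>i. t * z i)"
proof -
  have scale: "s * a * (t * b) - s * c * (t * d) - e * (s * a' * (t * b') - s * c' * (t * d')) =
      s * t * (a * b - c * d - e * (a' * b' - c' * d'))"
    "s * a * (t * b) + s * c * (t * d) - (s * a' * (t * b') + s * c' * (t * d')) =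
      s * t * (a * b + c * d - (a' * b' + c' * d'))"
    "s * a * (t * b) - s * c * (t * d) + e * (s * a' * (t * b') - s * c' * (t * d')) =
      s * t * (a * b - c * d + e * (a' * b' - c' * d'))"
    "s * a * (t * b) + s * c * (t * d) + (s * a' * (t * b') + s * c' * (t * d')) =
      s * t * (a * b + c * d + (a' * b' + c' * d'))" for a b c d e a' b' c' d'
    by (simp_all add: algebra_simps)
  show ?thesis using assms unfolding twist_pair_def scale by simp
qed

lemma twist_pair_proj:
  assumes "twist_pair \<alpha> \<beta> \<gamma> y z" "y' \<in> proj y" "z' \<in> proj z"
  shows "twist_pair \<alpha> \<beta> \<gamma> y' z'"
  using assms(2,3) by (elim proj_memE) (simp add: twist_pair_scale[OF assms(1)])

section \<open>The points of the point scheme\<close>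

text \<open>The word with letters \<open>r 0\<close>, ..., \<open>r (j - 1)\<close> evaluates to 1
  and isolates the factors j and j + 1. Conversely, the pair conditions are bihomogeneous, so they
  hold for any representatives and imply all relations.\<close>

lemma point_scheme_iff:
  fixes \<alpha> \<beta> \<gamma> :: "'k::field"
  assumes P: "\<And>j. P j = proj (y j)" and chart: "\<And>j. y j (r j) = 1"
  shows "P \<in> point_scheme (twist_relations \<alpha> \<beta> \<gamma>) \<longleftrightarrow> (\<forall>j. twist_pair \<alpha> \<beta> \<gamma> (y j) (y (Suc j)))"
proof
  assume P_in: "P \<in> point_scheme (twist_relations \<alpha> \<beta> \<gamma>)"
  show "\<forall>j. twist_pair \<alpha> \<beta> \<gamma> (y j) (y (Suc j))"
  proof
    fix j
    let ?w = "map r [0..<j]"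
    have "lin_ext (word_monomial (\<lambda>l. y (j + l))) q = 0" if q: "q \<in> twisted_relations \<alpha> \<beta> \<gamma>" for q
    proof -
      let ?f = "Poly_Mapping.single ?w 1 * q"
      have "length w = 2" if "w \<in> Poly_Mapping.keys q" for w
        using q that unfolding twisted_relations_def
        by (auto dest: word_degree_rel4(2))
      then have "?f \<in> free_homogeneous (j + 2)"
        unfolding free_homogeneous_def using Poly_Mapping.keys_mult[of "Poly_Mapping.single ?w 1" q]
        by (auto simp: plus_list_def)
      then have "meval y (multilinearisation ?f) = 0"
        using P_in word_twisted_relation_in[OF q, of ?w] P self_in_proj
        unfolding point_scheme_def on_truncated_def by blast
      moreover have "word_monomial y ?w = 1"
        by (simp add: word_monomial_prod chart)
      ultimately show ?thesis
        by (simp add: meval_multilinearisation lin_ext_single_mult plus_list_def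
            word_monomial_append lin_ext_scale)
    qed
    then show "twist_pair \<alpha> \<beta> \<gamma> (y j) (y (Suc j))"
      using lin_ext_twisted_relations[of \<alpha> \<beta> \<gamma> "\<lambda>l. y (j + l)"] by simp
  qed
next
  assume pair: "\<forall>j. twist_pair \<alpha> \<beta> \<gamma> (y j) (y (Suc j))"
  have "P j \<in> proj_space" for j
    unfolding P proj_space_def using chart[of j] by fastforce
  moreover have "on_truncated (twist_relations \<alpha> \<beta> \<gamma>) d P" for d
    unfolding on_truncated_def meval_multilinearisation
  proof (intro ballI allI impI)
    fix f y' assume f: "f \<in> twist_relations \<alpha> \<beta> \<gamma> \<inter> free_homogeneous d" and y': "\<forall>j. y' j \<in> P j"
    have "twist_pair \<alpha> \<beta> \<gamma> (y' j) (y' (Suc j))" for j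
      using twist_pair_proj pair y' P by metis
    then show "lin_ext (word_monomial y') f = 0"
      using f by (intro twist_relations_vanishing[of f \<alpha> \<beta> \<gamma> d]) auto
  qed
  ultimately show "P \<in> point_scheme (twist_relations \<alpha> \<beta> \<gamma>)" by (simp add: point_scheme_def)
qed

definition vec4 :: "'k \<Rightarrow> 'k \<Rightarrow> 'k \<Rightarrow> 'k \<Rightarrow> 4 \<Rightarrow> 'k" where
  "vec4 a b c d = (\<lambda>i. if i = 0 then a else if i = 1 then b else if i = 2 then c else d)"

lemma vec4_simps [simp]: "vec4 a b c d 0 = a" "vec4 a b c d 1 = b" "vec4 a b c d 2 = c" "vec4 a b c d 3 = d"
  by (simp_all add: vec4_def)

lemma vec4_eta: "vec4 (y 0) (y 1) (y 2) (y 3) = y"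
  unfolding fun_eq_iff forall_4 by simp

lemma pt_eq: "pt a b c d = proj (vec4 a b c d)"
  by (simp add: pt_def vec4_def)

lemma coordinate_points_iff:
  "p \<in> coordinate_points \<longleftrightarrow> (\<exists>y i. p = proj y \<and> y i = 1 \<and> (\<forall>l. l \<noteq> i \<longrightarrow> y l = 0))"
proof
  assume "p \<in> coordinate_points"
  then have "p = proj (vec4 1 0 0 0) \<or> p = proj (vec4 0 1 0 0) \<or> p = proj (vec4 0 0 1 0) \<or>
      p = proj (vec4 0 0 0 1)"
    by (simp add: coordinate_points_def pt_eq)
  then show "\<exists>y i. p = proj y \<and> y i = 1 \<and> (\<forall>l. l \<noteq> i \<longrightarrow> y l = 0)"
  proof (elim disjE)
    assume "p = proj (vec4 1 0 0 0)"
    then show ?thesis by (intro exI[of _ "vec4 1 0 0 0"] exI[of _ 0]) (simp add: forall_4)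
  next
    assume "p = proj (vec4 0 1 0 0)"
    then show ?thesis by (intro exI[of _ "vec4 0 1 0 0"] exI[of _ 1]) (simp add: forall_4)
  next
    assume "p = proj (vec4 0 0 1 0)"
    then show ?thesis by (intro exI[of _ "vec4 0 0 1 0"] exI[of _ 2]) (simp add: forall_4)
  next
    assume "p = proj (vec4 0 0 0 1)"
    then show ?thesis by (intro exI[of _ "vec4 0 0 0 1"] exI[of _ 3]) (simp add: forall_4)
  qed
next
  assume "\<exists>y i. p = proj y \<and> y i = 1 \<and> (\<forall>l. l \<noteq> i \<longrightarrow> y l = 0)"
  then obtain y i where y: "p = proj y" "y i = 1" "\<forall>l. l \<noteq> i \<longrightarrow> y l = 0" by blast
  have "i = 0 \<or> i = 1 \<or> i = 2 \<or> i = 3" using univ4 by blast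
  then have "y \<in> {vec4 1 0 0 0, vec4 0 1 0 0, vec4 0 0 1 0, vec4 0 0 0 1}"
    using y(2,3) by (subst vec4_eta[symmetric, of y]) auto
  then show "p \<in> coordinate_points" unfolding y(1) coordinate_points_def pt_eq by blast
qed

definition family_points :: "'k \<Rightarrow> 'k \<Rightarrow> 'k \<Rightarrow> 'k \<Rightarrow> 'k \<Rightarrow> 'k::field \<Rightarrow> ('k \<times> 'k \<times> 'k) set" where
  "family_points \<alpha> \<beta> \<gamma> e1 e2 e3 = {(p1, p2, p3). on_family \<alpha> \<beta> \<gamma> e1 e2 e3 p1 p2 p3}"

text \<open>The squares of the coordinates are determined by the family, hence so is a point up to signs.\<close>

lemma family_points_eq:
  fixes \<alpha> \<beta> \<gamma> :: "'k::field"
  assumes "on_family \<alpha> \<beta> \<gamma> e1 e2 e3 q1 q2 q3"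
  shows "family_points \<alpha> \<beta> \<gamma> e1 e2 e3 =
    (\<lambda>(s, t). (s * t * q1, s * q2, t * q3)) ` ({1, - 1} \<times> {1, - 1})"
proof -
  define l m n where "l = family_coeff \<alpha> 1 e1 e3" "m = family_coeff \<beta> 1 e2 e1"
    "n = family_coeff (- \<gamma>) (- 1) e3 e2"
  have fam: "on_family \<alpha> \<beta> \<gamma> e1 e2 e3 p1 p2 p3 \<longleftrightarrow> p1 \<noteq> 0 \<and> p2 \<noteq> 0 \<and> p3 \<noteq> 0 \<and>
      p1 = l * p2 * p3 \<and> p2 = m * p3 * p1 \<and> p3 = n * p1 * p2" for p1 p2 p3
    using assms unfolding on_family_def l_m_n_def by blast
  have q: "q1 \<noteq> 0" "q2 \<noteq> 0" "q3 \<noteq> 0" "q1 = l * q2 * q3" "q2 = m * q3 * q1" "q3 = n * q1 * q2"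
    using assms unfolding fam by blast+
  \<comment> \<open>Inserting the second equation, respectively the third, into the first and
    cancelling x1 determines the two squares.\<close>
  have sq: "l * m * x3 * x3 = 1" "l * n * x2 * x2 = 1"
    if x: "x1 \<noteq> 0" "x1 = l * x2 * x3" "x2 = m * x3 * x1" "x3 = n * x1 * x2" for x1 x2 x3
  proof -
    have "x1 * (l * m * x3 * x3) = l * (m * x3 * x1) * x3" by (simp add: mult_ac)
    also have "\<dots> = x1 * 1" unfolding x(3)[symmetric] x(2)[symmetric] by simp
    finally show "l * m * x3 * x3 = 1" using x(1) by (simp only: mult_cancel_left simp_thms)
    have "x1 * (l * n * x2 * x2) = l * x2 * (n * x1 * x2)" by (simp add: mult_ac)
    also have "\<dots> = x1 * 1" unfolding x(4)[symmetric] x(2)[symmetric] by simp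
    finally show "l * n * x2 * x2 = 1" using x(1) by (simp only: mult_cancel_left simp_thms)
  qed
  have sqq: "l * m * q3 * q3 = 1" "l * n * q2 * q2 = 1" using sq[OF q(1,4,5,6)] by auto
  have A: "(p1, p2, p3) \<in> (\<lambda>(s, t). (s * t * q1, s * q2, t * q3)) ` ({1, - 1} \<times> {1, - 1})"
    if "on_family \<alpha> \<beta> \<gamma> e1 e2 e3 p1 p2 p3" for p1 p2 p3
  proof -
    have p: "p1 \<noteq> 0" "p1 = l * p2 * p3" "p2 = m * p3 * p1" "p3 = n * p1 * p2"
      using that unfolding fam by blast+
    have "l * m \<noteq> 0" "l * n \<noteq> 0" using sqq by auto
    moreover have "l * m * (p3 * p3) = l * m * (q3 * q3)" "l * n * (p2 * p2) = l * n * (q2 * q2)"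
      using sq[OF p] sqq by (simp_all add: mult.assoc)
    ultimately have "p3\<^sup>2 = q3\<^sup>2" "p2\<^sup>2 = q2\<^sup>2" by (simp_all add: power2_eq_square)
    then obtain s t where s: "s \<in> {1, - 1}" "p2 = s * q2" and t: "t \<in> {1, - 1}" "p3 = t * q3"
      unfolding power2_eq_iff by (metis insertI1 insertI2 mult_1 mult_minus_left singletonI)
    \<comment> \<open>The signs of the second and third coordinates are free; the first equation
      makes that of the first their product.\<close>
    have "p1 = s * t * (l * q2 * q3)" unfolding p(2) s(2) t(2) by (simp add: mult_ac)
    then have "p1 = s * t * q1" unfolding q(4)[symmetric] .
    then show ?thesis using s t by force
  qed
  have B: "on_family \<alpha> \<beta> \<gamma> e1 e2 e3 (s * t * q1) (s * q2) (t * q3)"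
    if "s \<in> {1, - 1}" "t \<in> {1, - 1}" for s t
  proof -
    have "s * t * q1 = l * (s * q2) * (t * q3)" unfolding q(4) by (simp add: mult_ac)
    moreover have "s * q2 = m * (t * q3) * (s * t * q1)"
    proof -
      have "m * (t * q3) * (s * t * q1) = (t * t) * s * (m * q3 * q1)" by (simp add: mult_ac)
      also have "\<dots> = s * q2" unfolding q(5)[symmetric] using that by auto
      finally show ?thesis ..
    qed
    moreover have "t * q3 = n * (s * t * q1) * (s * q2)"
    proof -
      have "n * (s * t * q1) * (s * q2) = (s * s) * t * (n * q1 * q2)" by (simp add: mult_ac)
      also have "\<dots> = t * q3" unfolding q(6)[symmetric] using that by auto
      finally show ?thesis ..
    qed
    moreover have "s * t * q1 \<noteq> 0" "s * q2 \<noteq> 0" "t * q3 \<noteq> 0" using q(1-3) that by auto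
    ultimately show ?thesis unfolding fam by blast
  qed
  show ?thesis
    unfolding family_points_def
  proof (intro equalityI subsetI)
    fix x assume "x \<in> {(p1, p2, p3). on_family \<alpha> \<beta> \<gamma> e1 e2 e3 p1 p2 p3}"
    then show "x \<in> (\<lambda>(s, t). (s * t * q1, s * q2, t * q3)) ` ({1, - 1} \<times> {1, - 1})"
      by (cases x) (simp only: A mem_Collect_eq split_conv)
  next
    fix x assume "x \<in> (\<lambda>(s, t). (s * t * q1, s * q2, t * q3)) ` ({1, - 1} \<times> {1, - 1})"
    then obtain st where st: "x = (\<lambda>(s, t). (s * t * q1, s * q2, t * q3)) st"
      "st \<in> {1, - 1} \<times> {1, - 1}"
      by (rule imageE)
    obtain s t where "st = (s, t)" by (rule prod.exhaust)
    with st have "s \<in> {1, - 1}" "t \<in> {1, - 1}" "x = (s * t * q1, s * q2, t * q3)"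
      by auto
    then show "x \<in> {(p1, p2, p3). on_family \<alpha> \<beta> \<gamma> e1 e2 e3 p1 p2 p3}"
      using B[of s t] by (simp only: mem_Collect_eq split_conv)
  qed
qed

lemma card_family_points:
  fixes \<alpha> \<beta> \<gamma> :: "'k::field"
  assumes two: "(2::'k) \<noteq> 0" and q: "on_family \<alpha> \<beta> \<gamma> e1 e2 e3 q1 q2 q3"
  shows "card (family_points \<alpha> \<beta> \<gamma> e1 e2 e3) = 4"
proof -
  have ne: "(- 1 :: 'k) \<noteq> 1" using two by (metis add.right_inverse one_add_one)
  have "q2 \<noteq> 0" "q3 \<noteq> 0" using q unfolding on_family_def by blast+
  then have "inj_on (\<lambda>(s, t). (s * t * q1, s * q2, t * q3)) ({1, - 1} \<times> {1, - 1})"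
    by (auto simp: inj_on_def)
  then show ?thesis using ne unfolding family_points_eq[OF q]
    by (simp add: card_image card_cartesian_product)
qed

text \<open>A coordinate pair uses the same chart twice because all other entries vanish; a family
  pair lies in chart 0 by the preference for it.\<close>

lemma normalised_pair_cases:
  fixes y z :: "4 \<Rightarrow> 'k::field"
  assumes "(2::'k) \<noteq> 0" "\<alpha> + \<beta> + \<gamma> + \<alpha> * \<beta> * \<gamma> = 0" "{\<alpha>, \<beta>, \<gamma>} \<inter> {0, 1, - 1} = {}"
    and "twist_pair \<alpha> \<beta> \<gamma> y z" and y: "y i = 1" "y 0 \<noteq> 0 \<longrightarrow> i = 0"
    and z: "z i' = 1" "z 0 \<noteq> 0 \<longrightarrow> i' = 0"
  obtains (coordinate) "i' = i" "\<And>l. l \<noteq> i \<Longrightarrow> y l = 0" "\<And>l. l \<noteq> i \<Longrightarrow> z l = 0"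
  | (family) e1 e2 e3 where "i = 0" "i' = 0" "on_family \<alpha> \<beta> \<gamma> e1 e2 e3 (y 1) (y 2) (y 3)"
      "z 1 = e1 * y 1" "z 2 = e2 * y 2" "z 3 = e3 * y 3"
proof -
  have "y \<noteq> (\<lambda>i. 0)" "z \<noteq> (\<lambda>i. 0)" using y(1) z(1) by auto
  with assms(1-4) show thesis
  proof (cases rule: twist_pair_cases)
    case (coordinate l)
    then have "i = l" "i' = l" using y(1) z(1) by force+
    then show thesis using coordinate that(1) by blast
  next
    case (family e1 e2 e3)
    then have "i = 0" "i' = 0" using y(2) z(2) by auto
    then show thesis using family that(2)[of e1 e2 e3] y(1) z(1) by simp
  qed
qed

lemma on_family_nonzero: "on_family \<alpha> \<beta> \<gamma> e1 e2 e3 p1 p2 p3 \<Longrightarrow> p1 \<noteq> 0 \<and> p2 \<noteq> 0 \<and> p3 \<noteq> 0"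
  unfolding on_family_def by blast

text \<open>Uniqueness of the successor is what makes the first projection injective. In chart 0 a
  coordinate point has zero entries and a family point has none, so the two types do not
  mix.\<close>

lemma normalised_pair_unique:
  fixes y z z' :: "4 \<Rightarrow> 'k::field"
  assumes hyps: "(2::'k) \<noteq> 0" "\<alpha> + \<beta> + \<gamma> + \<alpha> * \<beta> * \<gamma> = 0" "{\<alpha>, \<beta>, \<gamma>} \<inter> {0, 1, - 1} = {}"
    and pair: "twist_pair \<alpha> \<beta> \<gamma> y z" "twist_pair \<alpha> \<beta> \<gamma> y z'"
    and y: "y i = 1" "y 0 \<noteq> 0 \<longrightarrow> i = 0"
    and z: "z l = 1" "z 0 \<noteq> 0 \<longrightarrow> l = 0" and z': "z' l' = 1" "z' 0 \<noteq> 0 \<longrightarrow> l' = 0"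
  shows "z = z'"
  using hyps pair(1) y z
proof (cases rule: normalised_pair_cases)
  case c: coordinate
  show ?thesis
    using hyps pair(2) y z'
  proof (cases rule: normalised_pair_cases)
    case coordinate
    show ?thesis
    proof
      fix x
      have "z i = 1" "z' i = 1" using z(1) z'(1) c(1) coordinate(1) by simp_all
      then show "z x = z' x" using c(3)[of x] coordinate(3)[of x] by (cases "x = i") simp_all
    qed
  next
    case (family e1 e2 e3)
    have "y 1 = 0" using c(2)[of 1] family(1) by simp
    then show ?thesis using on_family_nonzero[OF family(3)] by simp
  qed
next
  case f: (family e1 e2 e3)
  show ?thesis
    using hyps pair(2) y z'
  proof (cases rule: normalised_pair_cases)
    case coordinate
    have "y 1 = 0" using f(1) coordinate(2)[of 1] by simp
    then show ?thesis using on_family_nonzero[OF f(3)] by simp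
  next
    case (family e1' e2' e3')
    have "e1' = e1 \<and> e2' = e2 \<and> e3' = e3"
      by (rule on_family_unique[OF hyps(1,3) f(3) family(3)])
    moreover have "z 0 = 1" "z' 0 = 1" using z(1) z'(1) f(2) family(2) by simp_all
    ultimately have "\<forall>x. z x = z' x"
      unfolding forall_4 f(4-6) family(4-6) by (simp only: simp_thms)
    then show ?thesis by blast
  qed
qed

text \<open>The type of the first pair persists: coordinate points repeat, and in a family the signs
  of later pairs agree because a point determines its triple.\<close>

lemma normalised_sequence_cases:
  fixes y :: "nat \<Rightarrow> 4 \<Rightarrow> 'k::field"
  assumes hyps: "(2::'k) \<noteq> 0" "\<alpha> + \<beta> + \<gamma> + \<alpha> * \<beta> * \<gamma> = 0" "{\<alpha>, \<beta>, \<gamma>} \<inter> {0, 1, - 1} = {}"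
    and pair: "\<And>j. twist_pair \<alpha> \<beta> \<gamma> (y j) (y (Suc j))"
    and y: "\<And>j. y j (r j) = 1" "\<And>j. y j 0 \<noteq> 0 \<longrightarrow> r j = 0"
  obtains (coordinate) i where "\<And>j. r j = i" "\<And>j l. l \<noteq> i \<Longrightarrow> y j l = 0"
  | (family) e1 e2 e3 where "\<And>j. r j = 0"
      "\<And>j. on_family \<alpha> \<beta> \<gamma> e1 e2 e3 (y j 1) (y j 2) (y j 3)"
      "\<And>j. y (Suc j) 1 = e1 * y j 1" "\<And>j. y (Suc j) 2 = e2 * y j 2" "\<And>j. y (Suc j) 3 = e3 * y j 3"
  using hyps pair[of 0] y[of 0] y[of "Suc 0"]
proof (cases rule: normalised_pair_cases)
  case c: coordinate
  have "r j = r 0 \<and> (\<forall>l. l \<noteq> r 0 \<longrightarrow> y j l = 0)" for j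
  proof (induction j)
    case 0
    then show ?case using c by blast
  next
    case (Suc j)
    show ?case
      using hyps pair[of j] y[of j] y[of "Suc j"]
    proof (cases rule: normalised_pair_cases)
      case coordinate
      then show ?thesis using Suc by simp
    next
      case (family e1 e2 e3)
      then have "y j 1 = 0" using Suc by simp
      then show ?thesis using on_family_nonzero[OF family(3)] by simp
    qed
  qed
  then show thesis using coordinate[of "r 0"] by blast
next
  case f: (family e1 e2 e3)
  have step: "r (Suc j) = 0 \<and> y (Suc j) 1 = e1 * y j 1 \<and> y (Suc j) 2 = e2 * y j 2 \<and> y (Suc j) 3 = e3 * y j 3"
    if fam: "on_family \<alpha> \<beta> \<gamma> e1 e2 e3 (y j 1) (y j 2) (y j 3)" and r: "r j = 0" for j
    using hyps pair[of j] y[of j] y[of "Suc j"]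
  proof (cases rule: normalised_pair_cases)
    case coordinate
    then have "y j 1 = 0" using r by simp
    then show ?thesis using on_family_nonzero[OF fam] by simp
  next
    case (family e1' e2' e3')
    then show ?thesis using on_family_unique[OF hyps(1,3) fam family(3)] by simp
  qed
  have fam: "r j = 0 \<and> on_family \<alpha> \<beta> \<gamma> e1 e2 e3 (y j 1) (y j 2) (y j 3)" for j
  proof (induction j)
    case 0
    then show ?case using f by blast
  next
    case (Suc j)
    then show ?case using step[of j] on_family_succ[of \<alpha> \<beta> \<gamma> e1 e2 e3 "y j 1" "y j 2" "y j 3"] by simp
  qed
  show thesis
    using family[of e1 e2 e3] fam step[OF conjunct2[OF fam] conjunct1[OF fam]] by simp
qed

text \<open>Rigidity in factor j comes from the relations between the factors j and j + 1, so it
  holds uniformly in all infinitely many factors.\<close>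

lemma multiplicity_one:
  fixes \<alpha> \<beta> \<gamma> :: "'k::field"
  assumes hyps: "(2::'k) \<noteq> 0" "\<alpha> + \<beta> + \<gamma> + \<alpha> * \<beta> * \<gamma> = 0" "{\<alpha>, \<beta>, \<gamma>} \<inter> {0, 1, - 1} = {}"
    and pair: "\<And>j. twist_pair \<alpha> \<beta> \<gamma> (y j) (y (Suc j))"
    and y: "\<And>j. y j (r j) = 1" "\<And>j. y j 0 \<noteq> 0 \<longrightarrow> r j = 0"
  shows "has_multiplicity (twist_relations \<alpha> \<beta> \<gamma>) (\<lambda>j. proj (y j)) 1"
proof -
  interpret projective_sequence y r by unfold_locales (rule y(1))
  define J where "J = point_scheme_stalk_ideal (twist_relations \<alpha> \<beta> \<gamma>) P"
  interpret li: local_ideal R J K val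
    unfolding J_def by (rule local_ideal_if_ideal[OF stalk_ideal])
  note rel = relations_in_stalk_ideal[where \<alpha> = \<alpha> and \<beta> = \<beta> and \<gamma> = \<gamma>, folded J_def]
  have "u j l - K (y j l) \<in> J" for j l
    using hyps pair y
  proof (cases rule: normalised_sequence_cases)
    case (coordinate i)
    show ?thesis
    proof (cases "l = i")
      case True
      then show ?thesis using u_chart[of j] y(1)[of j] coordinate(1)[of j] by (simp add: li.K_1 li.J_0)
    next
      case False
      have ui: "u m i = 1" for m using u_chart[of m] coordinate(1)[of m] by simp
      have "u j l \<in> J"
        by (rule li.coordinate_rigid[OF R_u R_u rel[where n = j] hyps(1,3), where i = i])
          (simp_all add: ui val_u coordinate(2) False)
      then show ?thesis using coordinate(2)[OF False, of j] by (simp add: li.K_0)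
    qed
  next
    case (family e1 e2 e3)
    have u0: "u m 0 = 1" for m using u_chart[of m] family(1)[of m] by simp
    have y0: "y m 0 = 1" for m using y(1)[of m] family(1)[of m] by simp
    have fam: "on_family \<alpha> \<beta> \<gamma> e1 e2 e3 (val (u j 1)) (val (u j 2)) (val (u j 3))"
      using family(2) by (simp only: val_u)
    have succ: "val (u (Suc j) 1) = e1 * val (u j 1)" "val (u (Suc j) 2) = e2 * val (u j 2)"
      "val (u (Suc j) 3) = e3 * val (u j 3)"
      using family(3-5) by (simp_all only: val_u)
    note f = rel[where n = j, unfolded u0 mult_1_left mult_1_right]
    have "u j 1 - K (y j 1) \<in> J" "u j 2 - K (y j 2) \<in> J" "u j 3 - K (y j 3) \<in> J"
      using li.family_point_rigid[OF R_u R_u R_u R_u R_u R_u f hyps fam succ] by (simp_all only: val_u)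
    moreover have "u j 0 - K (y j 0) \<in> J" by (simp add: u0 y0 li.K_1 li.J_0)
    ultimately have "\<forall>l. u j l - K (y j l) \<in> J" unfolding forall_4 by blast
    then show ?thesis ..
  qed
  then show ?thesis
    using has_multiplicity_1[of "twist_relations \<alpha> \<beta> \<gamma>"] twist_relations_vanishing[where y = y, OF _ _ pair]
    unfolding J_def P_def by blast
qed

section \<open>Distinctness and number of the points\<close>

lemma vec4_proj_eqD:
  assumes "pt a b c d = pt a' b' c' d'"
  obtains k where "k \<noteq> 0" "a = k * a'" "b = k * b'" "c = k * c'" "d = k * d'"
proof -
  have "vec4 a b c d \<in> proj (vec4 a' b' c' d')"
    using self_in_proj assms unfolding pt_eq by metis
  then obtain k where k: "k \<noteq> 0" "vec4 a b c d = (\<lambda>i. k * vec4 a' b' c' d' i)" by (rule proj_memE)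
  show thesis
    using that[OF k(1)] fun_cong[OF k(2), of 0] fun_cong[OF k(2), of 1] fun_cong[OF k(2), of 2]
      fun_cong[OF k(2), of 3]
    by simp
qed

lemma card_coordinate_points: "card (coordinate_points :: 'k::field point set) = 4"
proof -
  have "pt 1 0 0 0 \<noteq> (pt 0 1 0 0 :: 'k point)" "pt 1 0 0 0 \<noteq> (pt 0 0 1 0 :: 'k point)"
    "pt 1 0 0 0 \<noteq> (pt 0 0 0 1 :: 'k point)" "pt 0 1 0 0 \<noteq> (pt 0 0 1 0 :: 'k point)"
    "pt 0 1 0 0 \<noteq> (pt 0 0 0 1 :: 'k point)" "pt 0 0 1 0 \<noteq> (pt 0 0 0 1 :: 'k point)"
    by (auto elim: vec4_proj_eqD)
  then show ?thesis by (simp add: coordinate_points_def)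
qed

lemma affine_pt_inj: "pt 1 b c d = pt 1 b' c' d' \<Longrightarrow> b = b' \<and> c = c' \<and> d = d'"
  by (elim vec4_proj_eqD) simp

definition all_families :: "'k \<Rightarrow> 'k \<Rightarrow> 'k::field \<Rightarrow> ('k \<times> 'k \<times> 'k) set" where
  "all_families \<alpha> \<beta> \<gamma> = family_points \<alpha> \<beta> \<gamma> 1 1 1 \<union> family_points \<alpha> \<beta> \<gamma> 1 (- 1) (- 1) \<union>
     family_points \<alpha> \<beta> \<gamma> (- 1) 1 (- 1) \<union> family_points \<alpha> \<beta> \<gamma> (- 1) (- 1) 1"

lemma all_families_iff:
  "(p1, p2, p3) \<in> all_families \<alpha> \<beta> \<gamma> \<longleftrightarrow> (\<exists>e1 e2 e3. on_family \<alpha> \<beta> \<gamma> e1 e2 e3 p1 p2 p3)"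
proof -
  have "sign_triple e1 e2 e3" if "on_family \<alpha> \<beta> \<gamma> e1 e2 e3 p1 p2 p3" for e1 e2 e3
    using that unfolding on_family_def by blast
  then show ?thesis unfolding all_families_def family_points_def sign_triple_def by blast
qed

text \<open>One listed point for each sign triple; the rest of its family follows by the sign
  changes of \<open>family_points_eq\<close>.\<close>

lemma on_family_listed:
  fixes \<alpha> \<beta> \<gamma> a b c \<iota> :: "'k::field"
  assumes two: "(2::'k) \<noteq> 0" and nz: "\<alpha> \<noteq> 0" "\<beta> \<noteq> 0" "\<gamma> \<noteq> 0"
    and sq: "a\<^sup>2 = \<alpha>" "b\<^sup>2 = \<beta>" "c\<^sup>2 = \<gamma>" "\<iota>\<^sup>2 = - 1"
  shows "on_family \<alpha> \<beta> \<gamma> 1 1 1 \<iota> \<iota> 1"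
    and "on_family \<alpha> \<beta> \<gamma> 1 (- 1) (- 1) (- inverse (b * c)) (- inverse c) (- inverse b)"
    and "on_family \<alpha> \<beta> \<gamma> (- 1) 1 (- 1) (\<iota> * inverse c) (inverse (a * c)) (\<iota> * inverse a)"
    and "on_family \<alpha> \<beta> \<gamma> (- 1) (- 1) 1 (inverse b) (\<iota> * inverse a) (\<iota> * inverse (a * b))"
proof -
  have ne: "(- 1 :: 'k) \<noteq> 1" using two by (metis add.right_inverse one_add_one)
  have abc: "a \<noteq> 0" "b \<noteq> 0" "c \<noteq> 0" using nz sq by auto
  have ii: "\<iota> * \<iota> = - 1" "\<iota> * (\<iota> * x) = - x" for x
    using sq(4) by (simp_all add: power2_eq_square mult.assoc[symmetric])
  have i0: "\<iota> \<noteq> 0" using ii(1) by auto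
  have sq': "\<alpha> = a * a" "\<beta> = b * b" "\<gamma> = c * c" using sq by (simp_all add: power2_eq_square)
  note simps = on_family_def sign_triple_def family_coeff_def ne abc i0 ii sq'
  show "on_family \<alpha> \<beta> \<gamma> 1 1 1 \<iota> \<iota> 1" by (simp add: simps)
  show "on_family \<alpha> \<beta> \<gamma> 1 (- 1) (- 1) (- inverse (b * c)) (- inverse c) (- inverse b)"
    by (simp add: simps field_simps)
  show "on_family \<alpha> \<beta> \<gamma> (- 1) 1 (- 1) (\<iota> * inverse c) (inverse (a * c)) (\<iota> * inverse a)"
    by (simp add: simps field_simps)
  show "on_family \<alpha> \<beta> \<gamma> (- 1) (- 1) 1 (inverse b) (\<iota> * inverse a) (\<iota> * inverse (a * b))"
    by (simp add: simps field_simps)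
qed

text \<open>Two consecutive entries of the list, each with both signs, are the four sign changes of
  one family.\<close>

lemma Gamma'_eq:
  fixes \<alpha> \<beta> \<gamma> a b c \<iota> :: "'k::field"
  assumes "(2::'k) \<noteq> 0" "\<alpha> \<noteq> 0" "\<beta> \<noteq> 0" "\<gamma> \<noteq> 0" "a\<^sup>2 = \<alpha>" "b\<^sup>2 = \<beta>" "c\<^sup>2 = \<gamma>" "\<iota>\<^sup>2 = - 1"
  shows "Gamma' a b c \<iota> = (\<lambda>(p1, p2, p3). pt 1 p1 p2 p3) ` all_families \<alpha> \<beta> \<gamma>"
proof -
  have four: "(\<lambda>(s, t). (s * t * q1, s * q2, t * q3)) ` ({1, - 1} \<times> {1, - 1}) =
      {(q1, q2, q3), (- q1, q2, - q3), (- q1, - q2, q3), (q1, - q2, - q3)}" for q1 q2 q3 :: 'k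
    by auto
  note fams = on_family_listed[OF assms, THEN family_points_eq, unfolded four]
  show ?thesis
    unfolding all_families_def fams Gamma'_def by (simp add: image_Un insert_commute)
qed

text \<open>Four families of four points, disjoint because the signs are unique; distinct triples
  differ already in the first two signs.\<close>

lemma card_all_families:
  fixes \<alpha> \<beta> \<gamma> a b c \<iota> :: "'k::field"
  assumes two: "(2::'k) \<noteq> 0" and nz: "{\<alpha>, \<beta>, \<gamma>} \<inter> {0, 1, - 1} = {}"
    and sq: "a\<^sup>2 = \<alpha>" "b\<^sup>2 = \<beta>" "c\<^sup>2 = \<gamma>" "\<iota>\<^sup>2 = - 1"
  shows "card (all_families \<alpha> \<beta> \<gamma>) = 16"
proof -
  have ne: "(- 1 :: 'k) \<noteq> 1" using two by (metis add.right_inverse one_add_one)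
  have n0: "\<alpha> \<noteq> 0" "\<beta> \<noteq> 0" "\<gamma> \<noteq> 0" using nz by auto
  note card = on_family_listed[OF two n0 sq, THEN card_family_points[OF two]]
  have fin: "finite (family_points \<alpha> \<beta> \<gamma> 1 1 1)" "finite (family_points \<alpha> \<beta> \<gamma> 1 (- 1) (- 1))"
    "finite (family_points \<alpha> \<beta> \<gamma> (- 1) 1 (- 1))" "finite (family_points \<alpha> \<beta> \<gamma> (- 1) (- 1) 1)"
    using card by (auto intro: card_ge_0_finite)
  have disj: "family_points \<alpha> \<beta> \<gamma> e1 e2 e3 \<inter> family_points \<alpha> \<beta> \<gamma> e1' e2' e3' = {}"
    if "e1 \<noteq> e1' \<or> e2 \<noteq> e2'" for e1 e2 e3 e1' e2' e3'
    using on_family_unique[OF two nz] that unfolding family_points_def by blast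
  show ?thesis
    unfolding all_families_def
    by (simp add: card_Un_disjoint fin card disj ne ne[symmetric] Int_Un_distrib2)
qed

theorem theorem4p2p20:
  fixes \<alpha> \<beta> \<gamma> :: "'k::alg_closed_field"
    and a b c \<iota> :: 'k
    and \<sigma> :: "'k point \<Rightarrow> 'k point"
  assumes "CHAR('k) \<noteq> 2"
    and "\<alpha> + \<beta> + \<gamma> + \<alpha> * \<beta> * \<gamma> = 0"
    and "{\<alpha>, \<beta>, \<gamma>} \<inter> {0, 1, - 1} = {}"
    and "sklyanin_automorphism \<alpha> \<beta> \<gamma> \<sigma>"
    and "infinite_order_on (sklyanin_curve \<alpha> \<beta> \<gamma>) \<sigma>"
    and "a\<^sup>2 = \<alpha>" and "b\<^sup>2 = \<beta>" and "c\<^sup>2 = \<gamma>" and "\<iota>\<^sup>2 = - 1"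
  shows "bij_betw (\<lambda>P. P 0) (point_scheme (twist_relations \<alpha> \<beta> \<gamma>))
           (Gamma' a b c \<iota> \<union> coordinate_points)
       \<and> card (Gamma' a b c \<iota> \<union> coordinate_points) = 20
       \<and> (\<forall>P\<in>point_scheme (twist_relations \<alpha> \<beta> \<gamma>).
            has_multiplicity (twist_relations \<alpha> \<beta> \<gamma>) P 1)"
proof -
  \<comment> \<open>If 2 were 0, the characteristic would be a divisor of 2 other than 1, that is, 2
    itself.\<close>
  have two: "(2::'k) \<noteq> 0"
  proof
    assume "(2::'k) = 0"
    then have "of_nat 2 = (0::'k)" by simp
    then have dvd: "CHAR('k) dvd 2" unfolding of_nat_eq_0_iff_char_dvd .
    then have "CHAR('k) \<le> 2" by (rule dvd_imp_le) simp
    moreover have "CHAR('k) \<noteq> 0" using dvd by (metis dvd_0_left_iff zero_neq_numeral)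
    moreover have "CHAR('k) \<noteq> 1"
      using of_nat_eq_0_iff_char_dvd[where 'a = 'k, of 1] by auto
    ultimately show False using assms(1) by linarith
  qed
  note hyps = two assms(2,3)
  have n0: "\<alpha> \<noteq> 0" "\<beta> \<noteq> 0" "\<gamma> \<noteq> 0" using assms(3) by auto
  let ?X = "point_scheme (twist_relations \<alpha> \<beta> \<gamma>)"
  have Gamma': "Gamma' a b c \<iota> = (\<lambda>(p1, p2, p3). pt 1 p1 p2 p3) ` all_families \<alpha> \<beta> \<gamma>"
    by (rule Gamma'_eq[OF two n0 assms(6-9)])
  have "\<forall>p\<in>proj_space. \<exists>yi. p = proj (fst yi) \<and> fst yi (snd yi) = (1::'k) \<and>
      (fst yi 0 \<noteq> 0 \<longrightarrow> snd yi = 0)"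
  proof
    fix p :: "'k point" assume "p \<in> proj_space"
    then obtain y i where "p = proj y" "y i = 1" "y 0 \<noteq> 0 \<longrightarrow> i = 0"
      by (rule proj_space_normalised)
    then show "\<exists>yi. p = proj (fst yi) \<and> fst yi (snd yi) = 1 \<and> (fst yi 0 \<noteq> 0 \<longrightarrow> snd yi = 0)"
      by (intro exI[of _ "(y, i)"]) simp
  qed
  \<comment> \<open>One normalised representative is fixed for each point, so that equal points have
    equal vectors and charts; the induction for injectivity relies on this.\<close>
  then obtain N :: "'k point \<Rightarrow> (4 \<Rightarrow> 'k) \<times> 4" where N: "\<forall>p\<in>proj_space. p = proj (fst (N p)) \<and>
      fst (N p) (snd (N p)) = 1 \<and> (fst (N p) 0 \<noteq> 0 \<longrightarrow> snd (N p) = 0)"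
    by (rule bchoice[THEN exE])
  define Y where "Y P = (\<lambda>j. fst (N (P j)))" for P :: "nat \<Rightarrow> 'k point"
  define r where "r P = (\<lambda>j. snd (N (P j)))" for P :: "nat \<Rightarrow> 'k point"
  have Y: "P j = proj (Y P j)" "Y P j (r P j) = 1" "Y P j 0 \<noteq> 0 \<longrightarrow> r P j = 0"
    if "P \<in> ?X" for P j
  proof -
    have "P j \<in> proj_space" using that unfolding point_scheme_def by blast
    then show "P j = proj (Y P j)" "Y P j (r P j) = 1" "Y P j 0 \<noteq> 0 \<longrightarrow> r P j = 0"
      using N unfolding Y_def r_def by blast+
  qed
  have pair: "twist_pair \<alpha> \<beta> \<gamma> (Y P j) (Y P (Suc j))" if "P \<in> ?X" for P j
    using point_scheme_iff[of P "Y P" "r P" \<alpha> \<beta> \<gamma>, OF Y(1)[OF that] Y(2)[OF that]] that by blast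
  have "inj_on (\<lambda>P. P 0) ?X"
  proof (rule inj_onI)
    fix P P' assume P: "P \<in> ?X" and P': "P' \<in> ?X" and eq: "P 0 = P' 0"
    have "P j = P' j" for j
    proof (induction j)
      case 0
      then show ?case by (rule eq)
    next
      case (Suc j)
      then have Yj: "Y P j = Y P' j" "r P j = r P' j" by (simp_all add: Y_def r_def)
      have "Y P (Suc j) = Y P' (Suc j)"
        by (rule normalised_pair_unique[OF hyps pair[OF P, of j] pair[OF P', of j, folded Yj(1)]
              Y(2,3)[OF P, of j] Y(2,3)[OF P, of "Suc j"] Y(2,3)[OF P', of "Suc j"]])
      then show ?case using Y(1)[OF P] Y(1)[OF P'] by metis
    qed
    then show "P = P'" by blast
  qed
  moreover have "(\<lambda>P. P 0) ` ?X \<subseteq> Gamma' a b c \<iota> \<union> coordinate_points"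
  proof (rule image_subsetI)
    fix P assume P: "P \<in> ?X"
    show "P 0 \<in> Gamma' a b c \<iota> \<union> coordinate_points"
      using hyps pair[OF P, of 0] Y(2,3)[OF P, of 0] Y(2,3)[OF P, of "Suc 0"]
    proof (cases rule: normalised_pair_cases)
      case coordinate
      then have "P 0 \<in> coordinate_points"
        unfolding coordinate_points_iff using Y(1,2)[OF P, of 0] by blast
      then show ?thesis ..
    next
      case (family e1 e2 e3)
      have "P 0 = proj (vec4 (Y P 0 0) (Y P 0 1) (Y P 0 2) (Y P 0 3))"
        unfolding vec4_eta by (rule Y(1)[OF P])
      also have "Y P 0 0 = 1" using Y(2)[OF P, of 0] family(1) by simp
      finally have "P 0 = pt 1 (Y P 0 1) (Y P 0 2) (Y P 0 3)" by (simp only: pt_eq)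
      moreover have "(Y P 0 1, Y P 0 2, Y P 0 3) \<in> all_families \<alpha> \<beta> \<gamma>"
        unfolding all_families_iff using family(3) by blast
      ultimately show ?thesis unfolding Gamma' by force
    qed
  qed
  moreover have "coordinate_points \<subseteq> (\<lambda>P. P 0) ` ?X"
  proof
    fix p :: "'k point" assume "p \<in> coordinate_points"
    then obtain y i where y: "p = proj y" "y i = 1" "\<forall>l. l \<noteq> i \<longrightarrow> y l = 0"
      unfolding coordinate_points_iff by blast
    \<comment> \<open>Every relation involves only products of distinct coordinates, so a coordinate
      point may follow itself and the constant sequence is a point of the scheme.\<close>
    have "y l * y m = 0" if "l \<noteq> m" for l m using y(3) that by (metis mult_eq_0_iff)
    then have "twist_pair \<alpha> \<beta> \<gamma> y y" by (simp add: twist_pair_def del: mult_eq_0_iff)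
    then have "(\<lambda>j. p) \<in> ?X"
      using point_scheme_iff[of "\<lambda>j. p" "\<lambda>j. y" "\<lambda>j. i" \<alpha> \<beta> \<gamma>] y by simp
    then show "p \<in> (\<lambda>P. P 0) ` ?X" by force
  qed
  moreover have "Gamma' a b c \<iota> \<subseteq> (\<lambda>P. P 0) ` ?X"
  proof
    fix p assume "p \<in> Gamma' a b c \<iota>"
    then obtain p1 p2 p3 e1 e2 e3 where p: "p = pt 1 p1 p2 p3"
      and fam: "on_family \<alpha> \<beta> \<gamma> e1 e2 e3 p1 p2 p3"
      unfolding Gamma' using all_families_iff by fastforce
    \<comment> \<open>The successor rule applied j times produces the powers of the signs, with
      coordinate 0 kept at 1.\<close>
    define y where "y j = vec4 1 (e1 ^ j * p1) (e2 ^ j * p2) (e3 ^ j * p3)" for j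
    have "on_family \<alpha> \<beta> \<gamma> e1 e2 e3 (e1 ^ j * p1) (e2 ^ j * p2) (e3 ^ j * p3)" for j
      by (induction j) (use fam on_family_succ in \<open>auto simp: mult.assoc\<close>)
    then have "twist_pair \<alpha> \<beta> \<gamma> (y j) (y (Suc j))" for j
      by (intro on_family_twist_pair[OF two, of _ _ _ e1 e2 e3]) (simp_all add: y_def)
    then have "(\<lambda>j. proj (y j)) \<in> ?X"
      using point_scheme_iff[of "\<lambda>j. proj (y j)" y "\<lambda>j. 0" \<alpha> \<beta> \<gamma>] by (simp add: y_def)
    moreover have "proj (y 0) = p" by (simp add: y_def p pt_eq)
    ultimately show "p \<in> (\<lambda>P. P 0) ` ?X" by force
  qed
  ultimately have "bij_betw (\<lambda>P. P 0) ?X (Gamma' a b c \<iota> \<union> coordinate_points)"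
    unfolding bij_betw_def by blast
  moreover have "card (Gamma' a b c \<iota> \<union> coordinate_points) = 20"
  proof -
    have "inj_on (\<lambda>(p1, p2, p3). pt 1 p1 p2 p3) (all_families \<alpha> \<beta> \<gamma>)"
      by (auto simp: inj_on_def dest: affine_pt_inj)
    then have card: "card (Gamma' a b c \<iota>) = 16"
      unfolding Gamma' using card_all_families[OF two assms(3,6-9)] by (simp add: card_image)
    have "Gamma' a b c \<iota> \<inter> coordinate_points = {}"
    proof -
      have "pt 1 p1 p2 p3 \<notin> coordinate_points" if "p1 \<noteq> 0" "p2 \<noteq> 0" for p1 p2 p3 :: 'k
        using that unfolding coordinate_points_def by (auto elim: vec4_proj_eqD)
      moreover have "p1 \<noteq> 0 \<and> p2 \<noteq> 0" if "(p1, p2, p3) \<in> all_families \<alpha> \<beta> \<gamma>" for p1 p2 p3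
        using that on_family_nonzero unfolding all_families_iff by blast
      ultimately show ?thesis unfolding Gamma' by auto
    qed
    moreover have "finite (Gamma' a b c \<iota>)" "finite (coordinate_points :: 'k point set)"
      by (simp_all add: Gamma'_def coordinate_points_def)
    ultimately show ?thesis by (simp add: card_Un_disjoint card card_coordinate_points)
  qed
  moreover have "has_multiplicity (twist_relations \<alpha> \<beta> \<gamma>) P 1" if P: "P \<in> ?X" for P
  proof -
    have "(\<lambda>j. proj (Y P j)) = P" by (rule ext) (rule Y(1)[OF P, symmetric])
    moreover have "has_multiplicity (twist_relations \<alpha> \<beta> \<gamma>) (\<lambda>j. proj (Y P j)) 1"
      by (rule multiplicity_one[where y = "Y P" and r = "r P", OF hyps pair[OF P] Y(2,3)[OF P]])
    ultimately show ?thesis by (simp only:)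
  qed
  ultimately show ?thesis by blast
qed

end
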